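(* Let $h>0$ and let $\mu_1(h)\le\mu_2(h)\le\mu_3(h)\le\cdots$ be the eigenvalues of the biharmonic operator with Dirichlet boundary conditions acting in $L^2(R_h)$, $R_h=[0,h]\times[0,1]$. Let $\rho_n(\alpha)$ be the $n$-th eigenvalue of $H(1,\alpha)$. Then $$\lambda_1(h):=\rho_1(\pi^2h^2)h^{-4}+\rho_1(\pi^2h^{-2})-2\pi^4h^{-2}\le\mu_1(h)$$ and $$\lambda_3(h):=\min\left\{\begin{array}{l}\rho_1(\pi^2h^2)h^{-4}+\rho_2(\pi^2h^{-2})-2\pi^4h^{-2},\\ \rho_3(\pi^2h^2)h^{-4}+\rho_1(\pi^2h^{-2})-2\pi^4h^{-2}\end{array}\right\}\le\mu_3(h).$$
   Context: The biharmonic operator $\Delta^2|_{\mathrm{DIR}}$ acting in $L^2(R_h)$ is the non-negative self-adjoint operator associated with the closed quadratic form $Q(f)=\int_{R_h}|\Delta f|^2$ if $f\in W^{2,2}_0(R_h)$, and $Q(f)=\infty$ otherwise; it has compact resolvent, and its eigenvalues $\mu_n(h)$ are listed in increasing order, repeated according to multiplicity. For $h>0$, $\alpha\in\mathbb R$, $H(h,\alpha)=\frac{d^4}{dx^4}-2\alpha\frac{d^2}{dx^2}$ is the self-adjoint operator acting in $L^2([0,h])$ with quadratic form domain $W^{2,2}_0([0,h])$ (quadratic form $\int_0^h|f''|^2+2\alpha\int_0^h|f'|^2$). It is bounded below with compact resolvent; its eigenvalues are listed in increasing order, repeated according to multiplicity, and $\rho_n(\alpha)$ denotes the $n$-th eigenvalue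 of $H(1,\alpha)$. *)

theory Defs
  imports "HOL-Analysis.Analysis"
begin

section \<open>Complex \<open>L\<^sup>2\<close> on a region\<close>

text \<open>Elements of \<open>L\<^sup>2(U)\<close> are represented by functions on the whole space; only their values
  almost everywhere in \<open>U\<close> matter.\<close>

definition L2 :: "'a::euclidean_space set \<Rightarrow> ('a \<Rightarrow> complex) set" where
  "L2 U = {f. set_borel_measurable lborel U f \<and>
              set_integrable lborel U (\<lambda>x. (cmod (f x))\<^sup>2)}"

definition L2_inner :: "'a::euclidean_space set \<Rightarrow> ('a \<Rightarrow> complex) \<Rightarrow> ('a \<Rightarrow> complex) \<Rightarrow> complex" where
  "L2_inner U f g = (LINT x:U|lborel. f x * cnj (g x))"

definition L2_norm :: "'a::euclidean_space set \<Rightarrow> ('a \<Rightarrow> complex) \<Rightarrow> real" where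
  "L2_norm U f = sqrt (LINT x:U|lborel. (cmod (f x))\<^sup>2)"


section \<open>Weak derivatives and Sobolev spaces\<close>

definition partial_deriv :: "'a::euclidean_space \<Rightarrow> ('a \<Rightarrow> complex) \<Rightarrow> 'a \<Rightarrow> complex" where
  "partial_deriv b f = (\<lambda>x. frechet_derivative f (at x) b)"

primrec Ck :: "nat \<Rightarrow> ('a::euclidean_space \<Rightarrow> complex) \<Rightarrow> bool" where
  "Ck 0 f \<longleftrightarrow> continuous_on UNIV f"
| "Ck (Suc k) f \<longleftrightarrow> f differentiable_on UNIV \<and> (\<forall>b\<in>Basis. Ck k (partial_deriv b f))"

definition test_functions :: "'a::euclidean_space set \<Rightarrow> ('a \<Rightarrow> complex) set" where
  "test_functions U = {\<phi>. (\<forall>k. Ck k \<phi>) \<and>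
     compact (closure {x. \<phi> x \<noteq> 0}) \<and> closure {x. \<phi> x \<noteq> 0} \<subseteq> U}"

definition has_weak_deriv ::
    "'a::euclidean_space set \<Rightarrow> 'a \<Rightarrow> ('a \<Rightarrow> complex) \<Rightarrow> ('a \<Rightarrow> complex) \<Rightarrow> bool" where
  "has_weak_deriv U b f g \<longleftrightarrow> f \<in> L2 U \<and> g \<in> L2 U \<and>
     (\<forall>\<phi>\<in>test_functions U.
        (LINT x:U|lborel. f x * partial_deriv b \<phi> x) = - (LINT x:U|lborel. g x * \<phi> x))"

text \<open>The weak derivative is unique up to null sets, so for open \<open>U\<close> the choice below is immaterial.\<close>

definition weak_deriv ::
    "'a::euclidean_space set \<Rightarrow> 'a \<Rightarrow> ('a \<Rightarrow> complex) \<Rightarrow> ('a \<Rightarrow> complex)" where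
  "weak_deriv U b f = (SOME g. has_weak_deriv U b f g)"

definition W12 :: "'a::euclidean_space set \<Rightarrow> ('a \<Rightarrow> complex) set" where
  "W12 U = {f \<in> L2 U. \<forall>b\<in>Basis. \<exists>g. has_weak_deriv U b f g}"

definition W22 :: "'a::euclidean_space set \<Rightarrow> ('a \<Rightarrow> complex) set" where
  "W22 U = {f \<in> W12 U. \<forall>b\<in>Basis. weak_deriv U b f \<in> W12 U}"

definition W22_norm :: "'a::euclidean_space set \<Rightarrow> ('a \<Rightarrow> complex) \<Rightarrow> real" where
  "W22_norm U f = sqrt ((L2_norm U f)\<^sup>2
     + (\<Sum>b\<in>Basis. (L2_norm U (weak_deriv U b f))\<^sup>2)
     + (\<Sum>b\<in>Basis. \<Sum>c\<in>Basis. (L2_norm U (weak_deriv U c (weak_deriv U b f)))\<^sup>2))"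

definition W22_0 :: "'a::euclidean_space set \<Rightarrow> ('a \<Rightarrow> complex) set" where
  "W22_0 U = {f \<in> W22 U. \<forall>\<epsilon>>0. \<exists>\<phi>\<in>test_functions U. W22_norm U (\<lambda>x. f x - \<phi> x) < \<epsilon>}"

definition weak_laplacian :: "'a::euclidean_space set \<Rightarrow> ('a \<Rightarrow> complex) \<Rightarrow> ('a \<Rightarrow> complex)" where
  "weak_laplacian U f = (\<lambda>x. \<Sum>b\<in>Basis. weak_deriv U b (weak_deriv U b f) x)"


section \<open>Operators associated with forms, and their eigenvalues\<close>

text \<open>The graph of the operator in \<open>L\<^sup>2(U)\<close> associated with the closed form whose domain is \<open>D\<close> and
  whose sesquilinear (polarised) version is \<open>q\<close>: \<open>f\<close> is in the operator domain with image \<open>g\<close> iff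
  \<open>q(f,v) = \<langle>g,v\<rangle>\<close> for all \<open>v\<close> in \<open>D\<close>.\<close>

definition form_operator :: "'a::euclidean_space set \<Rightarrow> ('a \<Rightarrow> complex) set \<Rightarrow>
    (('a \<Rightarrow> complex) \<Rightarrow> ('a \<Rightarrow> complex) \<Rightarrow> complex) \<Rightarrow> (('a \<Rightarrow> complex) \<times> ('a \<Rightarrow> complex)) set" where
  "form_operator U D q = {(f, g). f \<in> D \<and> g \<in> L2 U \<and> (\<forall>v\<in>D. q f v = L2_inner U g v)}"

definition eigenspace ::
    "(('a \<Rightarrow> complex) \<times> ('a \<Rightarrow> complex)) set \<Rightarrow> real \<Rightarrow> ('a \<Rightarrow> complex) set" where
  "eigenspace T r = {f. (f, \<lambda>x. of_real r * f x) \<in> T}"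

text \<open>Complex dimension is taken modulo equality almost everywhere in \<open>U\<close>: some \<open>m\<close> members of \<open>E\<close>
  span \<open>E\<close> and are linearly independent, both up to null sets.\<close>

definition has_dimension_ae ::
    "'a::euclidean_space set \<Rightarrow> ('a \<Rightarrow> complex) set \<Rightarrow> nat \<Rightarrow> bool" where
  "has_dimension_ae U E m \<longleftrightarrow> (\<exists>\<phi> :: nat \<Rightarrow> 'a \<Rightarrow> complex.
     (\<forall>i<m. \<phi> i \<in> E) \<and>
     (\<forall>f\<in>E. \<exists>c. AE x in lborel. x \<in> U \<longrightarrow> f x = (\<Sum>i<m. c i * \<phi> i x)) \<and>
     (\<forall>c. (AE x in lborel. x \<in> U \<longrightarrow> (\<Sum>i<m. c i * \<phi> i x) = 0) \<longrightarrow> (\<forall>i<m. c i = 0)))"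

text \<open>\<open>\<mu> 1 \<le> \<mu> 2 \<le> \<dots>\<close> are all the eigenvalues of \<open>T\<close>, each repeated according to its (finite)
  multiplicity; a real \<open>r\<close> that is not an eigenvalue has multiplicity 0 and does not occur.
  The value \<open>\<mu> 0\<close> is irrelevant.\<close>

definition lists_eigenvalues :: "'a::euclidean_space set \<Rightarrow>
    (('a \<Rightarrow> complex) \<times> ('a \<Rightarrow> complex)) set \<Rightarrow> (nat \<Rightarrow> real) \<Rightarrow> bool" where
  "lists_eigenvalues U T \<mu> \<longleftrightarrow>
     mono_on {1..} \<mu> \<and>
     (\<forall>r. finite {n. 1 \<le> n \<and> \<mu> n = r} \<and>
          has_dimension_ae U (eigenspace T r) (card {n. 1 \<le> n \<and> \<mu> n = r}))"


section \<open>The two operators\<close>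

text \<open>The boundaries of \<open>[0,h] \<times> [0,1]\<close> and \<open>[0,h]\<close> are null sets, so \<open>L\<^sup>2\<close> may be taken over the
  interiors, on which the Sobolev spaces are defined.\<close>

definition rect :: "real \<Rightarrow> (real \<times> real) set" where
  "rect h = {0<..<h} \<times> {0<..<1}"

definition biharmonic_dir ::
    "real \<Rightarrow> ((real \<times> real \<Rightarrow> complex) \<times> (real \<times> real \<Rightarrow> complex)) set" where
  "biharmonic_dir h = form_operator (rect h) (W22_0 (rect h))
     (\<lambda>f g. L2_inner (rect h) (weak_laplacian (rect h) f) (weak_laplacian (rect h) g))"

definition H_op :: "real \<Rightarrow> real \<Rightarrow> ((real \<Rightarrow> complex) \<times> (real \<Rightarrow> complex)) set" where
  "H_op h \<alpha> = (let I = {0<..<h}; D = weak_deriv I 1 in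
     form_operator I (W22_0 I)
       (\<lambda>f g. L2_inner I (D (D f)) (D (D g)) + 2 * of_real \<alpha> * L2_inner I (D f) (D g)))"

end

theory Submission
  imports Defs "HOL-Complex_Analysis.Great_Picard"
begin

text \<open>On \<open>W\<^sup>2\<^sup>,\<^sup>2\<^sub>0(R\<^sub>h)\<close> the biharmonic form is \<open>\<parallel>f\<^sub>x\<^sub>x\<parallel>\<^sup>2 + 2\<parallel>f\<^sub>x\<^sub>y\<parallel>\<^sup>2 + \<parallel>f\<^sub>y\<^sub>y\<parallel>\<^sup>2\<close>. The operators
  \<open>-\<partial>\<^sub>x\<^sup>2 - \<pi>\<^sup>2/h\<^sup>2\<close> and \<open>-\<partial>\<^sub>y\<^sup>2 - \<pi>\<^sup>2\<close> with Dirichlet conditions are non-negative, hence so is their tensor product, that is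
  \<open>\<parallel>f\<^sub>x\<^sub>y\<parallel>\<^sup>2 \<ge> \<pi>\<^sup>2\<parallel>f\<^sub>x\<parallel>\<^sup>2 + (\<pi>\<^sup>2/h\<^sup>2)\<parallel>f\<^sub>y\<parallel>\<^sup>2 - (\<pi>\<^sup>4/h\<^sup>2)\<parallel>f\<parallel>\<^sup>2\<close>. The biharmonic operator therefore dominates the tensor sum of
  \<open>H(h, \<pi>\<^sup>2)\<close> and \<open>H(1, \<pi>\<^sup>2/h\<^sup>2)\<close>, shifted by \<open>-2\<pi>\<^sup>4/h\<^sup>2\<close>, where \<open>H(h, \<pi>\<^sup>2)\<close> has the eigenvalues \<open>\<rho>\<^sub>n(\<pi>\<^sup>2h\<^sup>2)/h\<^sup>4\<close> by scaling.
  Only the tensor products of the lowest eigenfunction in \<open>y\<close> with the two lowest in \<open>x\<close> can give values of the sum below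
  \<open>\<lambda>\<^sub>3(h)\<close>; a combination of three eigenfunctions for \<open>\<mu>\<^sub>1, \<mu>\<^sub>2, \<mu>\<^sub>3\<close> can be chosen orthogonal to both. The spectral bounds in
  one dimension come from minimising the form on orthogonal complements of eigenfunctions.\<close>

text \<open>The spectral argument runs in opposite directions in the two dimensions. On the
  rectangle the list \<open>\<mu>\<close> supplies the trial functions, so a form inequality is what
  has to be proved there. On the interval a lower bound by the listed \<open>\<rho>\<close> needs
  eigenvectors found by minimisation, matched with the list by counting multiplicities; hence
  compactness and completeness are established in one dimension. The one-dimensional bounds are
  quadratic inequalities for every function, with a finite-rank correction, instead of statements
  about orthogonal complements: in this shape they apply to each slice of \<open>f\<close> and can
  be integrated. Slicing uses pointwise derivatives, so the two-dimensional estimates are for test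
  functions, and the resulting inequality is extended to \<open>W22_0\<close> by continuity.
  Positivity of the tensor product comes from a factorisation: with D = d/dx - k cot(kx), k = pi/h,
  the square norm of D u is the form of -d^2/dx^2 - k^2. D commutes with d/dy, so the Poincare
  inequality in y can be applied to D f. Twice the resulting bound for the mixed derivative gives
  the first-order terms of both operators and the shift.\<close>

lemma homogeneous_system_nontrivial:
  fixes A :: "nat \<Rightarrow> nat \<Rightarrow> complex"
  assumes "d < p"
  shows "\<exists>c. (\<exists>i<p. c i \<noteq> 0) \<and> (\<forall>j<d. (\<Sum>i<p. A j i * c i) = 0)"
  using assms
proof (induction d arbitrary: p A)
  case 0
  then show ?case by (intro exI[of _ "\<lambda>_. 1"]) auto
next
  case (Suc d)
  show ?case
  proof (cases "\<forall>i<p. A d i = 0")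
    case True
    from Suc.IH[of p A] Suc.prems obtain c where
      c: "\<exists>i<p. c i \<noteq> 0" "\<forall>j<d. (\<Sum>i<p. A j i * c i) = 0" by auto
    with True show ?thesis by (intro exI[of _ c]) (auto simp: less_Suc_eq)
  next
    case False
    then obtain k where k: "k < p" "A d k \<noteq> 0" by auto
    from Suc.prems obtain p' where p': "p = Suc p'" "d < p'" by (cases p) auto
    \<comment> \<open>Enumerates the unknowns other than the pivot unknown \<open>k\<close>.\<close>
    define e where "e i = (if i < k then i else Suc i)" for i
    have e_img: "e ` {..<p'} = {..<p} - {k}"
    proof (intro set_eqI iffI)
      fix x assume "x \<in> {..<p} - {k}"
      then have "x = e (if x < k then x else x - 1)" "(if x < k then x else x - 1) < p'"
        using k p' by (auto simp: e_def)
      then show "x \<in> e ` {..<p'}" by blast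
    qed (use k p' in \<open>auto simp: e_def\<close>)
    have e_inj: "inj e" by (auto simp: inj_def e_def split: if_splits)
    \<comment> \<open>Gaussian elimination: row \<open>j\<close> after the pivot unknown has been
      substituted out by means of equation \<open>d\<close>. Afterwards \<open>c'\<close> recovers
      the value of that unknown from equation \<open>d\<close>.\<close>
    define B where "B j i = A j (e i) - A j k * A d (e i) / A d k" for j i
    from Suc.IH[of p' B] p' obtain c where
      c: "\<exists>i<p'. c i \<noteq> 0" "\<forall>j<d. (\<Sum>i<p'. B j i * c i) = 0" by auto
    define c' where "c' i = (if i = k then - (\<Sum>i<p'. A d (e i) * c i) / A d k
      else c (the_inv e i))" for i
    have c'e: "c' (e i) = c i" for i
    proof -
      have "e i \<noteq> k" by (auto simp: e_def)
      then show ?thesis using the_inv_f_f[OF e_inj] by (auto simp: c'_def)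
    qed
    have split: "(\<Sum>i<p. A j i * c' i) = A j k * c' k + (\<Sum>i<p'. A j (e i) * c i)" for j
    proof -
      have "(\<Sum>i<p. A j i * c' i) = A j k * c' k + (\<Sum>i\<in>{..<p}-{k}. A j i * c' i)"
        using k by (subst sum.remove[of _ k]) auto
      also have "(\<Sum>i\<in>{..<p}-{k}. A j i * c' i) = (\<Sum>i<p'. A j (e i) * c i)"
        unfolding e_img[symmetric]
        by (subst sum.reindex) (use e_inj in \<open>auto simp: inj_on_def inj_def c'e\<close>)
      finally show ?thesis .
    qed
    have ck: "c' k = - (\<Sum>i<p'. A d (e i) * c i) / A d k" by (simp add: c'_def)
    have "(\<Sum>i<p. A j i * c' i) = 0" if "j < d" for j
    proof -
      have "0 = (\<Sum>i<p'. B j i * c i)" using c that by simp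
      also have "\<dots> = (\<Sum>i<p'. A j (e i) * c i) - A j k / A d k * (\<Sum>i<p'. A d (e i) * c i)"
        by (simp add: B_def algebra_simps sum_subtractf sum_distrib_left)
      finally show ?thesis by (simp add: split ck)
    qed
    moreover have "(\<Sum>i<p. A d i * c' i) = 0" using k by (simp add: split ck)
    moreover have "\<exists>i<p. c' i \<noteq> 0"
    proof -
      from c obtain i where i: "i < p'" "c i \<noteq> 0" by auto
      then have "e i < p" using p' by (auto simp: e_def)
      then show ?thesis using i c'e by metis
    qed
    ultimately show ?thesis by (auto simp: less_Suc_eq)
  qed
qed

section \<open>Semidefinite Hermitian forms on function spaces\<close>

text \<open>Functions that agree almost everywhere are not identified, and forms built from
  derivatives may have a kernel, so only semidefiniteness is assumed; no quotient space is
  formed.\<close>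

locale semi_inner =
  fixes V :: "('a \<Rightarrow> complex) set" and s :: "('a \<Rightarrow> complex) \<Rightarrow> ('a \<Rightarrow> complex) \<Rightarrow> complex"
  assumes zero_mem: "(\<lambda>x. 0) \<in> V"
    and add_mem: "u \<in> V \<Longrightarrow> v \<in> V \<Longrightarrow> (\<lambda>x. u x + v x) \<in> V"
    and scale_mem: "u \<in> V \<Longrightarrow> (\<lambda>x. c * u x) \<in> V"
    and add_left: "u \<in> V \<Longrightarrow> v \<in> V \<Longrightarrow> w \<in> V \<Longrightarrow> s (\<lambda>x. u x + v x) w = s u w + s v w"
    and scale_left: "u \<in> V \<Longrightarrow> w \<in> V \<Longrightarrow> s (\<lambda>x. c * u x) w = c * s u w"
    and herm: "u \<in> V \<Longrightarrow> v \<in> V \<Longrightarrow> s v u = cnj (s u v)"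
    and nonneg: "u \<in> V \<Longrightarrow> 0 \<le> Re (s u u)"
begin

lemma diff_mem: "u \<in> V \<Longrightarrow> v \<in> V \<Longrightarrow> (\<lambda>x. u x - v x) \<in> V"
  using add_mem[of u "\<lambda>x. (-1) * v x"] scale_mem[of v "-1"] by simp

lemma diff_left: "u \<in> V \<Longrightarrow> v \<in> V \<Longrightarrow> w \<in> V \<Longrightarrow> s (\<lambda>x. u x - v x) w = s u w - s v w"
  using add_left[of u "\<lambda>x. (-1) * v x" w] scale_mem[of v "-1"] scale_left[of v w "-1"] by simp

lemma add_right: "u \<in> V \<Longrightarrow> v \<in> V \<Longrightarrow> w \<in> V \<Longrightarrow> s w (\<lambda>x. u x + v x) = s w u + s w v"
  using herm[of "\<lambda>x. u x + v x" w] herm[of u w] herm[of v w] add_left[of u v w] add_mem[of u v] by simp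

lemma diff_right: "u \<in> V \<Longrightarrow> v \<in> V \<Longrightarrow> w \<in> V \<Longrightarrow> s w (\<lambda>x. u x - v x) = s w u - s w v"
  using herm[of "\<lambda>x. u x - v x" w] herm[of u w] herm[of v w] diff_left[of u v w] diff_mem[of u v] by simp

lemma scale_right: "u \<in> V \<Longrightarrow> w \<in> V \<Longrightarrow> s w (\<lambda>x. c * u x) = cnj c * s w u"
  using herm[of "\<lambda>x. c * u x" w] herm[of u w] scale_left[of u w c] scale_mem[of u c] by simp

lemma self_real: "u \<in> V \<Longrightarrow> s u u = of_real (Re (s u u))"
  using herm[of u u] by (simp add: complex_eq_iff)

lemma sum_mem: "(\<And>i. i \<in> I \<Longrightarrow> f i \<in> V) \<Longrightarrow> (\<lambda>x. \<Sum>i\<in>I. c i * f i x) \<in> V"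
proof (induction I rule: infinite_finite_induct)
  case (insert i I)
  then show ?case using add_mem[OF scale_mem, of "f i" "\<lambda>x. \<Sum>i\<in>I. c i * f i x"] by simp
qed (auto simp: zero_mem)

lemma zero_left: "w \<in> V \<Longrightarrow> s (\<lambda>x. 0) w = 0"
  using scale_left[of "\<lambda>x. 0" w 0] zero_mem by simp

lemma sum_left:
  "(\<And>i. i \<in> I \<Longrightarrow> f i \<in> V) \<Longrightarrow> w \<in> V \<Longrightarrow> s (\<lambda>x. \<Sum>i\<in>I. c i * f i x) w = (\<Sum>i\<in>I. c i * s (f i) w)"
proof (induction I rule: infinite_finite_induct)
  case (insert i I)
  then show ?case
    using add_left[OF scale_mem sum_mem, of "f i" I f w] scale_left[of "f i" w] by simp
qed (auto simp: zero_left)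

lemma sum_right:
  "(\<And>i. i \<in> I \<Longrightarrow> f i \<in> V) \<Longrightarrow> w \<in> V \<Longrightarrow> s w (\<lambda>x. \<Sum>i\<in>I. c i * f i x) = (\<Sum>i\<in>I. cnj (c i) * s w (f i))"
  using herm[OF sum_mem, of I f w c] sum_left[of I f w c] herm[of _ w] by (simp cong: sum.cong)

lemma self_diff:
  "u \<in> V \<Longrightarrow> v \<in> V \<Longrightarrow> Re (s (\<lambda>x. u x - v x) (\<lambda>x. u x - v x)) = Re (s u u) - 2 * Re (s u v) + Re (s v v)"
  using herm[of u v] by (simp add: diff_left diff_right diff_mem)

lemma self_add:
  "u \<in> V \<Longrightarrow> v \<in> V \<Longrightarrow> Re (s (\<lambda>x. u x + v x) (\<lambda>x. u x + v x)) = Re (s u u) + 2 * Re (s u v) + Re (s v v)"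
  using herm[of u v] by (simp add: add_left add_right add_mem)

lemma self_scale: "u \<in> V \<Longrightarrow> Re (s (\<lambda>x. c * u x) (\<lambda>x. c * u x)) = (cmod c)\<^sup>2 * Re (s u u)"
proof -
  assume u: "u \<in> V"
  have "s (\<lambda>x. c * u x) (\<lambda>x. c * u x) = (c * cnj c) * s u u"
    using u by (simp add: scale_left scale_right scale_mem)
  also have "c * cnj c = of_real ((cmod c)\<^sup>2)" by (metis complex_norm_square)
  finally show ?thesis by simp
qed

lemma Cauchy_Schwarz:
  assumes u: "u \<in> V" and v: "v \<in> V"
  shows "(cmod (s u v))\<^sup>2 \<le> Re (s u u) * Re (s v v)"
proof -
  \<comment> \<open>Positivity of \<open>s\<close> on \<open>u - t v\<close>, where \<open>t\<close>
    is a real multiple of \<open>s u v\<close> so that the cross term becomes real. The multiple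
    \<open>r\<close> stays free, because the optimal choice \<open>1 / Re (s v v)\<close> breaks
    down when \<open>s v v = 0\<close>.\<close>
  have key: "0 \<le> Re (s u u) - 2 * r * (cmod (s u v))\<^sup>2 + r\<^sup>2 * (cmod (s u v))\<^sup>2 * Re (s v v)" for r :: real
  proof -
    define t where "t = of_real r * s u v"
    have m: "(\<lambda>x. t * v x) \<in> V" using v by (rule scale_mem)
    have "0 \<le> Re (s (\<lambda>x. u x - t * v x) (\<lambda>x. u x - t * v x))"
      by (intro nonneg diff_mem u m)
    also have "\<dots> = Re (s u u) - 2 * Re (cnj t * s u v) + (cmod t)\<^sup>2 * Re (s v v)"
      by (subst self_diff[OF u m]) (simp add: self_scale[OF v] scale_right[OF v u])
    also have "Re (cnj t * s u v) = r * (cmod (s u v))\<^sup>2"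
      unfolding cmod_power2 by (simp add: t_def power2_eq_square algebra_simps)
    also have "(cmod t)\<^sup>2 = r\<^sup>2 * (cmod (s u v))\<^sup>2"
      by (simp add: t_def norm_mult power_mult_distrib)
    finally show ?thesis by simp
  qed
  show ?thesis
  proof (cases "Re (s v v) = 0")
    case True
    have "(cmod (s u v))\<^sup>2 = 0"
    proof (rule ccontr)
      assume "(cmod (s u v))\<^sup>2 \<noteq> 0"
      \<comment> \<open>For \<open>s v v = 0\<close> the bound \<open>key\<close> is affine in
        \<open>r\<close>, and this value of \<open>r\<close> turns its right-hand side into
        -1.\<close>
      then have "2 * ((Re (s u u) + 1) / (2 * (cmod (s u v))\<^sup>2)) * (cmod (s u v))\<^sup>2 = Re (s u u) + 1"
        by simp
      with key[of "(Re (s u u) + 1) / (2 * (cmod (s u v))\<^sup>2)"] True show False by simp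
    qed
    then show ?thesis using True by simp
  next
    case False
    with nonneg[OF v] have p: "Re (s v v) > 0" by simp
    have "(1 / Re (s v v))\<^sup>2 * (cmod (s u v))\<^sup>2 * Re (s v v) = (cmod (s u v))\<^sup>2 / Re (s v v)"
      using p by (simp add: power2_eq_square)
    with key[of "1 / Re (s v v)"] have "(cmod (s u v))\<^sup>2 / Re (s v v) \<le> Re (s u u)" by simp
    with p show ?thesis by (simp add: pos_divide_le_eq)
  qed
qed

definition nrm where "nrm u = sqrt (Re (s u u))"

lemma nrm_nonneg: "0 \<le> nrm u" if "u \<in> V" using nonneg[OF that] by (simp add: nrm_def)

lemma nrm_sq: "u \<in> V \<Longrightarrow> (nrm u)\<^sup>2 = Re (s u u)" using nonneg by (simp add: nrm_def)

lemma cmod_le_nrm: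
  assumes "u \<in> V" "v \<in> V" shows "cmod (s u v) \<le> nrm u * nrm v"
proof (rule power2_le_imp_le)
  show "(cmod (s u v))\<^sup>2 \<le> (nrm u * nrm v)\<^sup>2"
    unfolding power_mult_distrib nrm_sq[OF assms(1)] nrm_sq[OF assms(2)] by (rule Cauchy_Schwarz[OF assms])
qed (use assms nrm_nonneg in simp)

lemma nrm_triangle:
  assumes "u \<in> V" "v \<in> V" shows "nrm (\<lambda>x. u x + v x) \<le> nrm u + nrm v"
proof (rule power2_le_imp_le)
  have "Re (s u v) \<le> nrm u * nrm v"
    using cmod_le_nrm[OF assms] complex_Re_le_cmod order_trans by blast
  then show "(nrm (\<lambda>x. u x + v x))\<^sup>2 \<le> (nrm u + nrm v)\<^sup>2"
    unfolding nrm_sq[OF add_mem[OF assms]] self_add[OF assms] power2_sum nrm_sq[OF assms(1)] nrm_sq[OF assms(2)]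
    by simp
  show "0 \<le> nrm u + nrm v" using nrm_nonneg[OF assms(1)] nrm_nonneg[OF assms(2)] by simp
qed

lemma nrm_scale: "u \<in> V \<Longrightarrow> nrm (\<lambda>x. c * u x) = cmod c * nrm u"
  by (simp add: nrm_def self_scale real_sqrt_mult)

lemma nrm_diff_commute: "u \<in> V \<Longrightarrow> v \<in> V \<Longrightarrow> nrm (\<lambda>x. u x - v x) = nrm (\<lambda>x. v x - u x)"
  using herm[of u v] by (simp add: nrm_def self_diff)

lemma nrm_diff_le:
  assumes "u \<in> V" "v \<in> V" "w \<in> V"
  shows "nrm (\<lambda>x. u x - w x) \<le> nrm (\<lambda>x. u x - v x) + nrm (\<lambda>x. v x - w x)"
  using nrm_triangle[OF diff_mem diff_mem, OF assms(1,2,2,3)] by simp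

lemma nrm_minus_le:
  assumes "u \<in> V" "v \<in> V"
  shows "\<bar>nrm u - nrm v\<bar> \<le> nrm (\<lambda>x. u x - v x)"
  using nrm_triangle[OF diff_mem[OF assms] assms(2)] nrm_triangle[OF diff_mem[OF assms(2,1)] assms(1)]
    nrm_diff_commute[OF assms] by simp

lemma nrm_tendsto:
  assumes "\<And>n. u n \<in> V" "v \<in> V" "(\<lambda>n. nrm (\<lambda>x. u n x - v x)) \<longlonglongrightarrow> 0"
  shows "(\<lambda>n. nrm (u n)) \<longlonglongrightarrow> nrm v"
proof -
  have "(\<lambda>n. nrm (u n) - nrm v) \<longlonglongrightarrow> 0"
  proof (rule tendsto_0_le[OF assms(3), of _ 1], intro always_eventually allI)
    fix n show "norm (nrm (u n) - nrm v) \<le> norm (nrm (\<lambda>x. u n x - v x)) * 1"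
      using nrm_minus_le[OF assms(1)[of n] assms(2)] nrm_nonneg[OF diff_mem[OF assms(1)[of n] assms(2)]] by simp
  qed
  then show ?thesis by (rule LIM_zero_cancel)
qed

lemma inner_tendsto:
  assumes "\<And>n. u n \<in> V" "v \<in> V" "w \<in> V" "(\<lambda>n. nrm (\<lambda>x. u n x - v x)) \<longlonglongrightarrow> 0"
  shows "(\<lambda>n. s (u n) w) \<longlonglongrightarrow> s v w"
proof -
  have "(\<lambda>n. s (u n) w - s v w) \<longlonglongrightarrow> 0"
  proof (rule Lim_null_comparison)
    have "norm (s (u n) w - s v w) \<le> nrm (\<lambda>x. u n x - v x) * nrm w" for n
    proof -
      have 1: "s (\<lambda>x. u n x - v x) w = s (u n) w - s v w"
        by (rule diff_left[OF assms(1) assms(2,3)])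
      have 2: "(\<lambda>x. u n x - v x) \<in> V" by (rule diff_mem[OF assms(1,2)])
      have "norm (s (\<lambda>x. u n x - v x) w) \<le> nrm (\<lambda>x. u n x - v x) * nrm w"
        by (rule cmod_le_nrm[OF 2 assms(3)])
      then show ?thesis unfolding 1 .
    qed
    then show "\<forall>\<^sub>F n in sequentially. norm (s (u n) w - s v w) \<le> nrm (\<lambda>x. u n x - v x) * nrm w"
      by (intro always_eventually allI)
    show "(\<lambda>n. nrm (\<lambda>x. u n x - v x) * nrm w) \<longlonglongrightarrow> 0"
      by (intro tendsto_mult_left_zero assms(4))
  qed
  then show ?thesis by (rule LIM_zero_cancel)
qed

end

section \<open>Eigenvectors of one form relative to another, and their minimisation property\<close>

locale form_pair = s: semi_inner V s + q: semi_inner V q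
  for V :: "('a \<Rightarrow> complex) set" and s q
begin

definition eigvec :: "real \<Rightarrow> ('a \<Rightarrow> complex) \<Rightarrow> bool" where
  "eigvec r f \<longleftrightarrow> f \<in> V \<and> (\<forall>v\<in>V. q f v = of_real r * s f v)"

definition orthonormal :: "nat \<Rightarrow> (nat \<Rightarrow> 'a \<Rightarrow> complex) \<Rightarrow> bool" where
  "orthonormal n \<phi> \<longleftrightarrow> (\<forall>i<n. \<phi> i \<in> V) \<and> (\<forall>i<n. \<forall>j<n. s (\<phi> i) (\<phi> j) = (if i = j then 1 else 0))"

lemma eigvec_right:
  assumes "eigvec r f" "v \<in> V" shows "q v f = of_real r * s v f"
  using assms q.herm[of f v] s.herm[of f v] by (simp add: eigvec_def)

lemma eigvec_orthogonal:
  assumes "eigvec r f" "eigvec t g" "r \<noteq> t" shows "s f g = 0"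
proof -
  have "of_real r * s f g = of_real t * s f g"
    using eigvec_right[OF assms(2), of f] assms(1,2) by (auto simp: eigvec_def)
  then show ?thesis using assms(3) by simp
qed

lemma residual:
  assumes on: "orthonormal n \<phi>" and u: "u \<in> V"
  defines "u' \<equiv> \<lambda>x. u x - (\<Sum>i<n. s u (\<phi> i) * \<phi> i x)"
  shows "u' \<in> V" "\<And>i. i < n \<Longrightarrow> s u' (\<phi> i) = 0"
    "Re (s u' u') = Re (s u u) - (\<Sum>i<n. (cmod (s u (\<phi> i)))\<^sup>2)"
proof -
  have P: "\<phi> i \<in> V" if "i \<in> {..<n}" for i using on that by (auto simp: orthonormal_def)
  define w where "w = (\<lambda>x. \<Sum>i<n. s u (\<phi> i) * \<phi> i x)"
  have w: "w \<in> V" unfolding w_def by (rule s.sum_mem) (rule P)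
  have u'w: "u' = (\<lambda>x. u x - w x)" by (simp add: u'_def w_def)
  show V: "u' \<in> V" unfolding u'w by (rule s.diff_mem[OF u w])
  show orth: "s u' (\<phi> i) = 0" if i: "i < n" for i
  proof -
    have "s u' (\<phi> i) = s u (\<phi> i) - s w (\<phi> i)"
      unfolding u'w using P[of i] i u w by (simp add: s.diff_left)
    also have "s w (\<phi> i) = (\<Sum>j<n. s u (\<phi> j) * s (\<phi> j) (\<phi> i))"
      unfolding w_def using P[of i] i by (intro s.sum_left P) auto
    also have "\<dots> = (\<Sum>j<n. if j = i then s u (\<phi> i) else 0)"
      by (rule sum.cong) (use on i in \<open>auto simp: orthonormal_def\<close>)
    also have "\<dots> = s u (\<phi> i)" using i by simp
    finally show ?thesis by simp
  qed
  have "s u' w = (\<Sum>i<n. cnj (s u (\<phi> i)) * s u' (\<phi> i))"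
    unfolding w_def by (rule s.sum_right) (use P V in auto)
  then have u'w0: "s u' w = 0" using orth by simp
  have "s u' u' = s u' u" unfolding u'w using u'w0 V u w by (simp add: s.diff_right u'w)
  also have "\<dots> = s u u - s w u" unfolding u'w using u w by (simp add: s.diff_left)
  also have "s w u = (\<Sum>i<n. s u (\<phi> i) * s (\<phi> i) u)"
    unfolding w_def by (rule s.sum_left) (use P u in auto)
  also have "\<dots> = (\<Sum>i<n. of_real ((cmod (s u (\<phi> i)))\<^sup>2))"
  proof (rule sum.cong)
    fix i assume "i \<in> {..<n}"
    then have "s (\<phi> i) u = cnj (s u (\<phi> i))" using P u s.herm by blast
    then show "s u (\<phi> i) * s (\<phi> i) u = of_real ((cmod (s u (\<phi> i)))\<^sup>2)"
      by (metis complex_norm_square)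
  qed simp
  finally show "Re (s u' u') = Re (s u u) - (\<Sum>i<n. (cmod (s u (\<phi> i)))\<^sup>2)" by simp
qed

text \<open>Pairing with an eigenvector in \<open>q\<close> is a multiple of pairing in
  \<open>s\<close>, so the projection and the remainder are orthogonal for \<open>q\<close> as well,
  and the energy splits just as the norm does.\<close>

lemma residual_form:
  assumes on: "orthonormal n \<phi>" and u: "u \<in> V" and e: "\<And>i. i < n \<Longrightarrow> eigvec (c i) (\<phi> i)"
  defines "u' \<equiv> \<lambda>x. u x - (\<Sum>i<n. s u (\<phi> i) * \<phi> i x)"
  shows "Re (q u' u') = Re (q u u) - (\<Sum>i<n. c i * (cmod (s u (\<phi> i)))\<^sup>2)"
proof -
  have P: "\<phi> i \<in> V" if "i \<in> {..<n}" for i using on that by (auto simp: orthonormal_def)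
  define w where "w = (\<lambda>x. \<Sum>i<n. s u (\<phi> i) * \<phi> i x)"
  have w: "w \<in> V" unfolding w_def by (rule s.sum_mem) (rule P)
  have u'w: "u' = (\<lambda>x. u x - w x)" by (simp add: u'_def w_def)
  note R = residual[OF on u, folded u'_def]
  have "q u' w = (\<Sum>i<n. cnj (s u (\<phi> i)) * q u' (\<phi> i))"
    unfolding w_def by (rule q.sum_right) (use P R(1) in auto)
  then have u'w0: "q u' w = 0" using R(2) eigvec_right[OF e R(1)] by simp
  have "q u' u' = q u' u" unfolding u'w using u'w0 R(1) u w by (simp add: q.diff_right u'w)
  also have "\<dots> = q u u - q w u" unfolding u'w using u w by (simp add: q.diff_left)
  also have "q w u = (\<Sum>i<n. s u (\<phi> i) * q (\<phi> i) u)"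
    unfolding w_def by (rule q.sum_left) (use P u in auto)
  also have "\<dots> = (\<Sum>i<n. of_real (c i * (cmod (s u (\<phi> i)))\<^sup>2))"
  proof (rule sum.cong)
    fix i assume i: "i \<in> {..<n}"
    then have "s (\<phi> i) u = cnj (s u (\<phi> i))" using P u s.herm by blast
    moreover have "q (\<phi> i) u = of_real (c i) * s (\<phi> i) u" using e i u by (auto simp: eigvec_def)
    ultimately show "s u (\<phi> i) * q (\<phi> i) u = of_real (c i * (cmod (s u (\<phi> i)))\<^sup>2)"
      unfolding of_real_mult complex_norm_square by simp
  qed simp
  finally show ?thesis by simp
qed

end

text \<open>Compact embedding of the form domain and closedness of the form. The first axiom yields
  only a Cauchy subsequence in the weaker norm; a limit is available once the sequence is Cauchy in
  \<open>q\<close> too, which the minimisation has to provide.\<close>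

locale compact_form = form_pair +
  assumes compact: "\<And>u C. (\<And>n. u n \<in> V) \<Longrightarrow> (\<And>n. Re (s (u n) (u n)) \<le> C) \<Longrightarrow> (\<And>n. Re (q (u n) (u n)) \<le> C) \<Longrightarrow>
      \<exists>k::nat \<Rightarrow> nat. strict_mono k \<and> (\<forall>e>0. \<exists>N. \<forall>m\<ge>N. \<forall>n\<ge>N. s.nrm (\<lambda>x. u (k m) x - u (k n) x) < e)"
    and complete: "\<And>u. (\<And>n::nat. u n \<in> V) \<Longrightarrow>
      (\<And>e. e > 0 \<Longrightarrow> \<exists>N. \<forall>m\<ge>N. \<forall>n\<ge>N. s.nrm (\<lambda>x. u m x - u n x) < e) \<Longrightarrow>
      (\<And>e. e > 0 \<Longrightarrow> \<exists>N. \<forall>m\<ge>N. \<forall>n\<ge>N. q.nrm (\<lambda>x. u m x - u n x) < e) \<Longrightarrow>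
      \<exists>v\<in>V. (\<lambda>n. s.nrm (\<lambda>x. u n x - v x)) \<longlonglongrightarrow> 0 \<and> (\<lambda>n. q.nrm (\<lambda>x. u n x - v x)) \<longlonglongrightarrow> 0"
begin

text \<open>A minimising sequence has a subsequence that converges for \<open>s\<close> by compactness; by the parallelogram
  law it then also converges for \<open>q\<close>. The limit is an eigenvector by the Cauchy--Schwarz inequality for the
  semidefinite form \<open>q - C s\<close>.\<close>

lemma minimiser:
  assumes on: "orthonormal n \<phi>" and e: "\<And>i. i < n \<Longrightarrow> eigvec (c i) (\<phi> i)"
    and ex: "w \<in> V" "\<And>i. i < n \<Longrightarrow> s w (\<phi> i) = 0" "s w w \<noteq> 0"
  obtains v C where "eigvec C v" "\<And>i. i < n \<Longrightarrow> s v (\<phi> i) = 0" "s v v = 1"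
    "\<And>u. u \<in> V \<Longrightarrow> (\<And>i. i < n \<Longrightarrow> s u (\<phi> i) = 0) \<Longrightarrow> C * Re (s u u) \<le> Re (q u u)"
proof -
  define W where "W = {u \<in> V. \<forall>i<n. s u (\<phi> i) = 0}"
  have WV: "u \<in> V" if "u \<in> W" for u using that by (simp add: W_def)
  have P: "\<phi> i \<in> V" if "i < n" for i using on that by (auto simp: orthonormal_def)
  have W_add: "(\<lambda>x. u x + v x) \<in> W" if "u \<in> W" "v \<in> W" for u v
    using that P by (auto simp: W_def s.add_mem s.add_left)
  have W_scale: "(\<lambda>x. a * u x) \<in> W" if "u \<in> W" for u a
    using that P by (auto simp: W_def s.scale_mem s.scale_left)
  have W_zero: "(\<lambda>x. 0) \<in> W" using W_scale[of w 0] ex by (simp add: W_def)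
  define A where "A = {Re (q u u) |u. u \<in> W \<and> Re (s u u) = 1}"
  have normalize: "\<exists>v\<in>W. Re (s v v) = 1 \<and> Re (q v v) = Re (q u u) / Re (s u u)"
    if u: "u \<in> W" "Re (s u u) \<noteq> 0" for u
  proof -
    have p: "Re (s u u) > 0" using s.nonneg[OF WV[OF u(1)]] u(2) by simp
    define v where "v = (\<lambda>x. of_real (1 / sqrt (Re (s u u))) * u x)"
    have "v \<in> W" unfolding v_def by (rule W_scale[OF u(1)])
    moreover have "Re (s v v) = 1" "Re (q v v) = Re (q u u) / Re (s u u)"
      unfolding v_def using p
      by (simp_all only: s.self_scale[OF WV[OF u(1)]] q.self_scale[OF WV[OF u(1)]] norm_of_real)
         (simp_all add: power_divide)
    ultimately show ?thesis by blast
  qed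
  have "Re (s w w) \<noteq> 0" using ex(3) s.self_real[OF ex(1)] by auto
  then obtain v0 where "v0 \<in> W" "Re (s v0 v0) = 1" using normalize[of w] ex by (auto simp: W_def)
  then have A_ne: "A \<noteq> {}" by (auto simp: A_def)
  have A_bdd: "bdd_below A" by (rule bdd_belowI[of _ 0]) (auto simp: A_def dest: WV q.nonneg)
  define C where "C = Inf A"
  have C_le: "C * Re (s u u) \<le> Re (q u u)" if u: "u \<in> W" for u
  proof (cases "Re (s u u) = 0")
    case True
    then show ?thesis using q.nonneg[OF WV[OF u]] by simp
  next
    case False
    then obtain v where "v \<in> W" "Re (s v v) = 1" "Re (q v v) = Re (q u u) / Re (s u u)"
      using normalize[OF u] by blast
    then have "Re (q u u) / Re (s u u) \<in> A" unfolding A_def by (intro CollectI exI[of _ v]) simp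
    then have "C \<le> Re (q u u) / Re (s u u)" unfolding C_def by (intro cInf_lower A_bdd)
    then show ?thesis using False s.nonneg[OF WV[OF u]] by (simp add: pos_le_divide_eq)
  qed
  have "\<exists>u. u \<in> W \<and> Re (s u u) = 1 \<and> Re (q u u) < C + 1 / Suc k" for k
    using cInf_less_iff[OF A_ne A_bdd, of "C + 1 / Suc k"] by (auto simp: A_def C_def)
  then obtain u0 where u0: "\<And>k. u0 k \<in> W" "\<And>k. Re (s (u0 k) (u0 k)) = 1"
    "\<And>k. Re (q (u0 k) (u0 k)) < C + 1 / Suc k" by metis
  have C0: "0 \<le> C" unfolding C_def using A_ne
    by (intro cInf_greatest) (auto simp: A_def dest: WV q.nonneg)
  have qb: "Re (q (u0 k) (u0 k)) \<le> C + 1" for k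
    using u0(3)[of k] by (smt (verit) divide_le_eq_1_pos of_nat_0_less_iff of_nat_1 of_nat_mono le_numeral_extra(4) Suc_le_eq zero_less_Suc One_nat_def)
  obtain k where k: "strict_mono (k::nat\<Rightarrow>nat)"
    and cau: "\<And>e. e > 0 \<Longrightarrow> \<exists>N. \<forall>m\<ge>N. \<forall>n\<ge>N. s.nrm (\<lambda>x. u0 (k m) x - u0 (k n) x) < e"
    using compact[of u0 "C + 1"] WV u0(1,2) C0 qb by auto
  define u where "u m = u0 (k m)" for m
  have u: "u m \<in> W" "Re (s (u m) (u m)) = 1" "Re (q (u m) (u m)) \<le> C + 1 / Suc m" for m
  proof -
    have "1 / real (Suc (k m)) \<le> 1 / real (Suc m)"
      using seq_suble[OF k, of m] by (intro divide_left_mono) auto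
    then show "Re (q (u m) (u m)) \<le> C + 1 / Suc m"
      using u0(3)[of "k m"] unfolding u_def by linarith
  qed (use u0 in \<open>auto simp: u_def\<close>)
  have uV: "u m \<in> V" for m using u WV by blast
  have cs: "\<exists>N. \<forall>m\<ge>N. \<forall>n\<ge>N. s.nrm (\<lambda>x. u m x - u n x) < e" if "e > 0" for e
    using cau[OF that] by (simp add: u_def)
  \<comment> \<open>The sum of two members of the sequence lies in \<open>W\<close>, so its energy
    is at least \<open>C\<close> times its square norm. As both members are nearly minimal, the
    parallelogram law leaves little energy for their difference.\<close>
  have qd: "(q.nrm (\<lambda>x. u m x - u l x))\<^sup>2 \<le> 2 / Suc m + 2 / Suc l + C * (s.nrm (\<lambda>x. u m x - u l x))\<^sup>2" for m l
  proof -
    have "C * Re (s (\<lambda>x. u m x + u l x) (\<lambda>x. u m x + u l x)) \<le> Re (q (\<lambda>x. u m x + u l x) (\<lambda>x. u m x + u l x))"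
      by (rule C_le[OF W_add[OF u(1) u(1)]])
    then have "C * (2 + 2 * Re (s (u m) (u l))) \<le> Re (q (u m) (u m)) + 2 * Re (q (u m) (u l)) + Re (q (u l) (u l))"
      by (simp add: s.self_add[OF uV uV] q.self_add[OF uV uV] u(2))
    then show ?thesis
      using u(3)[of m] u(3)[of l]
      unfolding q.nrm_sq[OF q.diff_mem[OF uV uV]] s.nrm_sq[OF s.diff_mem[OF uV uV]]
        s.self_diff[OF uV uV] q.self_diff[OF uV uV] u(2)
      by (simp add: algebra_simps)
  qed
  have cq: "\<exists>N. \<forall>m\<ge>N. \<forall>n\<ge>N. q.nrm (\<lambda>x. u m x - u n x) < e" if e: "e > 0" for e
  proof -
    \<comment> \<open>Chosen so that \<open>C d\<^sup>2\<close> is at most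
      \<open>e\<^sup>2 / 2\<close>; \<open>C + 1\<close> replaces \<open>C\<close>, which may be 0.
      The other half of \<open>e\<^sup>2\<close> goes to the two terms
      \<open>2 / Suc j\<close>.\<close>
    define d where "d = sqrt (e\<^sup>2 / (2 * (C + 1)))"
    have d: "d > 0" "d\<^sup>2 = e\<^sup>2 / (2 * (C + 1))" using e C0 by (auto simp: d_def)
    obtain N1 where N1: "\<forall>m\<ge>N1. \<forall>n\<ge>N1. s.nrm (\<lambda>x. u m x - u n x) < d" using cs[OF d(1)] by blast
    obtain N2 :: nat where N2: "8 / e\<^sup>2 < N2" using reals_Archimedean2 by blast
    show ?thesis
    proof (intro exI[of _ "max N1 N2"] allI impI)
      fix m l assume ml: "m \<ge> max N1 N2" "l \<ge> max N1 N2"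
      have t: "2 / Suc j < e\<^sup>2 / 4" if "j \<ge> N2" for j
      proof -
        have "8 / e\<^sup>2 < Suc j" using N2 that by linarith
        then show ?thesis using e by (simp add: field_simps)
      qed
      have "(s.nrm (\<lambda>x. u m x - u l x))\<^sup>2 \<le> d\<^sup>2"
        using N1 ml s.nrm_nonneg[OF s.diff_mem[OF uV[of m] uV[of l]]] by (intro power_mono) (auto intro: less_imp_le)
      then have "C * (s.nrm (\<lambda>x. u m x - u l x))\<^sup>2 \<le> C * d\<^sup>2" using C0 by (rule mult_left_mono)
      also have "C * d\<^sup>2 \<le> (C + 1) * d\<^sup>2" by (intro mult_right_mono) auto
      also have "(C + 1) * d\<^sup>2 = e\<^sup>2 / 2" using C0 by (simp add: d field_simps)
      finally have "(q.nrm (\<lambda>x. u m x - u l x))\<^sup>2 < e\<^sup>2"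
        using qd[of m l] t[of m] t[of l] ml by auto
      then show "q.nrm (\<lambda>x. u m x - u l x) < e" using e by (intro power2_less_imp_less[of _ e]) auto
    qed
  qed
  obtain v where v: "v \<in> V" "(\<lambda>n. s.nrm (\<lambda>x. u n x - v x)) \<longlonglongrightarrow> 0" "(\<lambda>n. q.nrm (\<lambda>x. u n x - v x)) \<longlonglongrightarrow> 0"
    using complete[of u] uV cs cq by blast
  have orth: "s v (\<phi> i) = 0" if i: "i < n" for i
  proof -
    have "(\<lambda>k. s (u k) (\<phi> i)) \<longlonglongrightarrow> s v (\<phi> i)" by (rule s.inner_tendsto[OF uV v(1) P[OF i] v(2)])
    moreover have "s (u k) (\<phi> i) = 0" for k using u(1)[of k] i by (simp add: W_def)
    ultimately show ?thesis by (simp add: LIMSEQ_const_iff)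
  qed
  have vW: "v \<in> W" using v orth by (simp add: W_def)
  have "(\<lambda>k. s.nrm (u k)) \<longlonglongrightarrow> s.nrm v" by (rule s.nrm_tendsto[OF uV v(1,2)])
  moreover have "s.nrm (u k) = 1" for k by (simp add: s.nrm_def u)
  ultimately have "s.nrm v = 1" by (simp add: LIMSEQ_const_iff)
  then have svr: "Re (s v v) = 1" using s.nrm_sq[OF v(1)] by simp
  then have sv: "s v v = 1" using s.self_real[OF v(1)] by simp
  have "(\<lambda>k. q.nrm (u k)) \<longlonglongrightarrow> q.nrm v" by (rule q.nrm_tendsto[OF uV v(1,3)])
  then have "(\<lambda>k. (q.nrm (u k))\<^sup>2) \<longlonglongrightarrow> (q.nrm v)\<^sup>2" by (intro tendsto_intros)
  then have l1: "(\<lambda>k. Re (q (u k) (u k))) \<longlonglongrightarrow> Re (q v v)" by (simp add: q.nrm_sq uV v)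
  have l2: "(\<lambda>k. C + 1 / Suc k) \<longlonglongrightarrow> C + 0" by (intro tendsto_intros LIMSEQ_Suc[OF lim_1_over_n])
  have "Re (q v v) \<le> C + 0" by (rule LIMSEQ_le[OF l1 l2]) (use u(3) in auto)
  then have qv: "Re (q v v) = C" using C_le[OF vW] svr by simp
  interpret p: semi_inner W "\<lambda>u v. q u v - of_real C * s u v"
  proof
    fix a b assume "a \<in> W" "b \<in> W"
    then show "q b a - of_real C * s b a = cnj (q a b - of_real C * s a b)"
      using s.herm[of a b] q.herm[of a b] WV by simp
  qed (use W_zero W_add W_scale C_le WV in
      \<open>auto simp: q.add_left s.add_left q.scale_left s.scale_left algebra_simps\<close>)
  have pvw: "q v w = of_real C * s v w" if "w \<in> W" for w
    using p.Cauchy_Schwarz[OF vW that] qv svr by simp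
  \<comment> \<open>So far the eigenvalue equation has been tested only on \<open>W\<close>. The
    component \<open>z\<close> of \<open>w\<close> along the earlier eigenvectors contributes 0 to
    both sides, since \<open>v\<close> is orthogonal to them in \<open>s\<close> and therefore in
    \<open>q\<close>.\<close>
  have "q v w = of_real C * s v w" if w: "w \<in> V" for w
  proof -
    define z where "z = (\<lambda>x. \<Sum>i<n. s w (\<phi> i) * \<phi> i x)"
    have P': "\<phi> i \<in> V" if "i \<in> {..<n}" for i using P that by auto
    have z: "z \<in> V" unfolding z_def by (rule s.sum_mem) (rule P')
    have w': "(\<lambda>x. w x - z x) \<in> W"
      using residual(1,2)[OF on w] by (simp add: W_def z_def)
    have "s v z = (\<Sum>i<n. cnj (s w (\<phi> i)) * s v (\<phi> i))"
      unfolding z_def by (rule s.sum_right) (use P v in auto)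
    then have sz: "s v z = 0" using orth by simp
    have "q v z = (\<Sum>i<n. cnj (s w (\<phi> i)) * q v (\<phi> i))"
      unfolding z_def by (rule q.sum_right) (use P v in auto)
    then have qz: "q v z = 0" using orth eigvec_right[OF e v(1)] by simp
    show ?thesis using pvw[OF w'] sz qz v(1) w z by (simp add: s.diff_right q.diff_right)
  qed
  then have "eigvec C v" using v by (simp add: eigvec_def)
  then show thesis using that orth sv C_le by (auto simp: W_def)
qed

text \<open>Repeated minimisation on the complement of the vectors already found. The last
  alternative covers a domain whose dimension modulo null vectors is less than \<open>m\<close>: the
  process then stops early, with vectors that exhaust the domain.\<close>

lemma eigen_sequence:
  "\<exists>n\<le>m. \<exists>\<phi> c. orthonormal n \<phi> \<and> (\<forall>i<n. eigvec (c i) (\<phi> i)) \<and>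
     (\<forall>i<n. \<forall>u\<in>V. (\<forall>j<i. s u (\<phi> j) = 0) \<longrightarrow> c i * Re (s u u) \<le> Re (q u u)) \<and>
     (n = m \<or> (\<forall>u\<in>V. (\<forall>j<n. s u (\<phi> j) = 0) \<longrightarrow> s u u = 0))"
proof (induction m)
  case 0
  show ?case by (intro exI[of _ 0]) (auto simp: orthonormal_def)
next
  case (Suc m)
  then obtain n \<phi> c where n: "n \<le> m" and on: "orthonormal n \<phi>" and e: "\<forall>i<n. eigvec (c i) (\<phi> i)"
    and min: "\<forall>i<n. \<forall>u\<in>V. (\<forall>j<i. s u (\<phi> j) = 0) \<longrightarrow> c i * Re (s u u) \<le> Re (q u u)"
    and alt: "n = m \<or> (\<forall>u\<in>V. (\<forall>j<n. s u (\<phi> j) = 0) \<longrightarrow> s u u = 0)" by blast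
  show ?case
  proof (cases "\<forall>u\<in>V. (\<forall>j<n. s u (\<phi> j) = 0) \<longrightarrow> s u u = 0")
    case True
    then show ?thesis using n on e min by (intro exI[of _ n] conjI exI[of _ \<phi>] exI[of _ c]) auto
  next
    case False
    then have nm: "n = m" using alt by blast
    from False obtain w where w: "w \<in> V" "\<forall>j<n. s w (\<phi> j) = 0" "s w w \<noteq> 0" by blast
    obtain v C where v: "eigvec C v" "\<And>i. i < n \<Longrightarrow> s v (\<phi> i) = 0" "s v v = 1"
      "\<And>u. u \<in> V \<Longrightarrow> (\<And>i. i < n \<Longrightarrow> s u (\<phi> i) = 0) \<Longrightarrow> C * Re (s u u) \<le> Re (q u u)"
      using minimiser[OF on, of c w] e w by metis
    have vV: "v \<in> V" using v by (simp add: eigvec_def)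
    have v': "s (\<phi> i) v = 0" if "i < n" for i
      using v(2)[OF that] s.herm[of v "\<phi> i"] vV on that by (simp add: orthonormal_def)
    have "orthonormal (Suc n) (\<phi>(n := v))"
      using on v(2,3) v' vV by (auto simp: orthonormal_def less_Suc_eq)
    moreover have "\<forall>i<Suc n. eigvec ((c(n := C)) i) ((\<phi>(n := v)) i)"
      using e v(1) by (auto simp: less_Suc_eq)
    moreover have "\<forall>i<Suc n. \<forall>u\<in>V. (\<forall>j<i. s u ((\<phi>(n := v)) j) = 0) \<longrightarrow> (c(n := C)) i * Re (s u u) \<le> Re (q u u)"
      using min v(4) by (auto simp: less_Suc_eq)
    ultimately show ?thesis using nm by blast
  qed
qed

end


section \<open>Comparison of eigenvectors with a listed spectrum\<close>

locale spectral_form = form_pair V s q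
  for V :: "('a::euclidean_space \<Rightarrow> complex) set" and s q +
  fixes U T
  assumes eigenspace_iff: "f \<in> eigenspace T r \<longleftrightarrow> eigvec r f"
    and null_iff: "u \<in> V \<Longrightarrow> s u u = 0 \<longleftrightarrow> (AE x in lborel. x \<in> U \<longrightarrow> u x = 0)"
begin

lemma null_left:
  assumes "u \<in> V" "v \<in> V" "s u u = 0" shows "s u v = 0"
  using s.Cauchy_Schwarz[OF assms(1,2)] assms(3) by simp

text \<open>If there were more orthonormal eigenvectors than the dimension of the eigenspace, a
  nontrivial combination of them would vanish almost everywhere. Pairing it with each of them shows
  that all its coefficients are 0.\<close>

lemma card_orthonormal_le_multiplicity:
  assumes ev: "lists_eigenvalues U T \<rho>"
    and on: "orthonormal m \<phi>" and e: "\<And>i. i < m \<Longrightarrow> eigvec (c i) (\<phi> i)"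
  shows "card {i. i < m \<and> c i = r} \<le> card {n. 1 \<le> n \<and> \<rho> n = r}"
proof (rule ccontr)
  define d where "d = card {n. 1 \<le> n \<and> \<rho> n = r}"
  define p where "p = card {i. i < m \<and> c i = r}"
  assume "\<not> card {i. i < m \<and> c i = r} \<le> card {n. 1 \<le> n \<and> \<rho> n = r}"
  then have dp: "d < p" by (simp add: d_def p_def)
  obtain b where b: "bij_betw b {..<p} {i. i < m \<and> c i = r}"
    using ex_bij_betw_nat_finite[of "{i. i < m \<and> c i = r}"] by (auto simp: p_def atLeast0LessThan)
  have bm: "b i < m" "c (b i) = r" if "i < p" for i using b that by (auto simp: bij_betw_def)
  have "has_dimension_ae U (eigenspace T r) d" using ev by (simp add: lists_eigenvalues_def d_def)
  then obtain \<eta> where \<eta>: "\<forall>f\<in>eigenspace T r. \<exists>a. AE x in lborel. x \<in> U \<longrightarrow> f x = (\<Sum>j<d. a j * \<eta> j x)"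
    unfolding has_dimension_ae_def by blast
  have eb: "\<phi> (b i) \<in> eigenspace T r" if "i < p" for i
    using e[OF bm(1)[OF that]] bm(2)[OF that] by (simp add: eigenspace_iff)
  have "\<forall>i. \<exists>a. i < p \<longrightarrow> (AE x in lborel. x \<in> U \<longrightarrow> \<phi> (b i) x = (\<Sum>j<d. a j * \<eta> j x))"
    using \<eta> eb by blast
  then obtain a where a: "\<And>i. i < p \<Longrightarrow> (AE x in lborel. x \<in> U \<longrightarrow> \<phi> (b i) x = (\<Sum>j<d. a i j * \<eta> j x))"
    by metis
  obtain z where z: "\<exists>i<p. z i \<noteq> 0" "\<forall>j<d. (\<Sum>i<p. a i j * z i) = 0"
    using homogeneous_system_nontrivial[OF dp, of "\<lambda>j i. a i j"] by blast
  define w where "w = (\<lambda>x. \<Sum>i<p. z i * \<phi> (b i) x)"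
  have P: "\<phi> (b i) \<in> V" if "i \<in> {..<p}" for i using on bm that by (auto simp: orthonormal_def)
  have w: "w \<in> V" unfolding w_def by (rule s.sum_mem) (rule P)
  have "AE x in lborel. \<forall>i\<in>{..<p}. x \<in> U \<longrightarrow> \<phi> (b i) x = (\<Sum>j<d. a i j * \<eta> j x)"
    by (rule AE_finite_allI) (use a in auto)
  then have "AE x in lborel. x \<in> U \<longrightarrow> w x = 0"
  proof (rule AE_mp, intro AE_I2 impI)
    fix x assume A: "\<forall>i\<in>{..<p}. x \<in> U \<longrightarrow> \<phi> (b i) x = (\<Sum>j<d. a i j * \<eta> j x)" and "x \<in> U"
    then have "w x = (\<Sum>i<p. z i * (\<Sum>j<d. a i j * \<eta> j x))" by (simp add: w_def)
    also have "\<dots> = (\<Sum>i<p. \<Sum>j<d. a i j * z i * \<eta> j x)" by (simp add: sum_distrib_left mult_ac)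
    also have "\<dots> = (\<Sum>j<d. \<Sum>i<p. a i j * z i * \<eta> j x)" by (rule sum.swap)
    also have "\<dots> = (\<Sum>j<d. (\<Sum>i<p. a i j * z i) * \<eta> j x)" by (simp add: sum_distrib_right)
    also have "\<dots> = 0" using z by simp
    finally show "w x = 0" .
  qed
  then have sw: "s w w = 0" using null_iff[OF w] by simp
  from z obtain i where i: "i < p" "z i \<noteq> 0" by blast
  have "s w (\<phi> (b i)) = (\<Sum>k<p. z k * s (\<phi> (b k)) (\<phi> (b i)))"
    unfolding w_def using i by (intro s.sum_left P) auto
  also have "\<dots> = (\<Sum>k<p. if k = i then z i else 0)"
  proof (rule sum.cong)
    fix k assume k: "k \<in> {..<p}"
    have "b k = b i \<longleftrightarrow> k = i" using b k i by (auto simp: bij_betw_def inj_on_def)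
    then show "z k * s (\<phi> (b k)) (\<phi> (b i)) = (if k = i then z i else 0)"
      using on bm[of k] bm[of i] i k by (auto simp: orthonormal_def)
  qed simp
  also have "\<dots> = z i" using i by simp
  finally show False using null_left[OF w P sw, of i] i by simp
qed

text \<open>The list contains each value \<open>c i\<close> at least as often as it occurs among the
  \<open>m\<close> eigenvectors, so at least \<open>m\<close> indices carry a value that is at most
  \<open>C\<close>. The largest of these indices is at least \<open>m\<close>, and the list is
  increasing.\<close>

lemma eigenvalue_le_of_orthonormal:
  assumes ev: "lists_eigenvalues U T \<rho>"
    and on: "orthonormal m \<phi>" and e: "\<And>i. i < m \<Longrightarrow> eigvec (c i) (\<phi> i)"
    and C: "\<And>i. i < m \<Longrightarrow> c i \<le> C" and m: "1 \<le> m"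
  shows "\<rho> m \<le> C"
proof -
  define N where "N r = {n. 1 \<le> n \<and> \<rho> n = r}" for r
  define R where "R = c ` {..<m}"
  have fin: "finite (N r)" for r using ev by (simp add: lists_eigenvalues_def N_def)
  have "m = card (\<Union>r\<in>R. {i. i < m \<and> c i = r})"
  proof -
    have "(\<Union>r\<in>R. {i. i < m \<and> c i = r}) = {..<m}" by (auto simp: R_def)
    then show ?thesis by simp
  qed
  also have "\<dots> = (\<Sum>r\<in>R. card {i. i < m \<and> c i = r})"
    by (rule card_UN_disjoint) (auto simp: R_def)
  also have "\<dots> \<le> (\<Sum>r\<in>R. card (N r))"
    unfolding N_def by (rule sum_mono) (rule card_orthonormal_le_multiplicity[OF ev on e])
  also have "\<dots> = card (\<Union>r\<in>R. N r)"
    by (rule card_UN_disjoint[symmetric]) (use fin in \<open>auto simp: R_def N_def\<close>)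
  finally have card: "m \<le> card (\<Union>r\<in>R. N r)" .
  have "\<exists>n\<in>(\<Union>r\<in>R. N r). m \<le> n"
  proof (rule ccontr)
    assume "\<not> ?thesis"
    then have lt: "n < m" if "n \<in> (\<Union>r\<in>R. N r)" for n using that by (meson not_le)
    \<comment> \<open>The list starts at index 1, so this interval has only \<open>m - 1\<close>
      elements.\<close>
    have "(\<Union>r\<in>R. N r) \<subseteq> {1..<m}"
    proof
      fix n assume n: "n \<in> (\<Union>r\<in>R. N r)"
      then have "1 \<le> n" by (auto simp: N_def)
      with lt[OF n] show "n \<in> {1..<m}" by simp
    qed
    from card_mono[OF _ this] card m show False by simp
  qed
  then obtain n i where "m \<le> n" "i < m" "\<rho> n = c i" by (auto simp: R_def N_def)
  moreover have "\<rho> m \<le> \<rho> n"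
    using ev m \<open>m \<le> n\<close> by (auto simp: lists_eigenvalues_def mono_on_def)
  ultimately show ?thesis using C[of i] by simp
qed

text \<open>The combination \<open>f\<close> is chosen among eigenvectors for \<open>\<mu> 1, \<dots>, \<mu> k\<close> that need not be orthogonal within an
  eigenspace; \<open>\<mu> k s f f - q f f\<close> is the square norm of the combination with coefficients scaled by
  \<open>sqrt (\<mu> k - \<mu> i)\<close>.\<close>

lemma span_of_first_eigenvectors:
  assumes ev: "lists_eigenvalues U T \<mu>" and dk: "d < k"
    and lin: "\<And>j c f. j < d \<Longrightarrow> (\<And>i. i < k \<Longrightarrow> f i \<in> V) \<Longrightarrow>
        l j (\<lambda>x. \<Sum>i<k. c i * f i x) = (\<Sum>i<k. c i * l j (f i))"
  obtains f where "f \<in> V" "s f f \<noteq> 0" "\<And>j. j < d \<Longrightarrow> l j f = 0" "Re (q f f) \<le> \<mu> k * Re (s f f)"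
proof -
  define N where "N r = {n. 1 \<le> n \<and> \<mu> n = r}" for r
  have fin: "finite (N r)" and dim: "has_dimension_ae U (eigenspace T r) (card (N r))" for r
    using ev by (simp_all add: lists_eigenvalues_def N_def)
  have "\<forall>r. \<exists>\<phi>. (\<forall>i<card (N r). \<phi> i \<in> eigenspace T r) \<and>
     (\<forall>c. (AE x in lborel. x \<in> U \<longrightarrow> (\<Sum>i<card (N r). c i * \<phi> i x) = 0) \<longrightarrow> (\<forall>i<card (N r). c i = 0))"
    using dim unfolding has_dimension_ae_def by blast
  from choice[OF this] obtain \<Phi> where \<Phi>': "\<forall>r. (\<forall>i<card (N r). \<Phi> r i \<in> eigenspace T r) \<and>
     (\<forall>c. (AE x in lborel. x \<in> U \<longrightarrow> (\<Sum>i<card (N r). c i * \<Phi> r i x) = 0) \<longrightarrow> (\<forall>i<card (N r). c i = 0))" ..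
  have \<Phi>: "i < card (N r) \<Longrightarrow> \<Phi> r i \<in> eigenspace T r"
    "(AE x in lborel. x \<in> U \<longrightarrow> (\<Sum>i<card (N r). c i * \<Phi> r i x) = 0) \<Longrightarrow> (\<forall>i<card (N r). c i = 0)" for r i c
    using \<Phi>' by auto
  have "\<exists>b. bij_betw b (N r) {..<card (N r)}" for r
    using ex_bij_betw_finite_nat[OF fin[of r]] by (auto simp: atLeast0LessThan)
  then obtain b where b: "\<And>r. bij_betw (b r) (N r) {..<card (N r)}" by metis
  \<comment> \<open>The list starts at index 1, the sums at 0. \<open>b r\<close> numbers the
    indices at which the list takes the value \<open>r\<close>, so a repeated eigenvalue is given a
    different basis vector of its eigenspace at each occurrence.\<close>
  define m where "m i = \<mu> (Suc i)" for i
  define f where "f i = \<Phi> (m i) (b (m i) (Suc i))" for i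
  have Nm: "Suc i \<in> N (m i)" for i by (simp add: N_def m_def)
  have e: "eigvec (m i) (f i)" for i
    unfolding f_def eigenspace_iff[symmetric]
    by (rule \<Phi>(1)) (use b[of "m i"] Nm[of i] in \<open>auto simp: bij_betw_def\<close>)
  have fV: "f i \<in> V" for i using e[of i] by (simp add: eigvec_def)
  have orth: "s (f i) (f j) = 0" if "m i \<noteq> m j" for i j using eigvec_orthogonal[OF e e that] .
  obtain c where c: "\<exists>i<k. c i \<noteq> 0" "\<forall>j<d. (\<Sum>i<k. l j (f i) * c i) = 0"
    using homogeneous_system_nontrivial[OF dk, of "\<lambda>j i. l j (f i)"] by blast
  define F where "F = (\<lambda>x. \<Sum>i<k. c i * f i x)"
  have F: "F \<in> V" unfolding F_def by (rule s.sum_mem) (rule fV)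
  have lF: "l j F = 0" if "j < d" for j
    unfolding F_def using lin[of j f c] that fV c(2) by (simp add: mult.commute)
  have sF: "s F F \<noteq> 0"
  proof
    \<comment> \<open>Eigenvectors for different values are orthogonal, so the part \<open>E\<close>
      of the combination inside one eigenspace satisfies \<open>s E E = s E F\<close>, which is 0 as
      \<open>F\<close> is a null vector. Hence \<open>E\<close> vanishes almost everywhere, against
      the independence of the basis and \<open>c i0 \<noteq> 0\<close>.\<close>
    assume sF: "s F F = 0"
    from c obtain i0 where i0: "i0 < k" "c i0 \<noteq> 0" by blast
    define r where "r = m i0"
    define E where "E = (\<lambda>x. \<Sum>i\<in>{i. i < k \<and> m i = r}. c i * f i x)"
    have E: "E \<in> V" unfolding E_def by (rule s.sum_mem) (rule fV)
    have sE: "s (f i) E = (if m i = r then s (f i) F else 0)" for i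
    proof -
      have 1: "s (f i) E = (\<Sum>j\<in>{j. j < k \<and> m j = r}. cnj (c j) * s (f i) (f j))"
        unfolding E_def by (rule s.sum_right) (rule fV)+
      have "s (f i) F = (\<Sum>j<k. cnj (c j) * s (f i) (f j))"
        unfolding F_def by (rule s.sum_right) (rule fV)+
      also have "\<dots> = (\<Sum>j\<in>{j. j < k \<and> m j = m i}. cnj (c j) * s (f i) (f j))"
      proof (rule sum.mono_neutral_right)
        show "\<forall>j\<in>{..<k} - {j. j < k \<and> m j = m i}. cnj (c j) * s (f i) (f j) = 0"
        proof
          fix j assume "j \<in> {..<k} - {j. j < k \<and> m j = m i}"
          then have "m i \<noteq> m j" by auto
          then show "cnj (c j) * s (f i) (f j) = 0" by (simp add: orth)
        qed
      qed auto
      finally have 2: "s (f i) F = (\<Sum>j\<in>{j. j < k \<and> m j = m i}. cnj (c j) * s (f i) (f j))" .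
      show ?thesis
      proof (cases "m i = r")
        case False
        have "s (f i) E = 0" unfolding 1 by (rule sum.neutral) (use False orth[of i] in auto)
        then show ?thesis using False by simp
      qed (use 1 2 in simp)
    qed
    have "s E E = (\<Sum>i\<in>{i. i < k \<and> m i = r}. c i * s (f i) E)"
      unfolding E_def by (subst s.sum_left) (use fV E in \<open>auto simp: E_def\<close>)
    also have "\<dots> = (\<Sum>i\<in>{i. i < k \<and> m i = r}. c i * s (f i) F)"
      by (rule sum.cong) (auto simp: sE)
    also have "\<dots> = s E F"
      unfolding E_def by (rule s.sum_left[symmetric]) (use fV F in auto)
    also have "\<dots> = cnj (s F E)" by (rule s.herm[OF F E])
    also have "\<dots> = 0" using null_left[OF F E sF] by simp
    finally have "AE x in lborel. x \<in> U \<longrightarrow> E x = 0" using null_iff[OF E] by simp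
    \<comment> \<open>Coefficients of \<open>E\<close> in the basis \<open>\<Phi> r\<close>; basis
      vectors that belong to indices beyond \<open>k\<close> receive 0.\<close>
    moreover define c' where "c' j = (let n = the_inv_into (N r) (b r) j in if n \<le> k then c (n - 1) else 0)" for j
    have binj: "inj_on (b r) (N r)" and bimg: "b r ` N r = {..<card (N r)}" using b[of r] by (auto simp: bij_betw_def)
    have "E x = (\<Sum>j<card (N r). c' j * \<Phi> r j x)" for x
    proof -
      have "(\<Sum>j<card (N r). c' j * \<Phi> r j x) = (\<Sum>n\<in>N r. c' (b r n) * \<Phi> r (b r n) x)"
        unfolding bimg[symmetric] by (rule sum.reindex[OF binj, unfolded o_def])
      also have "\<dots> = (\<Sum>n\<in>N r. (if n \<le> k then c (n - 1) * \<Phi> r (b r n) x else 0))"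
        by (rule sum.cong) (auto simp: c'_def the_inv_into_f_f[OF binj])
      also have "\<dots> = (\<Sum>n\<in>{n\<in>N r. n \<le> k}. c (n - 1) * \<Phi> r (b r n) x)"
        by (rule sum.inter_filter[symmetric]) (rule fin)
      also have "{n\<in>N r. n \<le> k} = Suc ` {i. i < k \<and> m i = r}"
      proof (intro set_eqI iffI)
        fix n assume "n \<in> {n\<in>N r. n \<le> k}"
        then show "n \<in> Suc ` {i. i < k \<and> m i = r}"
          by (intro image_eqI[of _ _ "n - 1"]) (auto simp: N_def m_def)
      qed (auto simp: N_def m_def)
      also have "(\<Sum>n\<in>Suc ` {i. i < k \<and> m i = r}. c (n - 1) * \<Phi> r (b r n) x) = E x"
        unfolding E_def by (subst sum.reindex) (auto simp: f_def intro!: sum.cong)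
      finally show ?thesis by simp
    qed
    ultimately have "\<forall>j<card (N r). c' j = 0" using \<Phi>(2)[where r = r and c = c'] by simp
    moreover have "b r (Suc i0) < card (N r)" using bimg Nm[of i0] by (auto simp: r_def)
    moreover have "c' (b r (Suc i0)) = c i0"
      using Nm[of i0] i0 by (simp add: c'_def r_def the_inv_into_f_f[OF binj[unfolded r_def]])
    ultimately show False using i0 by simp
  qed
  have qF: "Re (q F F) \<le> \<mu> k * Re (s F F)"
  proof -
    have mk: "m i \<le> \<mu> k" if "i < k" for i
      using ev that by (auto simp: lists_eigenvalues_def mono_on_def m_def)
    define t where "t i = sqrt (\<mu> k - m i)" for i
    define G where "G = (\<lambda>x. \<Sum>i<k. (of_real (t i) * c i) * f i x)"
    have G: "G \<in> V" unfolding G_def by (rule s.sum_mem) (rule fV)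
    have "s G G = (\<Sum>i<k. of_real (t i) * c i * (\<Sum>j<k. cnj (of_real (t j) * c j) * s (f i) (f j)))"
      unfolding G_def by (subst s.sum_left, use fV G in \<open>simp_all add: G_def\<close>)
        (subst s.sum_right, use fV in simp_all)
    also have "\<dots> = (\<Sum>i<k. (of_real (\<mu> k - m i) * c i) * (\<Sum>j<k. cnj (c j) * s (f i) (f j)))"
    proof (rule sum.cong)
      fix i assume i: "i \<in> {..<k}"
      \<comment> \<open>The two weights agree whenever the inner product is not 0, so their product
        is the plain factor \<open>\<mu> k - m i\<close>.\<close>
      have X: "of_real (t i) * (cnj (of_real (t j) * c j) * s (f i) (f j)) = of_real (\<mu> k - m i) * (cnj (c j) * s (f i) (f j))" for j
      proof (cases "m i = m j")
        case True
        have "of_real (t i) * of_real (t j) = complex_of_real (\<mu> k - m i)"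
          unfolding of_real_mult[symmetric] using mk[of i] i True by (simp add: t_def)
        then show ?thesis by (simp add: mult.assoc[symmetric])
      qed (simp add: orth)
      have "of_real (t i) * c i * (\<Sum>j<k. cnj (of_real (t j) * c j) * s (f i) (f j)) =
          c i * (\<Sum>j<k. of_real (t i) * (cnj (of_real (t j) * c j) * s (f i) (f j)))"
        unfolding sum_distrib_left[of "of_real (t i)", symmetric] by (simp only: mult_ac)
      also have "\<dots> = c i * (of_real (\<mu> k - m i) * (\<Sum>j<k. cnj (c j) * s (f i) (f j)))"
        unfolding X sum_distrib_left[of "of_real (\<mu> k - m i)", symmetric] ..
      also have "\<dots> = (of_real (\<mu> k - m i) * c i) * (\<Sum>j<k. cnj (c j) * s (f i) (f j))"
        by (simp only: mult_ac)
      finally show "of_real (t i) * c i * (\<Sum>j<k. cnj (of_real (t j) * c j) * s (f i) (f j)) =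
          (of_real (\<mu> k - m i) * c i) * (\<Sum>j<k. cnj (c j) * s (f i) (f j))" .
    qed simp
    also have "\<dots> = (\<Sum>i<k. (of_real (\<mu> k - m i) * c i) * s (f i) F)"
      unfolding F_def using fV by (subst s.sum_right) auto
    also have "\<dots> = of_real (\<mu> k) * (\<Sum>i<k. c i * s (f i) F) - (\<Sum>i<k. c i * (of_real (m i) * s (f i) F))"
      by (simp add: sum_distrib_left sum_subtractf[symmetric] algebra_simps)
    also have "(\<Sum>i<k. c i * s (f i) F) = s F F"
      unfolding F_def using fV F by (subst s.sum_left) (auto simp: F_def)
    also have "(\<Sum>i<k. c i * (of_real (m i) * s (f i) F)) = (\<Sum>i<k. c i * q (f i) F)"
      using e F by (simp add: eigvec_def)
    also have "\<dots> = q F F"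
      unfolding F_def using fV F by (subst q.sum_left) (auto simp: F_def)
    finally have "s G G = of_real (\<mu> k) * s F F - q F F" .
    with s.nonneg[OF G] show ?thesis by simp
  qed
  show thesis using that[OF F sF lF qF] .
qed

end

locale compact_spectral_form = compact_form V s q + spectral_form V s q U T
  for V :: "('a::euclidean_space \<Rightarrow> complex) set" and s q U T
begin

text \<open>The functions \<open>\<phi> i\<close> are zero from the dimension of the form domain onwards, should that be less than \<open>m\<close>.\<close>

lemma spectral_lower_bound:
  assumes ev: "lists_eigenvalues U T \<rho>"
  obtains \<phi> where "\<And>i. i < m \<Longrightarrow> \<phi> i \<in> V \<and> (\<phi> i = (\<lambda>x. 0) \<or> s (\<phi> i) (\<phi> i) = 1)"
    "\<And>u. u \<in> V \<Longrightarrow>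
      \<rho> (Suc m) * Re (s u u) - (\<Sum>i<m. (\<rho> (Suc m) - \<rho> (Suc i)) * (cmod (s u (\<phi> i)))\<^sup>2) \<le> Re (q u u)"
proof -
  obtain n \<phi> c where n: "n \<le> Suc m" and on: "orthonormal n \<phi>" and e: "\<And>i. i < n \<Longrightarrow> eigvec (c i) (\<phi> i)"
    and min: "\<forall>i<n. \<forall>u\<in>V. (\<forall>j<i. s u (\<phi> j) = 0) \<longrightarrow> c i * Re (s u u) \<le> Re (q u u)"
    and alt: "n = Suc m \<or> (\<forall>u\<in>V. (\<forall>j<n. s u (\<phi> j) = 0) \<longrightarrow> s u u = 0)"
    using eigen_sequence[of "Suc m"] by blast
  have P: "\<phi> i \<in> V" if "i < n" for i using on that by (auto simp: orthonormal_def)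
  \<comment> \<open>\<open>\<phi> j\<close> is orthogonal to the first \<open>i\<close> vectors, so
    it competes in the minimisation that produced \<open>\<phi> i\<close>.\<close>
  have c_mono: "c i \<le> c j" if "i \<le> j" "j < n" for i j
  proof -
    have s1: "s (\<phi> j) (\<phi> j) = 1" "\<forall>l<i. s (\<phi> j) (\<phi> l) = 0"
      using on that unfolding orthonormal_def by simp_all
    have "q (\<phi> j) (\<phi> j) = of_real (c j)" using e[of j] s1 P[of j] that by (simp add: eigvec_def)
    moreover have "c i * Re (s (\<phi> j) (\<phi> j)) \<le> Re (q (\<phi> j) (\<phi> j))"
    proof (rule min[rule_format])
      show "s (\<phi> j) (\<phi> l) = 0" if "l < i" for l using s1(2) that by blast
    qed (use that P in auto)
    ultimately show ?thesis using s1 by simp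
  qed
  have rc: "\<rho> (Suc i) \<le> c i" if "i < n" for i
  proof (rule eigenvalue_le_of_orthonormal[OF ev, where c = c and \<phi> = \<phi>])
    show "orthonormal (Suc i) \<phi>" using on that by (auto simp: orthonormal_def)
    show "eigvec (c j) (\<phi> j)" if "j < Suc i" for j by (rule e) (use that \<open>i < n\<close> in simp)
    show "c j \<le> c i" if "j < Suc i" for j by (rule c_mono) (use that \<open>i < n\<close> in simp_all)
  qed simp
  \<comment> \<open>If \<open>n = Suc m\<close>, the first \<open>m\<close> vectors are split off
    and \<open>c m\<close> bounds the energy of the rest from below. Otherwise the \<open>n\<close>
    vectors exhaust the domain and the rest is a null vector.\<close>
  define l where "l = min n m"
  define \<phi>' where "\<phi>' i = (if i < l then \<phi> i else (\<lambda>x. 0))" for i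
  have ol: "orthonormal l \<phi>" and el: "\<And>i. i < l \<Longrightarrow> eigvec (c i) (\<phi> i)"
    using on e by (auto simp: orthonormal_def l_def)
  show thesis
  proof (rule that)
    fix i assume "i < m"
    show "\<phi>' i \<in> V \<and> (\<phi>' i = (\<lambda>x. 0) \<or> s (\<phi>' i) (\<phi>' i) = 1)"
      using ol s.zero_mem by (auto simp: \<phi>'_def orthonormal_def)
  next
    fix u assume u: "u \<in> V"
    define u' where "u' = (\<lambda>x. u x - (\<Sum>i<l. s u (\<phi> i) * \<phi> i x))"
    note R = residual[OF ol u, folded u'_def] residual_form[OF ol u el, folded u'_def]
    have q': "\<rho> (Suc m) * Re (s u' u') \<le> Re (q u' u')"
    proof (cases "n = Suc m")
      case True
      then have lm: "l = m" by (simp add: l_def)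
      have "c m * Re (s u' u') \<le> Re (q u' u')" using min True R(1,2) lm by simp
      moreover have "\<rho> (Suc m) * Re (s u' u') \<le> c m * Re (s u' u')"
        using rc[of m] True s.nonneg[OF R(1)] by (intro mult_right_mono) auto
      ultimately show ?thesis by simp
    next
      case False
      then have "l = n" using n by (simp add: l_def)
      then have "s u' u' = 0" using alt False R(1,2) by blast
      then show ?thesis using q.nonneg[OF R(1)] by simp
    qed
    have "(\<Sum>i<m. (\<rho> (Suc m) - \<rho> (Suc i)) * (cmod (s u (\<phi>' i)))\<^sup>2) =
        (\<Sum>i<l. (\<rho> (Suc m) - \<rho> (Suc i)) * (cmod (s u (\<phi> i)))\<^sup>2)"
    proof -
      have "s u (\<lambda>x. 0) = 0" using s.scale_right[of "\<lambda>x. 0" u 0] s.zero_mem u by simp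
      then show ?thesis
        by (intro sum.mono_neutral_cong_right) (auto simp: l_def \<phi>'_def)
    qed
    \<comment> \<open>Replacing \<open>c i\<close> by the possibly smaller
      \<open>\<rho> (Suc i)\<close> can only enlarge the correction that is subtracted.\<close>
    also have "\<dots> \<ge> (\<Sum>i<l. (\<rho> (Suc m) - c i) * (cmod (s u (\<phi> i)))\<^sup>2)"
      by (intro sum_mono mult_right_mono diff_left_mono rc) (auto simp: l_def)
    ultimately have "(\<Sum>i<m. (\<rho> (Suc m) - \<rho> (Suc i)) * (cmod (s u (\<phi>' i)))\<^sup>2) \<ge>
        \<rho> (Suc m) * (\<Sum>i<l. (cmod (s u (\<phi> i)))\<^sup>2) - (\<Sum>i<l. c i * (cmod (s u (\<phi> i)))\<^sup>2)"
      by (simp add: left_diff_distrib sum_subtractf sum_distrib_left)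
    then show "\<rho> (Suc m) * Re (s u u) - (\<Sum>i<m. (\<rho> (Suc m) - \<rho> (Suc i)) * (cmod (s u (\<phi>' i)))\<^sup>2) \<le> Re (q u u)"
      using q' R(3,4) by (simp add: right_diff_distrib)
  qed
qed

end

section \<open>The space of square integrable functions\<close>

lemma L2_iff:
  "f \<in> L2 U \<longleftrightarrow> (\<lambda>x. indicator U x *\<^sub>R f x) \<in> borel_measurable lborel \<and>
     integrable lborel (\<lambda>x. (cmod (indicator U x *\<^sub>R f x))\<^sup>2)"
proof -
  have "(\<lambda>x. (cmod (indicator U x *\<^sub>R f x))\<^sup>2) = (\<lambda>x. indicator U x *\<^sub>R (cmod (f x))\<^sup>2)"
    by (auto simp: indicator_def)
  then show ?thesis by (simp add: L2_def set_borel_measurable_def set_integrable_def)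
qed

lemma L2_mult_integrable:
  assumes "f \<in> L2 U" "g \<in> L2 U" shows "set_integrable lborel U (\<lambda>x. f x * g x)"
proof -
  let ?F = "\<lambda>x. indicator U x *\<^sub>R f x" and ?G = "\<lambda>x. indicator U x *\<^sub>R g x"
  have m: "?F \<in> borel_measurable lborel" "?G \<in> borel_measurable lborel"
    and i: "integrable lborel (\<lambda>x. (cmod (?F x))\<^sup>2)" "integrable lborel (\<lambda>x. (cmod (?G x))\<^sup>2)"
    using assms unfolding L2_iff by blast+
  have "integrable lborel (\<lambda>x. ?F x * ?G x)"
  proof (rule Bochner_Integration.integrable_bound[OF Bochner_Integration.integrable_add[OF i]])
    show "(\<lambda>x. ?F x * ?G x) \<in> borel_measurable lborel" by (rule borel_measurable_times[OF m])
    show "AE x in lborel. cmod (?F x * ?G x) \<le> norm ((cmod (?F x))\<^sup>2 + (cmod (?G x))\<^sup>2)"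
    proof (rule AE_I2)
      fix x
      have "0 \<le> cmod (?F x)" "0 \<le> cmod (?G x)" by simp_all
      then have "cmod (?F x) * cmod (?G x) \<le> (cmod (?F x))\<^sup>2 + (cmod (?G x))\<^sup>2"
        using sum_squares_bound[of "cmod (?F x)" "cmod (?G x)"] mult_nonneg_nonneg[of "cmod (?F x)" "cmod (?G x)"]
        by linarith
      then show "cmod (?F x * ?G x) \<le> norm ((cmod (?F x))\<^sup>2 + (cmod (?G x))\<^sup>2)"
        by (simp only: norm_mult real_norm_def)
    qed
  qed
  moreover have "(\<lambda>x. ?F x * ?G x) = (\<lambda>x. indicator U x *\<^sub>R (f x * g x))" by (auto simp: indicator_def)
  ultimately show ?thesis by (simp add: set_integrable_def)
qed

lemma L2_cnj: "f \<in> L2 U \<Longrightarrow> (\<lambda>x. cnj (f x)) \<in> L2 U"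
proof -
  assume f: "f \<in> L2 U"
  have "(\<lambda>x. cnj (indicator U x *\<^sub>R f x)) \<in> borel_measurable lborel"
    using f unfolding L2_iff by (intro borel_measurable_continuous_on[OF continuous_on_cnj[OF continuous_on_id]]) auto
  moreover have "(\<lambda>x. cnj (indicator U x *\<^sub>R f x)) = (\<lambda>x. indicator U x *\<^sub>R cnj (f x))" by (auto simp: indicator_def)
  ultimately show ?thesis using f by (simp add: L2_iff)
qed

lemma L2_inner_integrable: "f \<in> L2 U \<Longrightarrow> g \<in> L2 U \<Longrightarrow> set_integrable lborel U (\<lambda>x. f x * cnj (g x))"
  by (rule L2_mult_integrable[OF _ L2_cnj])

lemma L2_add: assumes "f \<in> L2 U" "g \<in> L2 U" shows "(\<lambda>x. f x + g x) \<in> L2 U"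
proof -
  let ?F = "\<lambda>x. indicator U x *\<^sub>R f x" and ?G = "\<lambda>x. indicator U x *\<^sub>R g x"
  have m: "?F \<in> borel_measurable lborel" "?G \<in> borel_measurable lborel"
    and i: "integrable lborel (\<lambda>x. (cmod (?F x))\<^sup>2)" "integrable lborel (\<lambda>x. (cmod (?G x))\<^sup>2)"
    using assms unfolding L2_iff by blast+
  have m2: "(\<lambda>x. ?F x + ?G x) \<in> borel_measurable lborel" by (rule borel_measurable_add[OF m])
  have i2: "integrable lborel (\<lambda>x. 2 * (cmod (?F x))\<^sup>2 + 2 * (cmod (?G x))\<^sup>2)"
    by (intro Bochner_Integration.integrable_add integrable_mult_right i)
  have "integrable lborel (\<lambda>x. (cmod (?F x + ?G x))\<^sup>2)"
  proof (rule Bochner_Integration.integrable_bound[OF i2])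
    show "(\<lambda>x. (cmod (?F x + ?G x))\<^sup>2) \<in> borel_measurable lborel" using m2 by measurable
    show "AE x in lborel. norm ((cmod (?F x + ?G x))\<^sup>2) \<le> norm (2 * (cmod (?F x))\<^sup>2 + 2 * (cmod (?G x))\<^sup>2)"
    proof (rule AE_I2)
      fix x
      have "(cmod (?F x + ?G x))\<^sup>2 \<le> (cmod (?F x) + cmod (?G x))\<^sup>2"
        by (intro power_mono norm_triangle_ineq) simp
      also have "\<dots> \<le> 2 * (cmod (?F x))\<^sup>2 + 2 * (cmod (?G x))\<^sup>2"
        using sum_squares_bound[of "cmod (?F x)" "cmod (?G x)"] unfolding power2_sum by linarith
      finally show "norm ((cmod (?F x + ?G x))\<^sup>2) \<le> norm (2 * (cmod (?F x))\<^sup>2 + 2 * (cmod (?G x))\<^sup>2)" by simp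
    qed
  qed
  with m2 show ?thesis by (simp add: L2_iff scaleR_add_right)
qed

lemma L2_scale: assumes "f \<in> L2 U" shows "(\<lambda>x. c * f x) \<in> L2 U"
proof -
  let ?F = "\<lambda>x. indicator U x *\<^sub>R f x"
  have e: "indicator U x *\<^sub>R (c * f x) = c * ?F x" for x by (auto simp: indicator_def)
  have m: "?F \<in> borel_measurable lborel" and i: "integrable lborel (\<lambda>x. (cmod (?F x))\<^sup>2)"
    using assms unfolding L2_iff by blast+
  have 1: "(\<lambda>x. c * ?F x) \<in> borel_measurable lborel" by (rule borel_measurable_times[OF borel_measurable_const m])
  have 2: "integrable lborel (\<lambda>x. (cmod (c * ?F x))\<^sup>2)"
    unfolding norm_mult power_mult_distrib by (rule integrable_mult_right[OF i])
  show ?thesis unfolding L2_iff e by (rule conjI[OF 1 2])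
qed

lemma L2_zero: "(\<lambda>x. 0) \<in> L2 U" by (simp add: L2_iff)

lemma L2_inner_self: "L2_inner U f f = of_real (LINT x:U|lborel. (cmod (f x))\<^sup>2)"
  unfolding L2_inner_def complex_norm_square[symmetric] by (rule set_integral_complex_of_real)

lemma set_integral_nonneg': "(\<And>x. 0 \<le> f x) \<Longrightarrow> 0 \<le> (LINT x:U|lborel. (f x :: real))"
  unfolding set_lebesgue_integral_def by (intro integral_nonneg_AE AE_I2) (simp add: indicator_def)

interpretation L2: semi_inner "L2 U" "L2_inner U" for U :: "'a::euclidean_space set"
proof
  fix u v w :: "'a \<Rightarrow> complex" and c assume u: "u \<in> L2 U"
  show "0 \<le> Re (L2_inner U u u)" by (simp add: L2_inner_self set_integral_nonneg')
  show "(\<lambda>x. c * u x) \<in> L2 U" by (rule L2_scale[OF u])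
  assume w: "w \<in> L2 U"
  show "L2_inner U (\<lambda>x. c * u x) w = c * L2_inner U u w"
    by (simp add: L2_inner_def mult.assoc)
  show "L2_inner U w u = cnj (L2_inner U u w)"
    unfolding L2_inner_def set_lebesgue_integral_def Bochner_Integration.integral_cnj[symmetric]
    by (simp add: mult.commute)
next
  fix u v w :: "'a \<Rightarrow> complex" assume u: "u \<in> L2 U" and v: "v \<in> L2 U"
  show "(\<lambda>x. u x + v x) \<in> L2 U" by (rule L2_add[OF u v])
  assume w: "w \<in> L2 U"
  show "L2_inner U (\<lambda>x. u x + v x) w = L2_inner U u w + L2_inner U v w"
    unfolding L2_inner_def
    by (simp add: distrib_right set_integral_add[OF L2_inner_integrable[OF u w] L2_inner_integrable[OF v w]])
qed (rule L2_zero)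

lemma L2_norm_eq: "L2_norm U = semi_inner.nrm (L2_inner U)"
  by (simp add: fun_eq_iff L2_norm_def L2.nrm_def L2_inner_self)

lemma L2_inner_cong:
  assumes "AE x in lborel. x \<in> U \<longrightarrow> f x = f' x" "AE x in lborel. x \<in> U \<longrightarrow> g x = g' x"
    and "f \<in> L2 U" "f' \<in> L2 U" "g \<in> L2 U" "g' \<in> L2 U"
  shows "L2_inner U f g = L2_inner U f' g'"
  unfolding L2_inner_def set_lebesgue_integral_def
proof (rule integral_cong_AE)
  show "AE x in lborel. indicat_real U x *\<^sub>R (f x * cnj (g x)) = indicat_real U x *\<^sub>R (f' x * cnj (g' x))"
    using assms(1,2) by eventually_elim (auto simp: indicator_def)
  show "(\<lambda>x. indicat_real U x *\<^sub>R (f x * cnj (g x))) \<in> borel_measurable lborel"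
    using L2_inner_integrable[OF assms(3,5)] unfolding set_integrable_def by (rule borel_measurable_integrable)
  show "(\<lambda>x. indicat_real U x *\<^sub>R (f' x * cnj (g' x))) \<in> borel_measurable lborel"
    using L2_inner_integrable[OF assms(4,6)] unfolding set_integrable_def by (rule borel_measurable_integrable)
qed

lemma L2_norm_cong:
  assumes "AE x in lborel. x \<in> U \<longrightarrow> f x = f' x" "f \<in> L2 U" "f' \<in> L2 U"
  shows "L2_norm U f = L2_norm U f'"
  unfolding L2_norm_eq L2.nrm_def using L2_inner_cong[OF assms(1,1)] assms(2,3) by simp

lemma L2_null_iff:
  assumes f: "f \<in> L2 U"
  shows "L2_inner U f f = 0 \<longleftrightarrow> (AE x in lborel. x \<in> U \<longrightarrow> f x = 0)"
proof -
  have "L2_inner U f f = 0 \<longleftrightarrow> integral\<^sup>L lborel (\<lambda>x. indicator U x *\<^sub>R (cmod (f x))\<^sup>2) = 0"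
    by (simp add: L2_inner_self set_lebesgue_integral_def)
  also have "\<dots> \<longleftrightarrow> (AE x in lborel. indicator U x *\<^sub>R (cmod (f x))\<^sup>2 = 0)"
    by (rule integral_nonneg_eq_0_iff_AE) (use f in \<open>auto simp: L2_def set_integrable_def indicator_def\<close>)
  also have "\<dots> \<longleftrightarrow> (AE x in lborel. x \<in> U \<longrightarrow> f x = 0)"
    by (intro AE_cong) (auto simp: indicator_def)
  finally show ?thesis .
qed

lemma L2_const: "U \<in> sets lborel \<Longrightarrow> emeasure lborel U < \<infinity> \<Longrightarrow> (\<lambda>x. c) \<in> L2 U"
  unfolding L2_def set_borel_measurable_def set_integrable_def by (simp add: measurable_lborel1)

lemma L2_imp_integrable: 
  assumes "U \<in> sets lborel" "emeasure lborel U < \<infinity>" "f \<in> L2 U"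
  shows "set_integrable lborel U f"
  using L2_mult_integrable[OF L2_const[OF assms(1,2), of 1] assms(3)] by simp

lemma cmod_indicator: "cmod (indicator U x *\<^sub>R z) = indicator U x * cmod z"
  by (simp add: indicator_def)

text \<open>Cauchy-Schwarz for the modulus of \<open>f\<close> against the constant 1.\<close>

lemma L2_L1_bound:
  assumes U: "U \<in> sets lborel" "emeasure lborel U < \<infinity>" and f: "f \<in> L2 U"
  shows "(LINT x|lborel. cmod (indicator U x *\<^sub>R f x)) \<le> L2_norm U f * sqrt (measure lborel U)"
proof -
  have c: "(\<lambda>x. of_real (cmod (f x))) \<in> L2 U"
  proof -
    have [measurable]: "(\<lambda>x. indicator U x *\<^sub>R f x) \<in> borel_measurable lborel"
      using f unfolding L2_iff by blast
    have "(\<lambda>x. complex_of_real (cmod (indicator U x *\<^sub>R f x))) \<in> borel_measurable lborel"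
      by measurable
    moreover have "(\<lambda>x. indicator U x *\<^sub>R complex_of_real (cmod (f x))) = (\<lambda>x. complex_of_real (cmod (indicator U x *\<^sub>R f x)))"
      by (auto simp: indicator_def)
    ultimately show ?thesis using f by (simp add: L2_iff)
  qed
  have o: "(\<lambda>x. 1) \<in> L2 U" using U by (rule L2_const)
  have "cmod (L2_inner U (\<lambda>x. of_real (cmod (f x))) (\<lambda>x. 1)) \<le> L2_norm U (\<lambda>x. of_real (cmod (f x))) * L2_norm U (\<lambda>x. 1)"
    unfolding L2_norm_eq by (rule L2.cmod_le_nrm[OF c o])
  moreover have "L2_inner U (\<lambda>x. of_real (cmod (f x))) (\<lambda>x. 1) = of_real (LINT x|lborel. cmod (indicator U x *\<^sub>R f x))"
    unfolding L2_inner_def cmod_indicator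
    by (simp add: set_lebesgue_integral_def set_integral_complex_of_real[unfolded set_lebesgue_integral_def])
  moreover have "L2_norm U (\<lambda>x. of_real (cmod (f x))) = L2_norm U f" by (simp add: L2_norm_def)
  moreover have "L2_norm U (\<lambda>x. 1) = sqrt (measure lborel U)"
    using U by (simp add: L2_norm_def set_lebesgue_integral_def)
  moreover have "0 \<le> (LINT x|lborel. cmod (indicator U x *\<^sub>R f x))" by simp
  ultimately show ?thesis by simp
qed

text \<open>On a set of finite measure an \<open>L\<^sup>2\<close> Cauchy sequence is Cauchy in \<open>L\<^sup>1\<close>, so a subsequence converges almost
  everywhere, and Fatou's lemma shows that its limit is the \<open>L\<^sup>2\<close> limit.\<close>

lemma L2_complete:
  fixes u :: "nat \<Rightarrow> 'a::euclidean_space \<Rightarrow> complex"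
  assumes U: "U \<in> sets lborel" "emeasure lborel U < \<infinity>" and u: "\<And>n. u n \<in> L2 U"
    and cau: "\<And>e. e > 0 \<Longrightarrow> \<exists>N. \<forall>m\<ge>N. \<forall>n\<ge>N. L2_norm U (\<lambda>x. u m x - u n x) < e"
  shows "\<exists>v\<in>L2 U. (\<lambda>n. L2_norm U (\<lambda>x. u n x - v x)) \<longlonglongrightarrow> 0"
proof -
  define w where "w n x = indicator U x *\<^sub>R u n x" for n x
  have wm[measurable]: "w n \<in> borel_measurable lborel" for n
    unfolding w_def using u[of n] by (simp add: L2_iff)
  have dL2: "(\<lambda>x. u m x - u n x) \<in> L2 U" for m n by (rule L2.diff_mem[OF u u])
  have wi: "integrable lborel (w n)" for n
    using L2_imp_integrable[OF U u[of n]] by (simp add: set_integrable_def w_def[abs_def])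
  have wd: "w m x - w n x = indicator U x *\<^sub>R (u m x - u n x)" for m n x
    by (simp add: w_def scaleR_diff_right)
  define M where "M = sqrt (measure lborel U)"
  have M: "0 \<le> M" by (simp add: M_def)
  have L1: "(LINT x|lborel. cmod (w m x - w n x)) \<le> L2_norm U (\<lambda>x. u m x - u n x) * M" for m n
    unfolding wd M_def by (rule L2_L1_bound[OF U dL2])
  have cauL1: "\<exists>N. \<forall>i\<ge>N. \<forall>j\<ge>N. (LINT x|lborel. cmod (w i x - w j x)) < e" if e: "e > 0" for e
  proof -
    obtain N where N: "\<forall>m\<ge>N. \<forall>n\<ge>N. L2_norm U (\<lambda>x. u m x - u n x) < e / (M + 1)"
      using cau[of "e / (M + 1)"] e M by auto
    have "(LINT x|lborel. cmod (w i x - w j x)) < e" if "i \<ge> N" "j \<ge> N" for i j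
    proof -
      have "(LINT x|lborel. cmod (w i x - w j x)) \<le> e / (M + 1) * M"
        using L1[of i j] N that M by (meson less_imp_le mult_right_mono order_trans)
      also have "\<dots> < e" using e M by (simp add: field_simps)
      finally show ?thesis .
    qed
    then show ?thesis by blast
  qed
  obtain r where r: "strict_mono r" and cr: "AE x in lborel. Cauchy (\<lambda>i. w (r i) x)"
    using cauchy_L1_AE_cauchy_subseq[OF wi cauL1] by blast
  define v where "v x = lim (\<lambda>i. w (r i) x)" for x
  have vm[measurable]: "v \<in> borel_measurable lborel" unfolding v_def[abs_def] by measurable
  have lim: "AE x in lborel. (\<lambda>i. w (r i) x) \<longlonglongrightarrow> v x"
    using cr by eventually_elim (simp add: v_def Cauchy_convergent_iff convergent_LIMSEQ_iff)
  have fatou: "(\<integral>\<^sup>+x. ennreal ((cmod (w n x - v x))\<^sup>2) \<partial>lborel) \<le> ennreal (e\<^sup>2)"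
    if N: "\<forall>m\<ge>N. \<forall>n\<ge>N. L2_norm U (\<lambda>x. u m x - u n x) < e" and n: "n \<ge> N" for n N e
  proof -
    have "(\<integral>\<^sup>+x. ennreal ((cmod (w n x - v x))\<^sup>2) \<partial>lborel) =
      (\<integral>\<^sup>+x. liminf (\<lambda>i. ennreal ((cmod (w n x - w (r i) x))\<^sup>2)) \<partial>lborel)"
    proof (rule nn_integral_cong_AE)
      show "AE x in lborel. ennreal ((cmod (w n x - v x))\<^sup>2) = liminf (\<lambda>i. ennreal ((cmod (w n x - w (r i) x))\<^sup>2))"
        using lim
      proof eventually_elim
        case (elim x)
        then have "(\<lambda>i. ennreal ((cmod (w n x - w (r i) x))\<^sup>2)) \<longlonglongrightarrow> ennreal ((cmod (w n x - v x))\<^sup>2)"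
          by (intro tendsto_intros)
        then show ?case by (intro lim_imp_Liminf[symmetric]) auto
      qed
    qed
    also have "\<dots> \<le> liminf (\<lambda>i. \<integral>\<^sup>+x. ennreal ((cmod (w n x - w (r i) x))\<^sup>2) \<partial>lborel)"
      by (rule nn_integral_liminf) measurable
    also have "\<dots> \<le> ennreal (e\<^sup>2)"
    proof (rule order_trans[OF Liminf_le_Limsup Limsup_bounded])
      \<comment> \<open>Since \<open>r i \<ge> i\<close>, the Cauchy estimate holds along a tail of
        the subsequence, which is all that the lower limit sees.\<close>
      show "\<forall>\<^sub>F i in sequentially. (\<integral>\<^sup>+x. ennreal ((cmod (w n x - w (r i) x))\<^sup>2) \<partial>lborel) \<le> ennreal (e\<^sup>2)"
        unfolding eventually_sequentially
      proof (intro exI[of _ N] allI impI)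
        fix i assume "N \<le> i"
        then have "L2_norm U (\<lambda>x. u n x - u (r i) x) < e"
          using N n seq_suble[OF r, of i] by simp
        moreover have "0 \<le> L2_norm U (\<lambda>x. u n x - u (r i) x)" by (simp add: L2_norm_def set_integral_nonneg')
        ultimately have "(L2_norm U (\<lambda>x. u n x - u (r i) x))\<^sup>2 \<le> e\<^sup>2" by (intro power_mono) auto
        moreover have "(\<integral>\<^sup>+x. ennreal ((cmod (w n x - w (r i) x))\<^sup>2) \<partial>lborel) = ennreal ((L2_norm U (\<lambda>x. u n x - u (r i) x))\<^sup>2)"
        proof -
          have "integrable lborel (\<lambda>x. (cmod (w n x - w (r i) x))\<^sup>2)" using dL2[of n "r i"] by (simp add: L2_iff wd)
          then have "(\<integral>\<^sup>+x. ennreal ((cmod (w n x - w (r i) x))\<^sup>2) \<partial>lborel) = ennreal (LINT x|lborel. (cmod (w n x - w (r i) x))\<^sup>2)"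
            by (rule nn_integral_eq_integral) simp
          also have "(LINT x|lborel. (cmod (w n x - w (r i) x))\<^sup>2) = (LINT x:U|lborel. (cmod (u n x - u (r i) x))\<^sup>2)"
            unfolding set_lebesgue_integral_def wd by (intro Bochner_Integration.integral_cong) (auto simp: indicator_def)
          also have "\<dots> = (L2_norm U (\<lambda>x. u n x - u (r i) x))\<^sup>2"
            by (simp add: L2_norm_def set_integral_nonneg')
          finally show ?thesis .
        qed
        ultimately show "(\<integral>\<^sup>+x. ennreal ((cmod (w n x - w (r i) x))\<^sup>2) \<partial>lborel) \<le> ennreal (e\<^sup>2)"
          by (simp add: ennreal_leI)
      qed
    qed auto
    finally show ?thesis .
  qed
  \<comment> \<open>The cut-off does not increase the error, because every \<open>w n\<close>
    vanishes outside \<open>U\<close>.\<close>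
  define V where "V x = indicator U x *\<^sub>R v x" for x
  have Vm[measurable]: "V \<in> borel_measurable lborel"
    unfolding V_def[abs_def] using U by (intro borel_measurable_scaleR) auto
  have VU: "indicator U x *\<^sub>R V x = V x" for x by (simp add: V_def indicator_def)
  have le: "(cmod (w n x - V x))\<^sup>2 \<le> (cmod (w n x - v x))\<^sup>2" for n x
    by (cases "x \<in> U") (auto simp: V_def w_def)
  have fatou': "integrable lborel (\<lambda>x. (cmod (w n x - V x))\<^sup>2) \<and> (LINT x|lborel. (cmod (w n x - V x))\<^sup>2) \<le> e\<^sup>2"
    if "\<forall>m\<ge>N. \<forall>n\<ge>N. L2_norm U (\<lambda>x. u m x - u n x) < e" "n \<ge> N" for n N e
  proof -
    have b: "(\<integral>\<^sup>+x. ennreal ((cmod (w n x - V x))\<^sup>2) \<partial>lborel) \<le> ennreal (e\<^sup>2)"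
      using le by (intro order_trans[OF nn_integral_mono fatou[OF that]]) (simp add: ennreal_leI)
    have i: "integrable lborel (\<lambda>x. (cmod (w n x - V x))\<^sup>2)"
      by (rule integrableI_bounded) (use b in \<open>auto simp: order.strict_trans1 less_top[symmetric] top_unique\<close>)
    have "ennreal (LINT x|lborel. (cmod (w n x - V x))\<^sup>2) \<le> ennreal (e\<^sup>2)"
      using b nn_integral_eq_integral[OF i] by simp
    then show ?thesis using i by (simp add: ennreal_le_iff)
  qed
  have wV: "w n x - V x = indicator U x *\<^sub>R (u n x - V x)" for n x
    using VU[of x] by (simp add: w_def scaleR_diff_right)
  obtain N1 where N1: "\<forall>m\<ge>N1. \<forall>n\<ge>N1. L2_norm U (\<lambda>x. u m x - u n x) < 1" using cau[of 1] by auto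
  have "(\<lambda>x. u N1 x - V x) \<in> L2 U"
  proof -
    have m: "(\<lambda>x. w N1 x - V x) \<in> borel_measurable lborel" by measurable
    show ?thesis using m fatou'[OF N1, of N1] unfolding L2_iff wV by simp
  qed
  from L2.diff_mem[OF u[of N1] this] have VL2: "V \<in> L2 U" by simp
  have "(\<lambda>n. L2_norm U (\<lambda>x. u n x - V x)) \<longlonglongrightarrow> 0"
  proof (rule LIMSEQ_I)
    fix e :: real assume e: "0 < e"
    obtain N where N: "\<forall>m\<ge>N. \<forall>n\<ge>N. L2_norm U (\<lambda>x. u m x - u n x) < e / 2" using cau[of "e/2"] e by auto
    have "L2_norm U (\<lambda>x. u n x - V x) < e" if n: "n \<ge> N" for n
    proof -
      have "(LINT x:U|lborel. (cmod (u n x - V x))\<^sup>2) = (LINT x|lborel. (cmod (w n x - V x))\<^sup>2)"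
        unfolding set_lebesgue_integral_def wV by (intro Bochner_Integration.integral_cong) (auto simp: indicator_def)
      also have "\<dots> \<le> (e/2)\<^sup>2" using fatou'[OF N n] by simp
      finally have "L2_norm U (\<lambda>x. u n x - V x) \<le> e / 2"
        unfolding L2_norm_def using e by (intro real_le_lsqrt) auto
      then show ?thesis using e by simp
    qed
    moreover have "0 \<le> L2_norm U (\<lambda>x. u n x - V x)" for n by (simp add: L2_norm_def set_integral_nonneg')
    ultimately show "\<exists>no. \<forall>n\<ge>no. norm (L2_norm U (\<lambda>x. u n x - V x) - 0) < e" by auto
  qed
  then show ?thesis using VL2 by blast
qed

section \<open>Smooth functions and test functions\<close>

lemma partial_deriv_eq:
  "(f has_derivative f') (at x) \<Longrightarrow> partial_deriv b f x = f' b"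
  unfolding partial_deriv_def using frechet_derivative_at by metis

lemma Ck_differentiable: "Ck (Suc k) f \<Longrightarrow> f differentiable at x"
  by (auto simp: differentiable_on_def)

lemma Ck_has_derivative: "Ck (Suc k) f \<Longrightarrow> (f has_derivative frechet_derivative f (at x)) (at x)"
  using Ck_differentiable frechet_derivative_works by blast

lemma Ck_SucI:
  assumes "\<And>x. (f has_derivative f' x) (at x)" "\<And>b. b \<in> Basis \<Longrightarrow> Ck k (\<lambda>x. f' x b)"
  shows "Ck (Suc k) f"
proof -
  have "partial_deriv b f = (\<lambda>x. f' x b)" for b using partial_deriv_eq[OF assms(1)] by auto
  moreover have "f differentiable_on UNIV"
    using assms(1) by (auto simp: differentiable_on_def differentiable_def)
  ultimately show ?thesis using assms(2) by simp
qed

lemma Ck_continuous: "Ck k f \<Longrightarrow> continuous_on UNIV f"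
  by (cases k) (auto intro: differentiable_imp_continuous_on)

lemma Ck_Suc_imp: "Ck (Suc k) f \<Longrightarrow> Ck k f"
proof (induction k arbitrary: f)
  case 0 then show ?case by (simp add: differentiable_imp_continuous_on)
next
  case (Suc k)
  then have "f differentiable_on UNIV" "\<And>b. b \<in> Basis \<Longrightarrow> Ck (Suc k) (partial_deriv b f)" by auto
  then show ?case using Suc.IH by auto
qed

lemma Ck_partial: "Ck (Suc k) f \<Longrightarrow> b \<in> Basis \<Longrightarrow> Ck k (partial_deriv b f)"
  by simp

lemma Ck_const: "Ck k (\<lambda>x. c)"
proof (induction k arbitrary: c)
  case (Suc k)
  show ?case by (rule Ck_SucI[where f' = "\<lambda>_ _. 0"]) (auto simp: Suc)
qed auto

lemma Ck_add: "Ck k f \<Longrightarrow> Ck k g \<Longrightarrow> Ck k (\<lambda>x. f x + g x)"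
proof (induction k arbitrary: f g)
  case (Suc k)
  show ?case
  proof (rule Ck_SucI)
    show "((\<lambda>x. f x + g x) has_derivative (\<lambda>h. frechet_derivative f (at x) h + frechet_derivative g (at x) h)) (at x)" for x
      by (intro has_derivative_add Ck_has_derivative) (fact Suc.prems)+
    show "Ck k (\<lambda>x. frechet_derivative f (at x) b + frechet_derivative g (at x) b)" if "b \<in> Basis" for b
      using Suc.IH Suc.prems[THEN Ck_partial, OF that] by (simp add: partial_deriv_def)
  qed
qed (auto intro: continuous_intros)

lemma Ck_mult: "Ck k f \<Longrightarrow> Ck k g \<Longrightarrow> Ck k (\<lambda>x. f x * g x)"
proof (induction k arbitrary: f g)
  case (Suc k)
  show ?case
  proof (rule Ck_SucI)
    show "((\<lambda>x. f x * g x) has_derivative (\<lambda>h. f x * frechet_derivative g (at x) h + frechet_derivative f (at x) h * g x)) (at x)" for x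
      by (intro has_derivative_mult Ck_has_derivative) (fact Suc.prems)+
    show "Ck k (\<lambda>x. f x * frechet_derivative g (at x) b + frechet_derivative f (at x) b * g x)" if b: "b \<in> Basis" for b
      using Suc.prems[THEN Ck_partial, OF b] Suc.prems[THEN Ck_Suc_imp] unfolding partial_deriv_def
      by (intro Ck_add Suc.IH)
  qed
qed (auto intro: continuous_intros)

lemma Ck_scale: "Ck k f \<Longrightarrow> Ck k (\<lambda>x. c * f x)"
  by (rule Ck_mult[OF Ck_const])

lemma Ck_prod: "finite I \<Longrightarrow> (\<And>i. i \<in> I \<Longrightarrow> Ck k (f i)) \<Longrightarrow> Ck k (\<lambda>x. \<Prod>i\<in>I. f i x)"
  by (induction I rule: finite_induct) (auto intro: Ck_mult simp: Ck_const)

lemma partial_deriv_add: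
  assumes "Ck (Suc 0) f" "Ck (Suc 0) g"
  shows "partial_deriv b (\<lambda>x. f x + g x) = (\<lambda>x. partial_deriv b f x + partial_deriv b g x)"
  unfolding partial_deriv_def[of b f] partial_deriv_def[of b g]
  by (rule ext) (rule partial_deriv_eq[OF has_derivative_add[OF assms[THEN Ck_has_derivative]]])

lemma partial_deriv_mult:
  assumes "Ck (Suc 0) f" "Ck (Suc 0) g"
  shows "partial_deriv b (\<lambda>x. f x * g x) = (\<lambda>x. f x * partial_deriv b g x + partial_deriv b f x * g x)"
  unfolding partial_deriv_def[of b f] partial_deriv_def[of b g]
  by (rule ext) (rule partial_deriv_eq[OF has_derivative_mult[OF assms[THEN Ck_has_derivative]]])

lemma partial_deriv_scale:
  assumes "Ck (Suc 0) f"
  shows "partial_deriv b (\<lambda>x. c * f x) = (\<lambda>x. c * partial_deriv b f x)"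
  unfolding partial_deriv_def[of b f]
  by (rule ext) (rule partial_deriv_eq[OF has_derivative_mult_right[OF Ck_has_derivative[OF assms]]])

definition smooth :: "('a::euclidean_space \<Rightarrow> complex) \<Rightarrow> bool" where
  "smooth f \<longleftrightarrow> (\<forall>k. Ck k f)"

lemma smooth_partial: "smooth f \<Longrightarrow> b \<in> Basis \<Longrightarrow> smooth (partial_deriv b f)"
  unfolding smooth_def using Ck_partial by blast

lemma smooth_Ck: "smooth f \<Longrightarrow> Ck k f" by (simp add: smooth_def)

lemma smooth_add: "smooth f \<Longrightarrow> smooth g \<Longrightarrow> smooth (\<lambda>x. f x + g x)"
  by (simp add: smooth_def Ck_add)

lemma smooth_scale: "smooth f \<Longrightarrow> smooth (\<lambda>x. c * f x)"
  by (simp add: smooth_def Ck_scale del: Ck.simps)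

lemma smooth_mult: "smooth f \<Longrightarrow> smooth g \<Longrightarrow> smooth (\<lambda>x. f x * g x)"
  by (simp add: smooth_def Ck_mult)

lemma test_functions_iff:
  "\<phi> \<in> test_functions U \<longleftrightarrow> smooth \<phi> \<and> (\<exists>K. compact K \<and> K \<subseteq> U \<and> (\<forall>x. x \<notin> K \<longrightarrow> \<phi> x = 0))"
proof
  assume "\<phi> \<in> test_functions U"
  then show "smooth \<phi> \<and> (\<exists>K. compact K \<and> K \<subseteq> U \<and> (\<forall>x. x \<notin> K \<longrightarrow> \<phi> x = 0))"
    unfolding test_functions_def smooth_def
    using closure_subset[of "{x. \<phi> x \<noteq> 0}"] by (auto intro!: exI[of _ "closure {x. \<phi> x \<noteq> 0}"])
next
  assume "smooth \<phi> \<and> (\<exists>K. compact K \<and> K \<subseteq> U \<and> (\<forall>x. x \<notin> K \<longrightarrow> \<phi> x = 0))"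
  then obtain K where K: "smooth \<phi>" "compact K" "K \<subseteq> U" "\<forall>x. x \<notin> K \<longrightarrow> \<phi> x = 0" by blast
  then have "closure {x. \<phi> x \<noteq> 0} \<subseteq> K" by (intro closure_minimal) (auto simp: compact_imp_closed)
  moreover from this K have "compact (closure {x. \<phi> x \<noteq> 0})"
    by (meson bounded_subset compact_closure compact_imp_bounded closure_subset order_trans)
  ultimately show "\<phi> \<in> test_functions U" using K by (auto simp: test_functions_def smooth_def)
qed

lemma partial_deriv_zero_outside:
  assumes "closed K" "\<forall>x. x \<notin> K \<longrightarrow> f x = 0" "x \<notin> K" shows "partial_deriv b f x = 0"
proof -
  have "(f has_derivative (\<lambda>_. 0)) (at x)"
  proof (rule has_derivative_transform_within_open[OF has_derivative_const])
    show "open (- K)" using assms(1) by (rule open_Compl)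
  qed (use assms in auto)
  then show ?thesis by (rule partial_deriv_eq)
qed

lemma test_partial:
  assumes "\<phi> \<in> test_functions U" "b \<in> Basis" shows "partial_deriv b \<phi> \<in> test_functions U"
proof -
  obtain K where K: "smooth \<phi>" "compact K" "K \<subseteq> U" "\<forall>x. x \<notin> K \<longrightarrow> \<phi> x = 0"
    using assms(1) unfolding test_functions_iff by blast
  have "\<forall>x. x \<notin> K \<longrightarrow> partial_deriv b \<phi> x = 0"
    using partial_deriv_zero_outside[OF compact_imp_closed[OF K(2)] K(4)] by blast
  then show ?thesis unfolding test_functions_iff using smooth_partial[OF K(1) assms(2)] K(2,3) by blast
qed

lemma test_smooth: "\<phi> \<in> test_functions U \<Longrightarrow> smooth \<phi>" by (simp add: test_functions_iff)

lemma test_zero: "(\<lambda>x. 0) \<in> test_functions U"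
  by (auto simp: test_functions_iff smooth_def Ck_const)

lemma test_add:
  assumes "\<phi> \<in> test_functions U" "\<psi> \<in> test_functions U" shows "(\<lambda>x. \<phi> x + \<psi> x) \<in> test_functions U"
proof -
  obtain K L where "compact K" "K \<subseteq> U" "\<forall>x. x \<notin> K \<longrightarrow> \<phi> x = 0" "compact L" "L \<subseteq> U" "\<forall>x. x \<notin> L \<longrightarrow> \<psi> x = 0"
    using assms unfolding test_functions_iff by blast
  then show ?thesis using assms unfolding test_functions_iff
    by (intro conjI smooth_add exI[of _ "K \<union> L"] compact_Un) auto
qed

lemma test_scale: "\<phi> \<in> test_functions U \<Longrightarrow> (\<lambda>x. c * \<phi> x) \<in> test_functions U"
proof -
  assume \<phi>: "\<phi> \<in> test_functions U"
  then obtain K where K: "smooth \<phi>" "compact K" "K \<subseteq> U" "\<forall>x. x \<notin> K \<longrightarrow> \<phi> x = 0"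
    unfolding test_functions_iff by blast
  then have "\<forall>x. x \<notin> K \<longrightarrow> c * \<phi> x = 0" by simp
  then show ?thesis unfolding test_functions_iff using smooth_scale[OF K(1)] K(2,3) by blast
qed

lemma test_bounded_support:
  assumes "\<phi> \<in> test_functions U"
  obtains R where "R > 0" "\<And>x. \<phi> x \<noteq> 0 \<Longrightarrow> norm x \<le> R"
proof -
  obtain K where K: "compact K" "\<forall>x. x \<notin> K \<longrightarrow> \<phi> x = 0" using assms unfolding test_functions_iff by blast
  then obtain R where "R > 0" "\<forall>x\<in>K. norm x \<le> R" using compact_imp_bounded bounded_pos by metis
  then show thesis using that K(2) by blast
qed

lemma test_bounded:
  assumes "\<phi> \<in> test_functions U"
  obtains M where "M \<ge> 0" "\<And>x. cmod (\<phi> x) \<le> M"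
proof -
  obtain K where K: "compact K" "\<forall>x. x \<notin> K \<longrightarrow> \<phi> x = 0" using assms unfolding test_functions_iff by blast
  have "compact (\<phi> ` K)"
    using K Ck_continuous[OF smooth_Ck[OF test_smooth[OF assms], of 0]]
    by (intro compact_continuous_image) (auto intro: continuous_on_subset)
  then obtain M where "M > 0" "\<forall>y\<in>\<phi> ` K. norm y \<le> M" using compact_imp_bounded bounded_pos by metis
  then have "cmod (\<phi> x) \<le> M" for x using K(2) by (cases "x \<in> K") auto
  with \<open>M > 0\<close> show thesis using that[of M] by auto
qed

lemma test_continuous: "\<phi> \<in> test_functions U \<Longrightarrow> continuous_on UNIV \<phi>"
  using Ck_continuous[OF smooth_Ck[OF test_smooth]] .

lemma compact_support_integrable:
  fixes f :: "'a::euclidean_space \<Rightarrow> 'b::{banach, second_countable_topology}"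
  assumes "continuous_on UNIV f" "compact K" "\<And>x. x \<notin> K \<Longrightarrow> f x = 0"
  shows "integrable lborel f"
proof -
  have "integrable lborel (\<lambda>x. indicator K x *\<^sub>R f x)"
    by (rule borel_integrable_compact) (use assms continuous_on_subset in blast)+
  moreover have "(\<lambda>x. indicator K x *\<^sub>R f x) = f" using assms(3) by (auto simp: indicator_def)
  ultimately show ?thesis by simp
qed

lemma test_integrable: "\<phi> \<in> test_functions U \<Longrightarrow> integrable lborel \<phi>"
  using compact_support_integrable[OF test_continuous] unfolding test_functions_iff by blast

lemma test_indicator: "\<phi> \<in> test_functions U \<Longrightarrow> indicator U x *\<^sub>R \<phi> x = \<phi> x"
  by (auto simp: test_functions_iff indicator_def)

lemma test_L2: assumes t: "\<phi> \<in> test_functions U" shows "\<phi> \<in> L2 U"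
proof -
  obtain K where K: "compact K" "\<forall>x. x \<notin> K \<longrightarrow> \<phi> x = 0" using t unfolding test_functions_iff by blast
  have "integrable lborel (\<lambda>x. (cmod (\<phi> x))\<^sup>2)"
    by (rule compact_support_integrable[OF _ K(1)]) (use K(2) test_continuous[OF t] in \<open>auto intro: continuous_intros\<close>)
  then show ?thesis unfolding L2_iff test_indicator[OF t]
    using borel_measurable_continuous_onI[OF test_continuous[OF t]] by (simp add: measurable_lborel1)
qed

lemma test_set_integral:
  "\<phi> \<in> test_functions U \<Longrightarrow> (LINT x:U|lborel. \<phi> x) = (LINT x|lborel. \<phi> x)"
  by (simp add: set_lebesgue_integral_def test_indicator)

section \<open>Bump functions\<close>

text \<open>With y = 1/x, the derivative of p(y) exp(-y) with respect to x is y^2 (p(y) - p'(y))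
  exp(-y); this is the recursion.\<close>

primrec eflat_poly :: "nat \<Rightarrow> real poly" where
  "eflat_poly 0 = 1"
| "eflat_poly (Suc k) = [:0, 0, 1:] * (eflat_poly k - pderiv (eflat_poly k))"

text \<open>The \<open>k\<close>-th derivative of \<open>exp (-1/x)\<close>, extended by zero to the negative half-line.\<close>

definition eflat :: "nat \<Rightarrow> real \<Rightarrow> real" where
  "eflat k x = (if x > 0 then poly (eflat_poly k) (1 / x) * exp (- 1 / x) else 0)"

text \<open>The power \<open>y ^ k\<close> is carried along for the induction on \<open>p\<close>:
  splitting off the constant coefficient leaves a shorter polynomial times one more power of
  \<open>y\<close>.\<close>

lemma poly_over_exp_tendsto: "((\<lambda>y::real. poly p y * y ^ k / exp y) \<longlongrightarrow> 0) at_top"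
proof (induction p arbitrary: k)
  case (pCons a p)
  have "((\<lambda>y::real. a * (y ^ k / exp y) + poly p y * y ^ Suc k / exp y) \<longlongrightarrow> a * 0 + 0) at_top"
    by (intro tendsto_intros tendsto_power_div_exp_0 pCons.IH)
  then show ?case by (simp add: field_simps)
qed simp

text \<open>This is the difference quotient at 0, where \<open>eflat k\<close> has the value 0. It
  gives derivative 0 there, so the extension by zero is differentiable to every order.\<close>

lemma eflat_tendsto: "((\<lambda>x. eflat k x / x) \<longlongrightarrow> 0) (at 0)"
proof (rule filterlim_split_at_real)
  have "((\<lambda>x. poly (eflat_poly k) (inverse x) * inverse x ^ 1 / exp (inverse x)) \<longlongrightarrow> 0) (at_right (0::real))"
    by (rule filterlim_compose[OF poly_over_exp_tendsto filterlim_inverse_at_top_right])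
  then show "((\<lambda>x. eflat k x / x) \<longlongrightarrow> 0) (at_right 0)"
    by (rule Lim_transform_eventually)
       (auto simp: eventually_at_right_field eflat_def field_simps exp_minus intro!: exI[of _ 1])
  show "((\<lambda>x. eflat k x / x) \<longlongrightarrow> 0) (at_left 0)"
    by (rule Lim_transform_eventually[OF tendsto_const])
       (auto simp: eventually_at_left_field eflat_def intro!: exI[of _ "-1"])
qed

lemma eflat_deriv: "(eflat k has_real_derivative eflat (Suc k) x) (at x)"
proof -
  consider "x > 0" | "x < 0" | "x = 0" by linarith
  then show ?thesis
  proof cases
    case 1
    have "((\<lambda>x. poly (eflat_poly k) (1 / x) * exp (- 1 / x)) has_real_derivative eflat (Suc k) x) (at x)"
      using 1 by (auto intro!: derivative_eq_intros DERIV_chain'[OF _ poly_DERIV] simp: eflat_def field_simps power2_eq_square)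
    then show ?thesis
      by (rule DERIV_cong_ev[THEN iffD1, rotated 3, OF _ refl _ refl])
         (use 1 eventually_nhds_in_open[of "{0<..}" x] in \<open>auto elim!: eventually_mono simp: eflat_def\<close>)
  next
    case 2
    have "((\<lambda>x. 0) has_real_derivative eflat (Suc k) x) (at x)" using 2 by (simp add: eflat_def)
    then show ?thesis
      by (rule DERIV_cong_ev[THEN iffD1, rotated 3, OF _ refl _ refl])
         (use 2 eventually_nhds_in_open[of "{..<0}" x] in \<open>auto elim!: eventually_mono simp: eflat_def\<close>)
  next
    case 3
    have "((\<lambda>y. (eflat k y - eflat k 0) / (y - 0)) \<longlongrightarrow> 0) (at 0)"
      using eflat_tendsto[of k] by (simp add: eflat_def)
    then show ?thesis using 3 by (simp add: has_field_derivative_iff eflat_def)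
  qed
qed

lemma Ck_eflat: "Ck k (\<lambda>x::'a::euclidean_space. of_real (eflat m (c * (x \<bullet> i) + d)))"
proof (induction k arbitrary: m)
  case 0
  have "continuous_on UNIV (eflat m)"
    using eflat_deriv DERIV_isCont by (intro continuous_at_imp_continuous_on) blast
  then have "continuous_on UNIV (\<lambda>x::'a. eflat m (c * (x \<bullet> i) + d))"
    by (rule continuous_on_compose2) (auto intro!: continuous_intros)
  then show ?case by (simp add: continuous_on_of_real)
next
  case (Suc k)
  show ?case
  proof (rule Ck_SucI)
    fix x :: 'a
    have "((\<lambda>x. c * (x \<bullet> i) + d) has_derivative (\<lambda>h. c * (h \<bullet> i))) (at x)"
      by (auto intro!: derivative_eq_intros)
    from has_derivative_compose[OF this eflat_deriv[of m "c * (x \<bullet> i) + d", unfolded has_field_derivative_def]]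
    have "((\<lambda>x. eflat m (c * (x \<bullet> i) + d)) has_derivative (\<lambda>h. (c * (h \<bullet> i)) * eflat (Suc m) (c * (x \<bullet> i) + d))) (at x)"
      by (simp only: mult.commute)
    then show "((\<lambda>x. complex_of_real (eflat m (c * (x \<bullet> i) + d))) has_derivative
        (\<lambda>h. of_real ((c * (h \<bullet> i)) * eflat (Suc m) (c * (x \<bullet> i) + d)))) (at x)"
      by (rule has_derivative_of_real)
  next
    fix b :: 'a
    show "Ck k (\<lambda>x. complex_of_real ((c * (b \<bullet> i)) * eflat (Suc m) (c * (x \<bullet> i) + d)))"
      unfolding of_real_mult by (rule Ck_scale[OF Suc.IH])
  qed
qed

text \<open>Inside the box each coordinate contributes exp(-1/(n (x - a))) exp(-1/(n (b - x))),
  outside the product is 0. The parameter \<open>n\<close> steepens the flanks, so that the limit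
  for large \<open>n\<close> is the indicator of the open box.\<close>

definition bump :: "real \<Rightarrow> 'a::euclidean_space \<Rightarrow> 'a \<Rightarrow> 'a \<Rightarrow> complex" where
  "bump n a b x = (\<Prod>i\<in>Basis. of_real (eflat 0 (n * (x \<bullet> i) + (- n * (a \<bullet> i)))) *
                            of_real (eflat 0 (- n * (x \<bullet> i) + n * (b \<bullet> i))))"

lemma eflat_0: "eflat 0 x = (if x > 0 then exp (- 1 / x) else 0)" by (simp add: eflat_def)

lemma bump_zero: assumes "n > 0" "x \<notin> box a b" shows "bump n a b x = 0"
proof -
  obtain i where i: "i \<in> Basis" "x \<bullet> i \<le> a \<bullet> i \<or> b \<bullet> i \<le> x \<bullet> i" using assms(2) by (auto simp: mem_box not_less)
  then have "n * (x \<bullet> i) \<le> n * (a \<bullet> i) \<or> n * (b \<bullet> i) \<le> n * (x \<bullet> i)" using assms(1) by auto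
  then show ?thesis unfolding bump_def
    using i(1) by (intro prod_zero) (auto simp: eflat_0 intro!: bexI[of _ i])
qed

lemma bump_le_1: "cmod (bump n a b x) \<le> 1"
proof -
  have e: "cmod (of_real (eflat 0 y)) \<le> 1" for y by (simp add: eflat_0)
  have "cmod (bump n a b x) \<le> (\<Prod>i\<in>(Basis::'a set). 1)"
    unfolding bump_def prod_norm[symmetric] norm_mult
    by (intro prod_mono conjI mult_le_one e) simp_all
  then show ?thesis by simp
qed

lemma bump_tendsto: "(\<lambda>n. bump (real (Suc n)) a b x) \<longlonglongrightarrow> indicator (box a b) x"
proof (cases "x \<in> box a b")
  case False
  then show ?thesis by (simp add: bump_zero)
next
  case True
  have e: "(\<lambda>n. complex_of_real (eflat 0 (real (Suc n) * y))) \<longlonglongrightarrow> 1" if "y > 0" for y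
  proof -
    have "(\<lambda>n. - (1 / y) * (1 / real (Suc n))) \<longlonglongrightarrow> - (1 / y) * 0"
      by (intro tendsto_intros LIMSEQ_Suc[OF lim_1_over_n])
    then have "(\<lambda>n. exp (- (1 / y) * (1 / real (Suc n)))) \<longlonglongrightarrow> exp 0" using tendsto_exp by fastforce
    moreover have "exp (- (1 / y) * (1 / real (Suc n))) = eflat 0 (real (Suc n) * y)" for n
    proof -
      have "real (Suc n) * y > 0" using that by simp
      then show ?thesis by (simp add: eflat_0 field_simps del: of_nat_Suc)
    qed
    ultimately have "(\<lambda>n. eflat 0 (real (Suc n) * y)) \<longlonglongrightarrow> 1" by simp
    then show ?thesis using tendsto_of_real by fastforce
  qed
  have "(\<lambda>n. bump (real (Suc n)) a b x) \<longlonglongrightarrow> (\<Prod>i\<in>(Basis::'a set). 1 * 1)"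
    unfolding bump_def
  proof (intro tendsto_prod tendsto_mult)
    fix i :: 'a assume "i \<in> Basis"
    then have "x \<bullet> i - a \<bullet> i > 0" "b \<bullet> i - x \<bullet> i > 0" using True by (auto simp: mem_box)
    from e[OF this(1)] e[OF this(2)]
    show "(\<lambda>n. complex_of_real (eflat 0 (real (Suc n) * (x \<bullet> i) + - real (Suc n) * (a \<bullet> i)))) \<longlonglongrightarrow> 1"
      "(\<lambda>n. complex_of_real (eflat 0 (- real (Suc n) * (x \<bullet> i) + real (Suc n) * (b \<bullet> i)))) \<longlonglongrightarrow> 1"
      by (simp_all add: algebra_simps)
  qed
  then show ?thesis using True by simp
qed

lemma bump_test:
  assumes "n > 0" "closure (box a b) \<subseteq> U" shows "bump n a b \<in> test_functions U"
  unfolding test_functions_iff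
proof (intro conjI exI[of _ "closure (box a b)"] allI impI)
  show "smooth (bump n a b)"
    unfolding smooth_def bump_def[abs_def] by (intro allI Ck_prod Ck_mult Ck_eflat) simp_all
  show "compact (closure (box a b))" by (simp add: compact_closure)
  show "bump n a b x = 0" if "x \<notin> closure (box a b)" for x
    using that closure_subset bump_zero[OF assms(1)] by blast
qed (use assms in auto)

text \<open>Bump functions converge boundedly to the indicators of boxes, and boxes generate the Borel sets.\<close>

lemma test_orthogonal_imp_null:
  fixes U :: "'a::euclidean_space set"
  assumes U: "open U" and g: "g \<in> L2 U"
    and orth: "\<And>\<phi>. \<phi> \<in> test_functions U \<Longrightarrow> (LINT x:U|lborel. g x * \<phi> x) = 0"
  shows "AE x in lborel. x \<in> U \<longrightarrow> g x = 0"
proof -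
  have gU: "(\<lambda>x. indicator U x *\<^sub>R g x) \<in> borel_measurable lborel" using g by (simp add: L2_iff)
  have gi: "set_integrable lborel (cbox a b) g" if "cbox a b \<subseteq> U" for a b
  proof -
    have "g \<in> L2 (cbox a b)"
    proof -
      have "set_borel_measurable lborel (cbox a b) g"
        by (rule set_borel_measurable_subset[of _ U]) (use g that in \<open>auto simp: L2_def\<close>)
      moreover have "set_integrable lborel (cbox a b) (\<lambda>x. (cmod (g x))\<^sup>2)"
        by (rule set_integrable_subset[of _ U]) (use g that in \<open>auto simp: L2_def\<close>)
      ultimately show ?thesis by (simp add: L2_def)
    qed
    then show ?thesis by (intro L2_imp_integrable) (auto simp: emeasure_lborel_cbox_eq)
  qed
  \<comment> \<open>A closed box inside \<open>U\<close> surrounds the given one: \<open>g\<close>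
    is integrable on it, which provides the dominating function, and it keeps the supports of the
    bumps compact in \<open>U\<close>.\<close>
  have box0: "(LINT x:box c d|lborel. g x) = 0" if ab: "cbox a b \<subseteq> U" "box c d \<subseteq> box a b" for a b c d
  proof -
    have cl: "closure (box c d) \<subseteq> cbox a b"
      using ab(2) by (meson box_subset_cbox closed_cbox closure_minimal order_trans)
    have lim: "(\<lambda>n. LINT x|lborel. indicator (cbox a b) x *\<^sub>R g x * bump (real (Suc n)) c d x)
      \<longlonglongrightarrow> (LINT x|lborel. indicator (box c d) x *\<^sub>R g x)"
    proof (rule integral_dominated_convergence)
      let ?G = "\<lambda>x. indicator (cbox a b) x *\<^sub>R g x"
      have Gi: "integrable lborel ?G" using gi[OF ab(1)] by (simp add: set_integrable_def)
      then have [measurable]: "?G \<in> borel_measurable lborel" by simp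
      have e: "indicator (box c d) x *\<^sub>R g x = ?G x * indicator (box c d) x" for x
        using ab(2) box_subset_cbox[of a b] by (auto simp: indicator_def)
      show "(\<lambda>x. indicator (box c d) x *\<^sub>R g x) \<in> borel_measurable lborel" unfolding e by measurable
      have [measurable]: "bump (real (Suc n)) c d \<in> borel_measurable lborel" for n
        using test_continuous[OF bump_test[of "real (Suc n)" c d UNIV]] borel_measurable_continuous_onI
        by (simp add: measurable_lborel1 del: of_nat_Suc)
      show "(\<lambda>x. ?G x * bump (real (Suc n)) c d x) \<in> borel_measurable lborel" for n by measurable
      show "integrable lborel (\<lambda>x. cmod (?G x))" using Gi by (rule integrable_norm)
      show "AE x in lborel. (\<lambda>n. ?G x * bump (real (Suc n)) c d x) \<longlonglongrightarrow> indicator (box c d) x *\<^sub>R g x"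
        unfolding e by (intro AE_I2 tendsto_mult tendsto_const bump_tendsto)
      show "AE x in lborel. cmod (?G x * bump (real (Suc n)) c d x) \<le> cmod (?G x)" for n
        unfolding norm_mult by (intro AE_I2 mult_right_le_one_le bump_le_1 norm_ge_zero)
    qed
    have "(LINT x|lborel. indicator (cbox a b) x *\<^sub>R g x * bump (real (Suc n)) c d x) = 0" for n
    proof -
      have t: "bump (real (Suc n)) c d \<in> test_functions U" using cl ab by (intro bump_test) auto
      have eq: "indicator (cbox a b) x *\<^sub>R g x * bump (real (Suc n)) c d x = indicator U x *\<^sub>R (g x * bump (real (Suc n)) c d x)" for x
      proof (cases "x \<in> box c d")
        case True
        then have "x \<in> cbox a b" using ab(2) box_subset_cbox by blast
        then show ?thesis using ab(1) by (auto simp: indicator_def)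
      next
        case False
        have "bump (real (Suc n)) c d x = 0" by (rule bump_zero[OF _ False]) simp
        then show ?thesis by (simp del: of_nat_Suc)
      qed
      show ?thesis unfolding eq using orth[OF t] by (simp only: set_lebesgue_integral_def)
    qed
    with lim show ?thesis by (simp add: set_lebesgue_integral_def LIMSEQ_const_iff)
  qed
  have boxAE: "AE x in lborel. x \<in> box a b \<longrightarrow> g x = 0" if ab: "cbox a b \<subseteq> U" for a b
  proof -
    let ?G = "\<lambda>x. indicator (box a b) x *\<^sub>R g x"
    have Gi: "integrable lborel ?G"
      using set_integrable_subset[OF gi[OF ab], of "box a b"] box_subset_cbox[of a b] by (simp add: set_integrable_def)
    have SG: "set_integrable lborel A ?G" if "A \<in> sets borel" for A
      unfolding set_integrable_def by (rule integrable_mult_indicator[OF _ Gi]) (use that in simp)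
    have basic: "(LINT x:box c d|lborel. ?G x) = 0" for c d
    proof -
      obtain c' d' where cd: "box c d \<inter> box a b = box c' d'" using box_Int_box by blast
      have "(LINT x:box c d|lborel. ?G x) = (LINT x:box c' d'|lborel. g x)"
        unfolding set_lebesgue_integral_def cd[symmetric]
        by (intro Bochner_Integration.integral_cong) (auto simp: indicator_def)
      also have "\<dots> = 0" by (rule box0[OF ab]) (use cd in auto)
      finally show ?thesis .
    qed
    have all0: "(LINT x|lborel. ?G x) = 0"
      using box0[OF ab subset_refl] by (simp add: set_lebesgue_integral_def)
    \<comment> \<open>Boxes are stable under intersection, so the pi-lambda theorem carries the
      vanishing from boxes to all Borel sets.\<close>
    have null: "(LINT x:A|lborel. ?G x) = 0" if "A \<in> sets borel" for A
    proof -
      let ?S = "range (\<lambda>(a, b). box a b :: 'a set)"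
      have stable: "Int_stable ?S" unfolding Int_stable_def by (auto simp: box_Int_box)
      have sets: "sigma_sets UNIV ?S = sets borel" by (simp add: borel_eq_box)
      have "A \<in> sigma_sets UNIV ?S" using that sets by simp
      from stable _ this show ?thesis
      proof (rule sigma_sets_induct_disjoint)
        show "(LINT x:A|lborel. ?G x) = 0" if "A \<in> ?S" for A using that basic by auto
        show "(LINT x:UNIV - A|lborel. ?G x) = 0" if "A \<in> sigma_sets UNIV ?S" "(LINT x:A|lborel. ?G x) = 0" for A
        proof -
          have A: "A \<in> sets borel" using that(1) sets by simp
          have "(LINT x:UNIV - A|lborel. ?G x) = (LINT x|lborel. ?G x) - (LINT x:A|lborel. ?G x)"
            unfolding set_lebesgue_integral_def
            by (subst Bochner_Integration.integral_diff[symmetric, OF Gi SG[OF A, unfolded set_integrable_def]])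
               (intro Bochner_Integration.integral_cong, auto simp: indicator_def)
          then show ?thesis using all0 that(2) by simp
        qed
        show "(LINT x:(\<Union>i. A i)|lborel. ?G x) = 0"
          if A: "disjoint_family A" "range A \<subseteq> sigma_sets UNIV ?S" "\<And>i. (LINT x:A i|lborel. ?G x) = 0" for A :: "nat \<Rightarrow> 'a set"
        proof -
          have Ai: "A i \<in> sets borel" for i using A(2) sets by auto
          have "(LINT x:(\<Union>i. A i)|lborel. ?G x) = (\<Sum>i. LINT x:A i|lborel. ?G x)"
          proof (rule lebesgue_integral_countable_add)
            show "set_integrable lborel (\<Union>i. A i) ?G" by (rule SG) (use Ai in auto)
            show "A i \<inter> A j = {}" if "i \<noteq> j" for i j using A(1) that by (auto simp: disjoint_family_on_def)
          qed (use Ai in simp)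
          then show ?thesis using A(3) by simp
        qed
      qed (simp_all add: set_lebesgue_integral_def)
    qed
    then have "AE x in lborel. ?G x = 0" by (intro sigma_finite_measure.density_zero[OF sigma_finite_lborel Gi] null) simp
    then show ?thesis by eventually_elim (auto simp: indicator_def)
  qed
  \<comment> \<open>Countably many closed boxes fill \<open>U\<close>. The statement is known on
    their interiors, and their frontiers are null sets.\<close>
  obtain D where D: "countable D" "D \<subseteq> Pow U" "\<And>X. X \<in> D \<Longrightarrow> \<exists>a b. X = cbox a b" "\<Union>D = U"
    using open_countable_Union_open_cbox[OF U] by metis
  have "AE x in lborel. \<forall>X\<in>D. x \<in> interior X \<longrightarrow> g x = 0"
  proof (rule AE_ball_countable'[OF _ D(1)])
    fix X assume X: "X \<in> D"
    then obtain a b where ab: "X = cbox a b" using D by blast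
    then show "AE x in lborel. x \<in> interior X \<longrightarrow> g x = 0"
      using boxAE[of a b] X D(2) by (auto simp: interior_cbox)
  qed
  moreover have "AE x in lborel. \<forall>X\<in>D. x \<notin> frontier X"
  proof (rule AE_ball_countable'[OF _ D(1)])
    fix X assume "X \<in> D"
    then obtain a b where ab: "X = cbox a b" using D by blast
    have "negligible (frontier X)" unfolding ab by (intro negligible_convex_frontier convex_box)
    then have "frontier X \<in> null_sets lebesgue" by (simp add: negligible_iff_null_sets)
    then have "frontier X \<in> null_sets lborel" by (simp add: null_sets_completion_iff)
    then show "AE x in lborel. x \<notin> frontier X" by (rule AE_not_in)
  qed
  ultimately show ?thesis
  proof eventually_elim
    case (elim x)
    show ?case
    proof
      assume "x \<in> U"
      then obtain X where X: "X \<in> D" "x \<in> X" using D by blast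
      then have "x \<in> interior X" using elim(2) closure_subset by (auto simp: frontier_def)
      then show "g x = 0" using elim(1) X by blast
    qed
  qed
qed

section \<open>Integration by parts\<close>

text \<open>The mean value inequality along \<open>b\<close>. It supplies the dominating bound for
  difference quotients, here and when differentiating under the integral in
  \<open>gint\<close>.\<close>

lemma test_increment_bound:
  assumes t: "\<phi> \<in> test_functions U" and b: "b \<in> Basis" and M: "\<And>x. cmod (partial_deriv b \<phi> x) \<le> M"
  shows "cmod (\<phi> (x + s *\<^sub>R b) - \<phi> x) \<le> M * \<bar>s\<bar>"
proof -
  have "norm ((\<lambda>r. \<phi> (x + r *\<^sub>R b)) s - (\<lambda>r. \<phi> (x + r *\<^sub>R b)) 0) \<le> M * norm (s - 0)"
  proof (rule differentiable_bound[of UNIV])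
    fix r :: real
    have "(\<phi> has_derivative frechet_derivative \<phi> (at (x + r *\<^sub>R b))) (at (x + r *\<^sub>R b))"
      by (rule Ck_has_derivative[OF smooth_Ck[OF test_smooth[OF t]]])
    moreover have "((\<lambda>r. x + r *\<^sub>R b) has_derivative (\<lambda>h. h *\<^sub>R b)) (at r)"
      by (auto intro!: derivative_eq_intros)
    ultimately have d: "((\<lambda>r. \<phi> (x + r *\<^sub>R b)) has_derivative (\<lambda>h. frechet_derivative \<phi> (at (x + r *\<^sub>R b)) (h *\<^sub>R b))) (at r)"
      by (rule has_derivative_compose[rotated])
    then show "((\<lambda>r. \<phi> (x + r *\<^sub>R b)) has_derivative (\<lambda>h. frechet_derivative \<phi> (at (x + r *\<^sub>R b)) (h *\<^sub>R b))) (at r)" .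
    have lin: "linear (frechet_derivative \<phi> (at (x + r *\<^sub>R b)))"
      using Ck_differentiable[OF smooth_Ck[OF test_smooth[OF t]]] by (rule linear_frechet_derivative)
    show "onorm (\<lambda>h. frechet_derivative \<phi> (at (x + r *\<^sub>R b)) (h *\<^sub>R b)) \<le> M"
    proof (rule onorm_le)
      fix h :: real
      have "norm (frechet_derivative \<phi> (at (x + r *\<^sub>R b)) (h *\<^sub>R b)) = \<bar>h\<bar> * cmod (partial_deriv b \<phi> (x + r *\<^sub>R b))"
        by (simp add: linear_scale[OF lin] partial_deriv_def)
      also have "\<dots> \<le> \<bar>h\<bar> * M" by (intro mult_left_mono M) simp
      finally show "norm (frechet_derivative \<phi> (at (x + r *\<^sub>R b)) (h *\<^sub>R b)) \<le> M * norm h" by (simp add: mult.commute)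
    qed
  qed auto
  then show ?thesis by simp
qed

lemma has_vector_derivative_quotient:
  fixes f :: "real \<Rightarrow> complex"
  shows "(f has_vector_derivative d) (at x) \<longleftrightarrow> ((\<lambda>s. (f (x + s) - f x) /\<^sub>R s) \<longlongrightarrow> d) (at 0)"
proof -
  have eq: "norm (a - s *\<^sub>R d) / norm s = norm (a /\<^sub>R s - d)" if "s \<noteq> 0" for a :: complex and s :: real
  proof -
    have "a /\<^sub>R s - d = (a - s *\<^sub>R d) /\<^sub>R s" using that by (simp add: scaleR_diff_right)
    then show ?thesis by (simp add: divide_inverse mult.commute)
  qed
  have "(f has_vector_derivative d) (at x) \<longleftrightarrow> ((\<lambda>s. norm (f (x + s) - f x - s *\<^sub>R d) / norm s) \<longlongrightarrow> 0) (at 0)"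
    by (simp add: has_vector_derivative_def has_derivative_at bounded_linear_scaleR_left)
  also have "\<dots> \<longleftrightarrow> ((\<lambda>s. norm ((f (x + s) - f x) /\<^sub>R s - d)) \<longlongrightarrow> 0) (at 0)"
    by (rule tendsto_cong, unfold eventually_at_filter, intro always_eventually allI impI eq)
  also have "\<dots> \<longleftrightarrow> ((\<lambda>s. (f (x + s) - f x) /\<^sub>R s - d) \<longlongrightarrow> 0) (at 0)"
    by (rule tendsto_norm_zero_iff)
  also have "\<dots> \<longleftrightarrow> ((\<lambda>s. (f (x + s) - f x) /\<^sub>R s) \<longlongrightarrow> d) (at 0)"
    by (rule LIM_zero_iff)
  finally show ?thesis .
qed

lemma test_quotient_tendsto:
  assumes t: "\<phi> \<in> test_functions U"
  shows "(\<lambda>n. of_real (real (Suc n)) * (\<phi> (x + (1 / real (Suc n)) *\<^sub>R b) - \<phi> x)) \<longlonglongrightarrow> partial_deriv b \<phi> x"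
proof -
  have "(\<phi> has_derivative frechet_derivative \<phi> (at x)) (at (x + 0 *\<^sub>R b))"
    using Ck_has_derivative[OF smooth_Ck[OF test_smooth[OF t]]] by simp
  moreover have "((\<lambda>r. x + r *\<^sub>R b) has_derivative (\<lambda>h. h *\<^sub>R b)) (at (0::real))"
    by (auto intro!: derivative_eq_intros)
  ultimately have "((\<lambda>r. \<phi> (x + r *\<^sub>R b)) has_derivative (\<lambda>h. frechet_derivative \<phi> (at x) (h *\<^sub>R b))) (at 0)"
    by (rule has_derivative_compose[rotated])
  moreover have "linear (frechet_derivative \<phi> (at x))"
    using Ck_differentiable[OF smooth_Ck[OF test_smooth[OF t]]] by (rule linear_frechet_derivative)
  ultimately have "((\<lambda>r. \<phi> (x + r *\<^sub>R b)) has_vector_derivative partial_deriv b \<phi> x) (at 0)"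
    by (simp add: has_vector_derivative_def linear_scale partial_deriv_def)
  then have "((\<lambda>r. (\<phi> (x + r *\<^sub>R b) - \<phi> x) /\<^sub>R r) \<longlongrightarrow> partial_deriv b \<phi> x) (at 0)"
    unfolding has_vector_derivative_quotient by simp
  moreover have "filterlim (\<lambda>n. 1 / real (Suc n)) (at 0) sequentially"
    unfolding filterlim_at by (intro conjI always_eventually allI LIMSEQ_Suc[OF lim_1_over_n]) simp_all
  ultimately have "(\<lambda>n. (\<phi> (x + (1 / real (Suc n)) *\<^sub>R b) - \<phi> x) /\<^sub>R (1 / real (Suc n))) \<longlonglongrightarrow> partial_deriv b \<phi> x"
    by (rule filterlim_compose)
  moreover have "z /\<^sub>R (1 / real (Suc n)) = of_real (real (Suc n)) * z" for z :: complex and n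
    by (simp only: scaleR_conv_of_real inverse_divide div_by_1)
  ultimately show ?thesis by (simp only:)
qed

text \<open>Translation invariance of Lebesgue measure makes the integral of every difference quotient vanish.\<close>

lemma integral_partial_test:
  assumes t: "\<phi> \<in> test_functions U" and b: "b \<in> Basis"
  shows "(LINT x|lborel. partial_deriv b \<phi> x) = 0"
proof -
  obtain M where M: "M \<ge> 0" "\<And>x. cmod (partial_deriv b \<phi> x) \<le> M" using test_bounded[OF test_partial[OF t b]] by blast
  obtain R where R: "R > 0" "\<And>x. \<phi> x \<noteq> 0 \<Longrightarrow> norm x \<le> R" using test_bounded_support[OF t] by blast
  let ?q = "\<lambda>n x. of_real (real (Suc n)) * (\<phi> (x + (1 / real (Suc n)) *\<^sub>R b) - \<phi> x)"
  have cont[measurable]: "\<phi> \<in> borel_measurable borel" "partial_deriv b \<phi> \<in> borel_measurable borel"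
    by (intro borel_measurable_continuous_onI test_continuous[OF t] test_continuous[OF test_partial[OF t b]])+
  have ti: "integrable lborel (\<lambda>x. \<phi> (x + c))" "(LINT x|lborel. \<phi> (x + c)) = (LINT x|lborel. \<phi> x)" for c
  proof -
    have d: "distr lborel borel ((+) c) = (lborel :: 'a measure)" by (simp add: lborel_distr_plus)
    have "integrable (distr lborel borel ((+) c)) \<phi>" unfolding d by (rule test_integrable[OF t])
    then show "integrable lborel (\<lambda>x. \<phi> (x + c))" by (subst (asm) integrable_distr_eq) (auto simp: add.commute)
    have "(LINT x|lborel. \<phi> x) = (LINT x|distr lborel borel ((+) c). \<phi> x)" by (simp add: d)
    also have "\<dots> = (LINT x|lborel. \<phi> (c + x))" by (rule integral_distr) auto
    finally show "(LINT x|lborel. \<phi> (x + c)) = (LINT x|lborel. \<phi> x)" by (simp add: add.commute)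
  qed
  have q0: "(LINT x|lborel. ?q n x) = 0" for n
    using ti test_integrable[OF t] by (simp add: Bochner_Integration.integral_diff del: of_nat_Suc)
  have "(\<lambda>n. LINT x|lborel. ?q n x) \<longlonglongrightarrow> (LINT x|lborel. partial_deriv b \<phi> x)"
  proof (rule integral_dominated_convergence)
    \<comment> \<open>The translations have length at most 1, so all difference quotients vanish
      outside the ball of radius \<open>R + 1\<close>.\<close>
    show "integrable lborel (\<lambda>x. M * indicator (cball 0 (R + 1)) x)"
      by (intro integrable_mult_right integrable_real_indicator) (simp_all add: emeasure_bounded_finite[OF bounded_cball, unfolded infinity_ennreal_def])
    show "AE x in lborel. (\<lambda>n. ?q n x) \<longlonglongrightarrow> partial_deriv b \<phi> x" by (intro AE_I2 test_quotient_tendsto[OF t])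
    show "AE x in lborel. cmod (?q n x) \<le> M * indicator (cball 0 (R + 1)) x" for n
    proof (rule AE_I2)
      fix x
      have bd: "cmod (?q n x) \<le> M"
      proof -
        have "cmod (?q n x) = real (Suc n) * cmod (\<phi> (x + (1 / real (Suc n)) *\<^sub>R b) - \<phi> x)"
          by (simp add: norm_mult del: of_nat_Suc)
        also have "\<dots> \<le> real (Suc n) * (M * \<bar>1 / real (Suc n)\<bar>)"
          by (intro mult_left_mono test_increment_bound[OF t b M(2)]) simp
        also have "\<dots> = M" by (simp add: field_simps del: of_nat_Suc)
        finally show ?thesis .
      qed
      show "cmod (?q n x) \<le> M * indicator (cball 0 (R + 1)) x"
      proof (cases "x \<in> cball 0 (R + 1)")
        case True then show ?thesis using bd by simp
      next
        case False
        then have n: "norm x > R + 1" by simp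
        have "norm x \<le> norm (x + (1 / real (Suc n)) *\<^sub>R b) + norm ((1 / real (Suc n)) *\<^sub>R b)"
          using norm_triangle_ineq4[of "x + (1 / real (Suc n)) *\<^sub>R b" "(1 / real (Suc n)) *\<^sub>R b"] by (simp del: of_nat_Suc)
        also have "norm ((1 / real (Suc n)) *\<^sub>R b) \<le> 1" using b by (simp add: field_simps)
        finally have "norm (x + (1 / real (Suc n)) *\<^sub>R b) > R" using n by simp
        then have "\<phi> (x + (1 / real (Suc n)) *\<^sub>R b) = 0" using R(2) by force
        moreover have "\<phi> x = 0" using R n by force
        ultimately show ?thesis using False by simp
      qed
    qed
  qed auto
  then show ?thesis unfolding q0 by (simp add: LIMSEQ_const_iff)
qed

lemma test_mult:
  assumes "\<phi> \<in> test_functions U" "smooth \<psi>" shows "(\<lambda>x. \<phi> x * \<psi> x) \<in> test_functions U"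
proof -
  obtain K where K: "smooth \<phi>" "compact K" "K \<subseteq> U" "\<forall>x. x \<notin> K \<longrightarrow> \<phi> x = 0"
    using assms unfolding test_functions_iff by blast
  then have "\<forall>x. x \<notin> K \<longrightarrow> \<phi> x * \<psi> x = 0" by simp
  then show ?thesis unfolding test_functions_iff using smooth_mult[OF K(1) assms(2)] K(2,3) by blast
qed

lemma test_parts:
  assumes t: "\<phi> \<in> test_functions U" and p: "\<psi> \<in> test_functions W" and b: "b \<in> Basis"
  shows "(LINT x|lborel. \<phi> x * partial_deriv b \<psi> x) = - (LINT x|lborel. partial_deriv b \<phi> x * \<psi> x)"
proof -
  note s = test_smooth[OF t] test_smooth[OF p]
  have i: "integrable lborel (\<lambda>x. \<phi> x * partial_deriv b \<psi> x)" "integrable lborel (\<lambda>x. partial_deriv b \<phi> x * \<psi> x)"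
    by (rule test_integrable, rule test_mult, (rule t test_partial[OF t b] s smooth_partial b)+)+
  have "(LINT x|lborel. \<phi> x * partial_deriv b \<psi> x) + (LINT x|lborel. partial_deriv b \<phi> x * \<psi> x) =
    (LINT x|lborel. partial_deriv b (\<lambda>x. \<phi> x * \<psi> x) x)"
    unfolding partial_deriv_mult[OF s[THEN smooth_Ck]] by (rule Bochner_Integration.integral_add[symmetric, OF i])
  also have "\<dots> = 0" by (rule integral_partial_test[OF test_mult[OF t s(2)] b])
  finally show ?thesis by (simp add: eq_neg_iff_add_eq_0)
qed

section \<open>Weak derivatives\<close>

lemma has_weak_deriv_L2: "has_weak_deriv U b f g \<Longrightarrow> f \<in> L2 U" "has_weak_deriv U b f g \<Longrightarrow> g \<in> L2 U"
  by (simp_all add: has_weak_deriv_def)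

lemma has_weak_deriv_test:
  assumes "\<phi> \<in> test_functions U" "b \<in> Basis"
  shows "has_weak_deriv U b \<phi> (partial_deriv b \<phi>)"
  unfolding has_weak_deriv_def
proof (intro conjI ballI test_L2 assms test_partial)
  fix \<psi> assume p: "\<psi> \<in> test_functions U"
  have s: "smooth \<psi>" "smooth (partial_deriv b \<psi>)" using test_smooth[OF p] assms smooth_partial by auto
  show "(LINT x:U|lborel. \<phi> x * partial_deriv b \<psi> x) = - (LINT x:U|lborel. partial_deriv b \<phi> x * \<psi> x)"
    unfolding test_set_integral[OF test_mult[OF assms(1) s(2)]]
      test_set_integral[OF test_mult[OF test_partial[OF assms] s(1)]]
    by (rule test_parts[OF assms(1) p assms(2)])
qed

lemma has_weak_deriv_add:
  assumes "has_weak_deriv U b f g" "has_weak_deriv U b f' g'" "b \<in> Basis"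
  shows "has_weak_deriv U b (\<lambda>x. f x + f' x) (\<lambda>x. g x + g' x)"
  using assms(1,2) unfolding has_weak_deriv_def
proof (elim conjE, intro conjI ballI L2_add)
  fix \<phi> assume p: "\<phi> \<in> test_functions U"
    and L: "f \<in> L2 U" "f' \<in> L2 U" "g \<in> L2 U" "g' \<in> L2 U"
    and e: "\<forall>\<phi>\<in>test_functions U. (LINT x:U|lborel. f x * partial_deriv b \<phi> x) = - (LINT x:U|lborel. g x * \<phi> x)"
      "\<forall>\<phi>\<in>test_functions U. (LINT x:U|lborel. f' x * partial_deriv b \<phi> x) = - (LINT x:U|lborel. g' x * \<phi> x)"
  note I = L2_mult_integrable[OF _ test_L2[OF p]] L2_mult_integrable[OF _ test_L2[OF test_partial[OF p assms(3)]]]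
  show "(LINT x:U|lborel. (f x + f' x) * partial_deriv b \<phi> x) = - (LINT x:U|lborel. (g x + g' x) * \<phi> x)"
    using I L p e by (simp add: distrib_right set_integral_add)
qed

lemma has_weak_deriv_scale:
  assumes "has_weak_deriv U b f g" shows "has_weak_deriv U b (\<lambda>x. c * f x) (\<lambda>x. c * g x)"
  using assms unfolding has_weak_deriv_def by (auto simp: L2_scale mult.assoc)

lemma set_integral_mult_cong:
  assumes "AE x in lborel. x \<in> U \<longrightarrow> f x = f' x" "f \<in> L2 U" "f' \<in> L2 U" "g \<in> L2 U"
  shows "(LINT x:U|lborel. f x * g x) = (LINT x:U|lborel. f' x * g x)"
  using L2_inner_cong[of U f f' "\<lambda>x. cnj (g x)" "\<lambda>x. cnj (g x)"] assms by (simp add: L2_inner_def L2_cnj)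

lemma has_weak_deriv_cong:
  assumes h: "has_weak_deriv U b f g" and "b \<in> Basis" "f' \<in> L2 U" "g' \<in> L2 U"
    "AE x in lborel. x \<in> U \<longrightarrow> f' x = f x" "AE x in lborel. x \<in> U \<longrightarrow> g' x = g x"
  shows "has_weak_deriv U b f' g'"
  unfolding has_weak_deriv_def
proof (intro conjI ballI assms)
  fix \<phi> assume p: "\<phi> \<in> test_functions U"
  have "(LINT x:U|lborel. f' x * partial_deriv b \<phi> x) = (LINT x:U|lborel. f x * partial_deriv b \<phi> x)"
    by (rule set_integral_mult_cong) (use assms test_L2[OF test_partial[OF p]] has_weak_deriv_L2[OF h] in auto)
  also have "\<dots> = - (LINT x:U|lborel. g x * \<phi> x)" using h p by (simp add: has_weak_deriv_def)
  also have "(LINT x:U|lborel. g x * \<phi> x) = (LINT x:U|lborel. g' x * \<phi> x)"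
    by (rule set_integral_mult_cong[symmetric]) (use assms test_L2[OF p] has_weak_deriv_L2[OF h] in auto)
  finally show "(LINT x:U|lborel. f' x * partial_deriv b \<phi> x) = - (LINT x:U|lborel. g' x * \<phi> x)" .
qed

lemma has_weak_deriv_unique:
  assumes U: "open U" and h: "has_weak_deriv U b f g" "has_weak_deriv U b f g'"
  shows "AE x in lborel. x \<in> U \<longrightarrow> g x = g' x"
proof -
  note L = has_weak_deriv_L2(2)[OF h(1)] has_weak_deriv_L2(2)[OF h(2)]
  have "AE x in lborel. x \<in> U \<longrightarrow> g x - g' x = 0"
  proof (rule test_orthogonal_imp_null[OF U L2.diff_mem[OF L]])
    fix \<phi> assume p: "\<phi> \<in> test_functions U"
    note I = L2_mult_integrable[OF _ test_L2[OF p]]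
    have "(LINT x:U|lborel. (g x - g' x) * \<phi> x) = (LINT x:U|lborel. g x * \<phi> x) - (LINT x:U|lborel. g' x * \<phi> x)"
      by (simp add: left_diff_distrib set_integral_diff I L)
    also have "(LINT x:U|lborel. g x * \<phi> x) = - (LINT x:U|lborel. f x * partial_deriv b \<phi> x)"
      using h(1) p unfolding has_weak_deriv_def by simp
    also have "(LINT x:U|lborel. g' x * \<phi> x) = - (LINT x:U|lborel. f x * partial_deriv b \<phi> x)"
      using h(2) p unfolding has_weak_deriv_def by simp
    finally show "(LINT x:U|lborel. (g x - g' x) * \<phi> x) = 0" by simp
  qed
  then show ?thesis by eventually_elim auto
qed

lemma weak_deriv_works: "has_weak_deriv U b f g \<Longrightarrow> has_weak_deriv U b f (weak_deriv U b f)"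
  unfolding weak_deriv_def by (rule someI[of "has_weak_deriv U b f"])

lemma weak_deriv_AE:
  "open U \<Longrightarrow> has_weak_deriv U b f g \<Longrightarrow> AE x in lborel. x \<in> U \<longrightarrow> weak_deriv U b f x = g x"
  using has_weak_deriv_unique weak_deriv_works by blast

lemma W12_D:
  assumes "f \<in> W12 U" "b \<in> Basis" shows "has_weak_deriv U b f (weak_deriv U b f)"
proof -
  obtain g where "has_weak_deriv U b f g" using assms unfolding W12_def by blast
  then show ?thesis by (rule weak_deriv_works)
qed

lemma W22_D:
  assumes "f \<in> W22 U"
  shows "f \<in> L2 U" "b \<in> Basis \<Longrightarrow> has_weak_deriv U b f (weak_deriv U b f)"
    "b \<in> Basis \<Longrightarrow> c \<in> Basis \<Longrightarrow> has_weak_deriv U c (weak_deriv U b f) (weak_deriv U c (weak_deriv U b f))"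
proof -
  have W: "f \<in> W12 U" "b \<in> Basis \<Longrightarrow> weak_deriv U b f \<in> W12 U" for b using assms by (auto simp: W22_def)
  then show "f \<in> L2 U" by (auto simp: W12_def)
  show "b \<in> Basis \<Longrightarrow> has_weak_deriv U b f (weak_deriv U b f)" by (rule W12_D[OF W(1)])
  show "b \<in> Basis \<Longrightarrow> c \<in> Basis \<Longrightarrow> has_weak_deriv U c (weak_deriv U b f) (weak_deriv U c (weak_deriv U b f))"
    by (rule W12_D[OF W(2)])
qed

text \<open>\<open>W22\<close> refers to derivatives of the representative picked by
  \<open>weak_deriv\<close>. The second derivatives known for \<open>g b\<close> therefore have to
  be transferred to that representative, which agrees with \<open>g b\<close> only almost
  everywhere.\<close>

lemma W22_I:
  assumes U: "open U" and f: "f \<in> L2 U"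
    and 1: "\<And>b. b \<in> Basis \<Longrightarrow> has_weak_deriv U b f (g b)"
    and 2: "\<And>b c. b \<in> Basis \<Longrightarrow> c \<in> Basis \<Longrightarrow> has_weak_deriv U c (g b) (k c b)"
  shows "f \<in> W22 U"
    and "b \<in> Basis \<Longrightarrow> AE x in lborel. x \<in> U \<longrightarrow> weak_deriv U b f x = g b x"
    and "b \<in> Basis \<Longrightarrow> c \<in> Basis \<Longrightarrow> AE x in lborel. x \<in> U \<longrightarrow> weak_deriv U c (weak_deriv U b f) x = k c b x"
proof -
  have A: "AE x in lborel. x \<in> U \<longrightarrow> weak_deriv U b f x = g b x" if "b \<in> Basis" for b
    by (rule weak_deriv_AE[OF U 1[OF that]])
  have B: "has_weak_deriv U c (weak_deriv U b f) (k c b)" if bc: "b \<in> Basis" "c \<in> Basis" for b c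
    by (rule has_weak_deriv_cong[OF 2[OF bc] bc(2) _ _ A[OF bc(1)]])
       (use has_weak_deriv_L2 weak_deriv_works[OF 1[OF bc(1)]] 2[OF bc] in auto)
  show "b \<in> Basis \<Longrightarrow> AE x in lborel. x \<in> U \<longrightarrow> weak_deriv U b f x = g b x" by (rule A)
  show "b \<in> Basis \<Longrightarrow> c \<in> Basis \<Longrightarrow> AE x in lborel. x \<in> U \<longrightarrow> weak_deriv U c (weak_deriv U b f) x = k c b x"
    by (rule weak_deriv_AE[OF U B])
  have "weak_deriv U b f \<in> L2 U" if "b \<in> Basis" for b
    using has_weak_deriv_L2(2)[OF weak_deriv_works[OF 1[OF that]]] .
  then show "f \<in> W22 U" using f 1 B unfolding W22_def W12_def by blast
qed

lemma W22_test:
  assumes "open U" "\<phi> \<in> test_functions U"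
  shows "\<phi> \<in> W22 U"
    and "b \<in> Basis \<Longrightarrow> AE x in lborel. x \<in> U \<longrightarrow> weak_deriv U b \<phi> x = partial_deriv b \<phi> x"
    and "b \<in> Basis \<Longrightarrow> c \<in> Basis \<Longrightarrow>
      AE x in lborel. x \<in> U \<longrightarrow> weak_deriv U c (weak_deriv U b \<phi>) x = partial_deriv c (partial_deriv b \<phi>) x"
proof -
  note I = W22_I[OF assms(1) test_L2[OF assms(2)] has_weak_deriv_test[OF assms(2)]
      has_weak_deriv_test[OF test_partial[OF assms(2)]]]
  show "\<phi> \<in> W22 U" by (rule I(1))
  show "b \<in> Basis \<Longrightarrow> AE x in lborel. x \<in> U \<longrightarrow> weak_deriv U b \<phi> x = partial_deriv b \<phi> x" by (rule I(2))
  show "b \<in> Basis \<Longrightarrow> c \<in> Basis \<Longrightarrow>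
      AE x in lborel. x \<in> U \<longrightarrow> weak_deriv U c (weak_deriv U b \<phi>) x = partial_deriv c (partial_deriv b \<phi>) x"
    by (rule I(3))
qed

lemma W22_add:
  assumes U: "open U" and f: "f \<in> W22 U" and g: "g \<in> W22 U"
  shows "(\<lambda>x. f x + g x) \<in> W22 U"
    and "b \<in> Basis \<Longrightarrow> AE x in lborel. x \<in> U \<longrightarrow> weak_deriv U b (\<lambda>x. f x + g x) x = weak_deriv U b f x + weak_deriv U b g x"
    and "b \<in> Basis \<Longrightarrow> c \<in> Basis \<Longrightarrow> AE x in lborel. x \<in> U \<longrightarrow>
      weak_deriv U c (weak_deriv U b (\<lambda>x. f x + g x)) x = weak_deriv U c (weak_deriv U b f) x + weak_deriv U c (weak_deriv U b g) x"
proof -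
  note I = W22_I[OF U L2_add[OF W22_D(1)[OF f] W22_D(1)[OF g]]
      has_weak_deriv_add[OF W22_D(2)[OF f] W22_D(2)[OF g]] has_weak_deriv_add[OF W22_D(3)[OF f] W22_D(3)[OF g]]]
  show "(\<lambda>x. f x + g x) \<in> W22 U" by (rule I(1))
  show "b \<in> Basis \<Longrightarrow> AE x in lborel. x \<in> U \<longrightarrow> weak_deriv U b (\<lambda>x. f x + g x) x = weak_deriv U b f x + weak_deriv U b g x"
    by (rule I(2))
  show "b \<in> Basis \<Longrightarrow> c \<in> Basis \<Longrightarrow> AE x in lborel. x \<in> U \<longrightarrow>
      weak_deriv U c (weak_deriv U b (\<lambda>x. f x + g x)) x = weak_deriv U c (weak_deriv U b f) x + weak_deriv U c (weak_deriv U b g) x"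
    by (rule I(3))
qed

lemma W22_scale:
  assumes U: "open U" and f: "f \<in> W22 U"
  shows "(\<lambda>x. a * f x) \<in> W22 U"
    and "b \<in> Basis \<Longrightarrow> AE x in lborel. x \<in> U \<longrightarrow> weak_deriv U b (\<lambda>x. a * f x) x = a * weak_deriv U b f x"
    and "b \<in> Basis \<Longrightarrow> c \<in> Basis \<Longrightarrow> AE x in lborel. x \<in> U \<longrightarrow>
      weak_deriv U c (weak_deriv U b (\<lambda>x. a * f x)) x = a * weak_deriv U c (weak_deriv U b f) x"
proof -
  note I = W22_I[OF U L2_scale[OF W22_D(1)[OF f]] has_weak_deriv_scale[OF W22_D(2)[OF f]] has_weak_deriv_scale[OF W22_D(3)[OF f]]]
  show "(\<lambda>x. a * f x) \<in> W22 U" by (rule I(1))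
  show "b \<in> Basis \<Longrightarrow> AE x in lborel. x \<in> U \<longrightarrow> weak_deriv U b (\<lambda>x. a * f x) x = a * weak_deriv U b f x" by (rule I(2))
  show "b \<in> Basis \<Longrightarrow> c \<in> Basis \<Longrightarrow> AE x in lborel. x \<in> U \<longrightarrow>
      weak_deriv U c (weak_deriv U b (\<lambda>x. a * f x)) x = a * weak_deriv U c (weak_deriv U b f) x" by (rule I(3))
qed

section \<open>Sesquilinear forms on Sobolev spaces\<close>

text \<open>Because \<open>weak_deriv\<close> picks a representative, derivative maps are linear
  only almost everywhere; the inner product does not see the difference.\<close>

lemma semi_inner_pullback:
  assumes zero: "(\<lambda>x. 0) \<in> V"
    and add: "\<And>u v. u \<in> V \<Longrightarrow> v \<in> V \<Longrightarrow> (\<lambda>x. u x + v x) \<in> V"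
    and scale: "\<And>u c. u \<in> V \<Longrightarrow> (\<lambda>x. c * u x) \<in> V"
    and T: "\<And>u. u \<in> V \<Longrightarrow> T u \<in> L2 U"
    and Tadd: "\<And>u v. u \<in> V \<Longrightarrow> v \<in> V \<Longrightarrow> AE x in lborel. x \<in> U \<longrightarrow> T (\<lambda>x. u x + v x) x = T u x + T v x"
    and Tscale: "\<And>u c. u \<in> V \<Longrightarrow> AE x in lborel. x \<in> U \<longrightarrow> T (\<lambda>x. c * u x) x = c * T u x"
  shows "semi_inner V (\<lambda>u v. L2_inner U (T u) (T v))"
proof
  fix u v w assume u: "u \<in> V" and v: "v \<in> V" and w: "w \<in> V"
  have "L2_inner U (T (\<lambda>x. u x + v x)) (T w) = L2_inner U (\<lambda>x. T u x + T v x) (T w)"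
    by (rule L2_inner_cong[OF Tadd[OF u v] _ T[OF add[OF u v]] L2_add[OF T[OF u] T[OF v]] T[OF w] T[OF w]]) simp
  then show "L2_inner U (T (\<lambda>x. u x + v x)) (T w) = L2_inner U (T u) (T w) + L2_inner U (T v) (T w)"
    using T u v w by (simp add: L2.add_left)
next
  fix u w c assume u: "u \<in> V" and w: "w \<in> V"
  have "L2_inner U (T (\<lambda>x. c * u x)) (T w) = L2_inner U (\<lambda>x. c * T u x) (T w)"
    by (rule L2_inner_cong[OF Tscale[OF u] _ T[OF scale[OF u]] L2_scale[OF T[OF u]] T[OF w] T[OF w]]) simp
  then show "L2_inner U (T (\<lambda>x. c * u x)) (T w) = c * L2_inner U (T u) (T w)"
    using T u w by (simp add: L2.scale_left)
  show "L2_inner U (T w) (T u) = cnj (L2_inner U (T u) (T w))" by (rule L2.herm[OF T[OF u] T[OF w]])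
next
  fix u assume "u \<in> V"
  then show "0 \<le> Re (L2_inner U (T u) (T u))" by (intro L2.nonneg T)
qed (use zero add scale in auto)

lemma semi_inner_plus:
  assumes "semi_inner V s" "semi_inner V t" shows "semi_inner V (\<lambda>u v. s u v + t u v)"
proof -
  interpret s: semi_inner V s by fact
  interpret t: semi_inner V t by fact
  show ?thesis
  proof
    fix u v assume "u \<in> V" "v \<in> V"
    then show "s v u + t v u = cnj (s u v + t u v)" using s.herm[of u v] t.herm[of u v] by simp
  qed (auto simp: s.zero_mem s.add_mem s.scale_mem s.add_left t.add_left s.scale_left t.scale_left
      s.nonneg t.nonneg distrib_left)
qed

lemma semi_inner_scaled:
  assumes "semi_inner V s" "0 \<le> a" shows "semi_inner V (\<lambda>u v. of_real a * s u v)"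
proof -
  interpret s: semi_inner V s by fact
  show ?thesis
  proof
    fix u v assume "u \<in> V" "v \<in> V"
    then show "of_real a * s v u = cnj (of_real a * s u v)" using s.herm[of u v] by simp
  qed (auto simp: s.zero_mem s.add_mem s.scale_mem s.add_left s.scale_left s.nonneg distrib_left assms)
qed

lemma semi_inner_sum:
  assumes "finite I" "I \<noteq> {}" "\<And>i. i \<in> I \<Longrightarrow> semi_inner V (s i)"
  shows "semi_inner V (\<lambda>u v. \<Sum>i\<in>I. s i u v)"
  using assms by (induction I rule: finite_ne_induct) (auto intro: semi_inner_plus)

lemma semi_inner_subspace:
  assumes "semi_inner V s" "W \<subseteq> V" "(\<lambda>x. 0) \<in> W"
    "\<And>u v. u \<in> W \<Longrightarrow> v \<in> W \<Longrightarrow> (\<lambda>x. u x + v x) \<in> W" "\<And>u c. u \<in> W \<Longrightarrow> (\<lambda>x. c * u x) \<in> W"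
  shows "semi_inner W s"
proof -
  interpret s: semi_inner V s by fact
  have V: "u \<in> V" if "u \<in> W" for u using assms(2) that by blast
  show ?thesis
  proof
    show "s v u = cnj (s u v)" if "u \<in> W" "v \<in> W" for u v by (rule s.herm[OF that[THEN V]])
  qed (simp_all add: assms(3-5) V s.add_left s.scale_left s.nonneg)
qed

text \<open>The inner product behind \<open>W22_norm\<close>; through it the Sobolev norm inherits
  the triangle inequality from \<open>semi_inner\<close>.\<close>

definition W22_inner :: "'a::euclidean_space set \<Rightarrow> ('a \<Rightarrow> complex) \<Rightarrow> ('a \<Rightarrow> complex) \<Rightarrow> complex" where
  "W22_inner U f g = L2_inner U f g
     + (\<Sum>b\<in>Basis. L2_inner U (weak_deriv U b f) (weak_deriv U b g))
     + (\<Sum>b\<in>Basis. \<Sum>c\<in>Basis. L2_inner U (weak_deriv U c (weak_deriv U b f)) (weak_deriv U c (weak_deriv U b g)))"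

lemma W22_D_L2:
  assumes "f \<in> W22 U" "b \<in> Basis"
  shows "weak_deriv U b f \<in> L2 U" "c \<in> Basis \<Longrightarrow> weak_deriv U c (weak_deriv U b f) \<in> L2 U"
  using W22_D(2)[OF assms] W22_D(3)[OF assms] has_weak_deriv_L2 by blast+

lemma W22_zero: "open U \<Longrightarrow> (\<lambda>x. 0) \<in> W22 U" by (rule W22_test[OF _ test_zero])

lemma semi_inner_W22_parts:
  assumes U: "open U"
  shows "semi_inner (W22 U) (L2_inner U)"
    and "b \<in> Basis \<Longrightarrow> semi_inner (W22 U) (\<lambda>f g. L2_inner U (weak_deriv U b f) (weak_deriv U b g))"
    and "b \<in> Basis \<Longrightarrow> c \<in> Basis \<Longrightarrow>
      semi_inner (W22 U) (\<lambda>f g. L2_inner U (weak_deriv U c (weak_deriv U b f)) (weak_deriv U c (weak_deriv U b g)))"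
proof -
  show "semi_inner (W22 U) (L2_inner U)"
  proof (rule semi_inner_subspace[OF L2.semi_inner_axioms _ W22_zero[OF U]])
    show "W22 U \<subseteq> L2 U" using W22_D(1) by blast
  qed (fact W22_add(1)[OF U] W22_scale(1)[OF U])+
  show "semi_inner (W22 U) (\<lambda>f g. L2_inner U (weak_deriv U b f) (weak_deriv U b g))" if b: "b \<in> Basis"
  proof (rule semi_inner_pullback[where T = "weak_deriv U b", OF W22_zero[OF U] W22_add(1)[OF U] W22_scale(1)[OF U]])
    fix u v and a :: complex assume u: "u \<in> W22 U"
    show "weak_deriv U b u \<in> L2 U" by (rule W22_D_L2(1)[OF u b])
    show "AE x in lborel. x \<in> U \<longrightarrow> weak_deriv U b (\<lambda>x. a * u x) x = a * weak_deriv U b u x"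
      by (rule W22_scale(2)[OF U u b])
    assume v: "v \<in> W22 U"
    show "AE x in lborel. x \<in> U \<longrightarrow> weak_deriv U b (\<lambda>x. u x + v x) x = weak_deriv U b u x + weak_deriv U b v x"
      by (rule W22_add(2)[OF U u v b])
  qed
  show "semi_inner (W22 U) (\<lambda>f g. L2_inner U (weak_deriv U c (weak_deriv U b f)) (weak_deriv U c (weak_deriv U b g)))"
    if b: "b \<in> Basis" and c: "c \<in> Basis"
  proof (rule semi_inner_pullback[where T = "\<lambda>f. weak_deriv U c (weak_deriv U b f)",
        OF W22_zero[OF U] W22_add(1)[OF U] W22_scale(1)[OF U]])
    fix u v and a :: complex assume u: "u \<in> W22 U"
    show "weak_deriv U c (weak_deriv U b u) \<in> L2 U" by (rule W22_D_L2(2)[OF u b c])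
    show "AE x in lborel. x \<in> U \<longrightarrow> weak_deriv U c (weak_deriv U b (\<lambda>x. a * u x)) x = a * weak_deriv U c (weak_deriv U b u) x"
      by (rule W22_scale(3)[OF U u b c])
    assume v: "v \<in> W22 U"
    show "AE x in lborel. x \<in> U \<longrightarrow> weak_deriv U c (weak_deriv U b (\<lambda>x. u x + v x)) x =
        weak_deriv U c (weak_deriv U b u) x + weak_deriv U c (weak_deriv U b v) x"
      by (rule W22_add(3)[OF U u v b c])
  qed
qed

lemma semi_inner_W22: "open U \<Longrightarrow> semi_inner (W22 U) (W22_inner U)"
  unfolding W22_inner_def by (intro semi_inner_plus semi_inner_sum semi_inner_W22_parts) auto

lemma L2_norm_sq: "(L2_norm U f)\<^sup>2 = Re (L2_inner U f f)"
  by (simp add: L2_norm_def L2_inner_self set_integral_nonneg')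

lemma W22_norm_sq: "(W22_norm U f)\<^sup>2 = Re (W22_inner U f f)"
proof -
  have "0 \<le> (L2_norm U f)\<^sup>2 + (\<Sum>b\<in>Basis. (L2_norm U (weak_deriv U b f))\<^sup>2)
     + (\<Sum>b\<in>Basis. \<Sum>c\<in>Basis. (L2_norm U (weak_deriv U c (weak_deriv U b f)))\<^sup>2)"
    by (intro add_nonneg_nonneg sum_nonneg) auto
  then show ?thesis by (simp add: W22_norm_def W22_inner_def L2_norm_sq)
qed

lemma W22_norm_eq: "W22_norm U f = sqrt (Re (W22_inner U f f))"
  unfolding W22_norm_sq[symmetric]
  by (simp add: W22_norm_def add_nonneg_nonneg sum_nonneg)

lemma W22_0_sub: "f \<in> W22_0 U \<Longrightarrow> f \<in> W22 U" by (simp add: W22_0_def)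

lemma W22_0_approx:
  "f \<in> W22_0 U \<Longrightarrow> \<epsilon> > 0 \<Longrightarrow> \<exists>\<phi>\<in>test_functions U. W22_norm U (\<lambda>x. f x - \<phi> x) < \<epsilon>"
  by (simp add: W22_0_def)

lemma W22_0_limit:
  assumes U: "open U" and f: "f \<in> W22 U"
    and ap: "\<And>\<epsilon>. \<epsilon> > 0 \<Longrightarrow> \<exists>g\<in>W22_0 U. W22_norm U (\<lambda>x. f x - g x) < \<epsilon>"
  shows "f \<in> W22_0 U"
proof -
  interpret W: semi_inner "W22 U" "W22_inner U" by (rule semi_inner_W22[OF U])
  have N: "W22_norm U = W.nrm" by (simp add: fun_eq_iff W22_norm_eq W.nrm_def)
  have "\<exists>\<phi>\<in>test_functions U. W22_norm U (\<lambda>x. f x - \<phi> x) < \<epsilon>" if e: "\<epsilon> > 0" for \<epsilon>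
  proof -
    obtain g where g: "g \<in> W22_0 U" "W22_norm U (\<lambda>x. f x - g x) < \<epsilon> / 2" using ap[of "\<epsilon> / 2"] e by auto
    obtain \<phi> where p: "\<phi> \<in> test_functions U" "W22_norm U (\<lambda>x. g x - \<phi> x) < \<epsilon> / 2"
      using W22_0_approx[OF g(1), of "\<epsilon> / 2"] e by auto
    have "W22_norm U (\<lambda>x. f x - \<phi> x) \<le> W22_norm U (\<lambda>x. f x - g x) + W22_norm U (\<lambda>x. g x - \<phi> x)"
      unfolding N by (rule W.nrm_diff_le[OF f W22_0_sub[OF g(1)] W22_test(1)[OF U p(1)]])
    also have "\<dots> < \<epsilon>" using g(2) p(2) by simp
    finally show ?thesis by (rule bexI[OF _ p(1)])
  qed
  then show ?thesis using f by (simp add: W22_0_def)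
qed

lemma W22_0_test: assumes "open U" "\<phi> \<in> test_functions U" shows "\<phi> \<in> W22_0 U"
proof -
  interpret W: semi_inner "W22 U" "W22_inner U" by (rule semi_inner_W22[OF assms(1)])
  have "W22_norm U (\<lambda>x. 0) = 0" using W.zero_left[OF W.zero_mem] by (simp add: W22_norm_eq)
  then have "\<forall>\<epsilon>>0. \<exists>\<psi>\<in>test_functions U. W22_norm U (\<lambda>x. \<phi> x - \<psi> x) < \<epsilon>"
    by (intro allI impI bexI[OF _ assms(2)]) simp
  then show ?thesis using W22_test(1)[OF assms] by (simp add: W22_0_def)
qed

lemma W22_0_add:
  assumes U: "open U" and f: "f \<in> W22_0 U" and g: "g \<in> W22_0 U" shows "(\<lambda>x. f x + g x) \<in> W22_0 U"
proof -
  interpret W: semi_inner "W22 U" "W22_inner U" by (rule semi_inner_W22[OF U])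
  have N: "W22_norm U = W.nrm" by (simp add: fun_eq_iff W22_norm_eq W.nrm_def)
  note fg = W22_0_sub[OF f] W22_0_sub[OF g]
  have "\<exists>\<phi>\<in>test_functions U. W22_norm U (\<lambda>x. f x + g x - \<phi> x) < \<epsilon>" if e: "\<epsilon> > 0" for \<epsilon>
  proof -
    obtain \<phi> where p: "\<phi> \<in> test_functions U" "W22_norm U (\<lambda>x. f x - \<phi> x) < \<epsilon> / 2"
      using W22_0_approx[OF f, of "\<epsilon> / 2"] e by auto
    obtain \<psi> where q: "\<psi> \<in> test_functions U" "W22_norm U (\<lambda>x. g x - \<psi> x) < \<epsilon> / 2"
      using W22_0_approx[OF g, of "\<epsilon> / 2"] e by auto
    note d = W.diff_mem[OF fg(1) W22_test(1)[OF U p(1)]] W.diff_mem[OF fg(2) W22_test(1)[OF U q(1)]]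
    have "W22_norm U (\<lambda>x. (f x - \<phi> x) + (g x - \<psi> x)) \<le> W22_norm U (\<lambda>x. f x - \<phi> x) + W22_norm U (\<lambda>x. g x - \<psi> x)"
      unfolding N by (rule W.nrm_triangle[OF d])
    also have "\<dots> < \<epsilon>" using p(2) q(2) by simp
    also have "(\<lambda>x. (f x - \<phi> x) + (g x - \<psi> x)) = (\<lambda>x. f x + g x - (\<phi> x + \<psi> x))" by auto
    finally show ?thesis by (rule bexI[OF _ test_add[OF p(1) q(1)]])
  qed
  then show ?thesis using W.add_mem[OF fg] by (simp add: W22_0_def)
qed

lemma W22_0_scale:
  assumes U: "open U" and f: "f \<in> W22_0 U" shows "(\<lambda>x. c * f x) \<in> W22_0 U"
proof -
  interpret W: semi_inner "W22 U" "W22_inner U" by (rule semi_inner_W22[OF U])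
  have N: "W22_norm U = W.nrm" by (simp add: fun_eq_iff W22_norm_eq W.nrm_def)
  note fW = W22_0_sub[OF f]
  have c1: "cmod c + 1 > 0" by (simp add: add_nonneg_pos)
  have "\<exists>\<phi>\<in>test_functions U. W22_norm U (\<lambda>x. c * f x - \<phi> x) < \<epsilon>" if e: "\<epsilon> > 0" for \<epsilon>
  proof -
    obtain \<phi> where p: "\<phi> \<in> test_functions U" "W22_norm U (\<lambda>x. f x - \<phi> x) < \<epsilon> / (cmod c + 1)"
      using W22_0_approx[OF f divide_pos_pos[OF e c1]] by blast
    have d: "(\<lambda>x. f x - \<phi> x) \<in> W22 U" by (rule W.diff_mem[OF fW W22_test(1)[OF U p(1)]])
    have "W22_norm U (\<lambda>x. c * f x - c * \<phi> x) = cmod c * W22_norm U (\<lambda>x. f x - \<phi> x)"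
      unfolding N right_diff_distrib[symmetric] by (rule W.nrm_scale[OF d])
    also have "\<dots> \<le> cmod c * (\<epsilon> / (cmod c + 1))" by (rule mult_left_mono[OF less_imp_le[OF p(2)] norm_ge_zero])
    also have "\<dots> < \<epsilon>" using c1 e by (simp add: pos_divide_less_eq distrib_left mult.commute)
    finally show ?thesis by (rule bexI[OF _ test_scale[OF p(1)]])
  qed
  then show ?thesis using W.scale_mem[OF fW] by (simp add: W22_0_def)
qed

lemma semi_inner_W22_0:
  assumes U: "open U" and s: "semi_inner (W22 U) s" shows "semi_inner (W22_0 U) s"
proof (rule semi_inner_subspace[OF s])
  show "W22_0 U \<subseteq> W22 U" using W22_0_sub by blast
qed (erule W22_0_add[OF U] W22_0_scale[OF U] | rule W22_0_test[OF U test_zero] | assumption)+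

section \<open>The one-dimensional operator\<close>

lemma has_vector_derivative_partial:
  fixes f :: "real \<Rightarrow> complex"
  assumes "smooth f" shows "(f has_vector_derivative partial_deriv 1 f x) (at x)"
proof -
  have d: "(f has_derivative frechet_derivative f (at x)) (at x)" by (rule Ck_has_derivative[OF smooth_Ck[OF assms]])
  then have "linear (frechet_derivative f (at x))" by (rule has_derivative_linear)
  then have "frechet_derivative f (at x) h = h *\<^sub>R partial_deriv 1 f x" for h
    using linear_scale[of "frechet_derivative f (at x)" h 1] by (simp add: partial_deriv_def)
  then have "frechet_derivative f (at x) = (\<lambda>h. h *\<^sub>R partial_deriv 1 f x)" by auto
  with d show ?thesis by (simp add: has_vector_derivative_def)
qed

lemma L2_norm_nonneg: "0 \<le> L2_norm U f" by (simp add: L2_norm_def set_integral_nonneg')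

text \<open>\<open>A\<close> may reach beyond \<open>U\<close>: a test function vanishes there, so
  its norm over \<open>U\<close> is its norm over the whole space.\<close>

lemma L2_norm_mono:
  assumes "\<phi> \<in> test_functions U" "A \<in> sets borel"
  shows "L2_norm A \<phi> \<le> L2_norm U \<phi>"
proof -
  have i: "integrable lborel (\<lambda>x. (cmod (\<phi> x))\<^sup>2)"
    using test_L2[OF assms(1)] unfolding L2_iff test_indicator[OF assms(1)] by blast
  have "(LINT x:A|lborel. (cmod (\<phi> x))\<^sup>2) \<le> (LINT x|lborel. (cmod (\<phi> x))\<^sup>2)"
    unfolding set_lebesgue_integral_def
    by (intro integral_mono integrable_mult_indicator i) (use assms in \<open>auto simp: indicator_def\<close>)
  also have "\<dots> = (LINT x:U|lborel. (cmod (\<phi> x))\<^sup>2)"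
    unfolding set_lebesgue_integral_def
    by (intro Bochner_Integration.integral_cong refl) (use assms in \<open>auto simp: indicator_def test_functions_iff\<close>)
  finally show ?thesis by (simp add: L2_norm_def)
qed

text \<open>The fundamental theorem of calculus followed by Cauchy-Schwarz on \<open>{x..y}\<close>
  gives Hoelder continuity of order 1/2, with a constant controlled by the derivative alone.\<close>

lemma test_holder:
  fixes \<phi> :: "real \<Rightarrow> complex"
  assumes t: "\<phi> \<in> test_functions U" and "x \<le> y"
  shows "cmod (\<phi> y - \<phi> x) \<le> L2_norm U (partial_deriv 1 \<phi>) * sqrt (y - x)"
proof -
  have t': "partial_deriv 1 \<phi> \<in> test_functions U" by (rule test_partial[OF t]) simp
  have "(LINT z|lborel. indicator {x..y} z *\<^sub>R partial_deriv 1 \<phi> z) = \<phi> y - \<phi> x"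
    by (rule integral_FTC_Icc[OF assms(2)])
       (use has_vector_derivative_partial[OF test_smooth[OF t]] test_continuous[OF t'] in
        \<open>auto intro: has_vector_derivative_at_within continuous_on_subset\<close>)
  then have "cmod (\<phi> y - \<phi> x) \<le> (LINT z|lborel. cmod (indicator {x..y} z *\<^sub>R partial_deriv 1 \<phi> z))"
    using integral_norm_bound by metis
  also have "\<dots> \<le> L2_norm {x..y} (partial_deriv 1 \<phi>) * sqrt (measure lborel {x..y})"
  proof (rule L2_L1_bound)
    have "integrable lborel (\<lambda>z. (cmod (indicator {x..y} z *\<^sub>R partial_deriv 1 \<phi> z))\<^sup>2)"
    proof -
      have "integrable lborel (\<lambda>z. indicator {x..y} z *\<^sub>R (cmod (partial_deriv 1 \<phi> z))\<^sup>2)"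
        by (intro borel_integrable_compact continuous_intros continuous_on_subset[OF test_continuous[OF t']]) auto
      moreover have "(cmod (indicator {x..y} z *\<^sub>R partial_deriv 1 \<phi> z))\<^sup>2 = indicator {x..y} z *\<^sub>R (cmod (partial_deriv 1 \<phi> z))\<^sup>2" for z
        by (simp add: indicator_def)
      ultimately show ?thesis by simp
    qed
    moreover have "(\<lambda>z. indicator {x..y} z *\<^sub>R partial_deriv 1 \<phi> z) \<in> borel_measurable lborel"
      using borel_measurable_continuous_onI[OF test_continuous[OF t']]
      by (intro borel_measurable_scaleR) (auto simp: measurable_lborel1)
    ultimately show "partial_deriv 1 \<phi> \<in> L2 {x..y}" by (simp add: L2_iff)
  qed (use assms(2) in simp_all)
  also have "\<dots> \<le> L2_norm U (partial_deriv 1 \<phi>) * sqrt (y - x)"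
    using assms(2) L2_norm_mono[OF t', of "{x..y}"] by (intro mult_mono) (auto simp: L2_norm_nonneg)
  finally show ?thesis .
qed

lemma L2_norm_unit_le:
  assumes "f \<in> L2 {0<..<1::real}" "\<And>x. x \<in> {0<..<1} \<Longrightarrow> cmod (f x) \<le> e" "0 \<le> e"
  shows "L2_norm {0<..<1} f \<le> e"
proof -
  have "(LINT x:{0<..<1::real}|lborel. (cmod (f x))\<^sup>2) \<le> (LINT x:{0<..<1::real}|lborel. e\<^sup>2)"
    by (rule set_integral_mono)
       (use assms in \<open>auto simp: L2_def set_integrable_def intro!: power_mono integrable_mult_left\<close>)
  also have "\<dots> = e\<^sup>2" by (simp add: set_lebesgue_integral_def)
  finally show ?thesis unfolding L2_norm_def using assms(3) by (intro real_le_lsqrt) auto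
qed

text \<open>The bound on the derivatives gives a common Hoelder constant, and vanishing at 0 turns
  this into a uniform bound. Arzela-Ascoli then yields uniform convergence, which on the unit
  interval is stronger than convergence in the mean.\<close>

lemma test_compact:
  fixes \<phi> :: "nat \<Rightarrow> real \<Rightarrow> complex"
  assumes t: "\<And>n. \<phi> n \<in> test_functions {0<..<1}"
    and M: "\<And>n. L2_norm {0<..<1} (partial_deriv 1 (\<phi> n)) \<le> M"
  shows "\<exists>k. strict_mono (k::nat\<Rightarrow>nat) \<and> (\<forall>e>0. \<exists>N. \<forall>m\<ge>N. \<forall>n\<ge>N. L2_norm {0<..<1} (\<lambda>x. \<phi> (k m) x - \<phi> (k n) x) < e)"
proof -
  have M0: "0 \<le> M" using M[of 0] L2_norm_nonneg order_trans by blast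
  have hol: "cmod (\<phi> n y - \<phi> n x) \<le> M * sqrt \<bar>y - x\<bar>" for n x y
  proof -
    have *: "cmod (\<phi> n y - \<phi> n x) \<le> M * sqrt (y - x)" if "x \<le> y" for x y
      using test_holder[OF t that, of n] mult_right_mono[OF M[of n], of "sqrt (y - x)"] that by simp
    show ?thesis
      using *[of x y] *[of y x] by (cases "x \<le> y") (simp_all add: norm_minus_commute)
  qed
  have z: "\<phi> n 0 = 0" for n using t[of n] by (auto simp: test_functions_iff)
  obtain g k where k: "strict_mono (k::nat\<Rightarrow>nat)"
    and unif: "\<And>e. 0 < e \<Longrightarrow> \<exists>N. \<forall>n x. n \<ge> N \<and> x \<in> {0..1} \<longrightarrow> cmod (\<phi> (k n) x - g x) < e"
  proof (rule Arzela_Ascoli[of "{0..1::real}" \<phi> M])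
    show "cmod (\<phi> n x) \<le> M" if "x \<in> {0..1}" for n x
    proof -
      have "M * sqrt \<bar>x - 0\<bar> \<le> M * 1" using that M0 by (intro mult_left_mono) auto
      then show ?thesis using hol[of n x 0] z by simp
    qed
    show "\<exists>d>0. \<forall>n y. y \<in> {0..1} \<and> norm (x - y) < d \<longrightarrow> cmod (\<phi> n x - \<phi> n y) < e"
      if "x \<in> {0..1}" "0 < e" for x e
    \<comment> \<open>Solves \<open>(M + 1) * sqrt d = e\<close> for \<open>d\<close>;
      \<open>M + 1\<close> avoids division by a vanishing \<open>M\<close>.\<close>
    proof (intro exI[of _ "(e / (M + 1))\<^sup>2"] conjI allI impI)
      show "(e / (M + 1))\<^sup>2 > 0" using that M0 by (simp add: add_nonneg_pos)
      fix n y assume "y \<in> {0..1} \<and> norm (x - y) < (e / (M + 1))\<^sup>2"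
      then have "sqrt \<bar>x - y\<bar> < sqrt ((e / (M + 1))\<^sup>2)" by (intro real_sqrt_less_mono) simp
      also have "\<dots> = e / (M + 1)" using that M0 by simp
      finally have "(M + 1) * sqrt \<bar>x - y\<bar> < (M + 1) * (e / (M + 1))" using M0 by (intro mult_strict_left_mono) auto
      then have "(M + 1) * sqrt \<bar>x - y\<bar> < e" using M0 by simp
      moreover have "M * sqrt \<bar>x - y\<bar> \<le> (M + 1) * sqrt \<bar>x - y\<bar>" by (intro mult_right_mono) auto
      ultimately show "cmod (\<phi> n x - \<phi> n y) < e" using hol[of n x y] by linarith
    qed
  qed (use that in auto)
  have "\<exists>N. \<forall>m\<ge>N. \<forall>n\<ge>N. L2_norm {0<..<1} (\<lambda>x. \<phi> (k m) x - \<phi> (k n) x) < e" if e: "0 < e" for e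
  proof -
    obtain N where N: "\<And>n x. n \<ge> N \<Longrightarrow> x \<in> {0..1} \<Longrightarrow> cmod (\<phi> (k n) x - g x) < e / 3"
      using unif[of "e / 3"] e by auto
    have "L2_norm {0<..<1} (\<lambda>x. \<phi> (k m) x - \<phi> (k n) x) < e" if "m \<ge> N" "n \<ge> N" for m n
    proof -
      have "L2_norm {0<..<1} (\<lambda>x. \<phi> (k m) x - \<phi> (k n) x) \<le> 2 * e / 3"
      proof (rule L2_norm_unit_le)
        show "(\<lambda>x. \<phi> (k m) x - \<phi> (k n) x) \<in> L2 {0<..<1}" by (rule L2.diff_mem[OF test_L2[OF t] test_L2[OF t]])
        fix x :: real assume "x \<in> {0<..<1}"
        then show "cmod (\<phi> (k m) x - \<phi> (k n) x) \<le> 2 * e / 3"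
          using norm_triangle_ineq4[of "\<phi> (k m) x - g x" "\<phi> (k n) x - g x"] N[of m x] N[of n x] that by simp
      qed (use e in auto)
      then show ?thesis using e by simp
    qed
    then show ?thesis by blast
  qed
  then show ?thesis using k by blast
qed

section \<open>Closedness and compactness of the form on the unit interval\<close>

abbreviation (input) unit_interval :: "real set" ("\<J>") where "\<J> \<equiv> {0<..<1}"

abbreviation (input) weak_deriv_J :: "(real \<Rightarrow> complex) \<Rightarrow> real \<Rightarrow> complex" ("\<D>") where "\<D> \<equiv> weak_deriv \<J> 1"

definition H_form :: "real \<Rightarrow> (real \<Rightarrow> complex) \<Rightarrow> (real \<Rightarrow> complex) \<Rightarrow> complex" where
  "H_form \<alpha> f g = L2_inner \<J> (\<D> (\<D> f)) (\<D> (\<D> g)) + of_real (2 * \<alpha>) * L2_inner \<J> (\<D> f) (\<D> g)"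

lemma H_op_eq: "H_op 1 \<alpha> = form_operator \<J> (W22_0 \<J>) (H_form \<alpha>)"
  by (simp add: H_op_def Let_def H_form_def[abs_def])

lemma open_J: "open \<J>" by simp

lemma W22_inner_J:
  "W22_inner \<J> f g = L2_inner \<J> f g + L2_inner \<J> (\<D> f) (\<D> g) + L2_inner \<J> (\<D> (\<D> f)) (\<D> (\<D> g))"
  by (simp add: W22_inner_def)

lemma W22_norm_J: "(W22_norm \<J> f)\<^sup>2 = (L2_norm \<J> f)\<^sup>2 + (L2_norm \<J> (\<D> f))\<^sup>2 + (L2_norm \<J> (\<D> (\<D> f)))\<^sup>2"
  by (simp add: W22_norm_sq W22_inner_J L2_norm_sq)

lemma W22_norm_nonneg: "0 \<le> W22_norm U f"
  by (simp add: W22_norm_def add_nonneg_nonneg sum_nonneg)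

lemma H_form_self: "Re (H_form \<alpha> f f) = (L2_norm \<J> (\<D> (\<D> f)))\<^sup>2 + 2 * \<alpha> * (L2_norm \<J> (\<D> f))\<^sup>2"
  by (simp add: H_form_def L2_norm_sq)

interpretation WJ0: semi_inner "W22_0 \<J>" "L2_inner \<J>"
  by (rule semi_inner_W22_0[OF open_J semi_inner_W22_parts(1)[OF open_J]])

interpretation WJ1: semi_inner "W22 \<J>" "\<lambda>f g. L2_inner \<J> (\<D> f) (\<D> g)"
  by (rule semi_inner_W22_parts(2)[OF open_J]) simp

interpretation WJ2: semi_inner "W22 \<J>" "\<lambda>f g. L2_inner \<J> (\<D> (\<D> f)) (\<D> (\<D> g))"
  by (rule semi_inner_W22_parts(3)[OF open_J]) simp_all

lemma WJ_nrm: "WJ0.nrm f = L2_norm \<J> f" "WJ1.nrm f = L2_norm \<J> (\<D> f)" "WJ2.nrm f = L2_norm \<J> (\<D> (\<D> f))"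
  by (simp_all add: WJ0.nrm_def WJ1.nrm_def WJ2.nrm_def L2_norm_def L2_inner_self)

lemma WJ_L2: "f \<in> W22 \<J> \<Longrightarrow> f \<in> L2 \<J>" "f \<in> W22 \<J> \<Longrightarrow> \<D> f \<in> L2 \<J>" "f \<in> W22 \<J> \<Longrightarrow> \<D> (\<D> f) \<in> L2 \<J>"
  using W22_D(1) W22_D_L2[of f \<J> 1] by auto

lemma WJ_diff:
  assumes f: "f \<in> W22 \<J>" and g: "g \<in> W22 \<J>"
  shows "AE x in lborel. x \<in> \<J> \<longrightarrow> \<D> (\<lambda>x. f x - g x) x = \<D> f x - \<D> g x"
    "AE x in lborel. x \<in> \<J> \<longrightarrow> \<D> (\<D> (\<lambda>x. f x - g x)) x = \<D> (\<D> f) x - \<D> (\<D> g) x"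
proof -
  note m = W22_scale(1)[OF open_J g, of "-1"]
  have e: "(\<lambda>x. f x - g x) = (\<lambda>x. f x + (-1) * g x)" by simp
  have B: "(1::real) \<in> Basis" by simp
  show "AE x in lborel. x \<in> \<J> \<longrightarrow> \<D> (\<lambda>x. f x - g x) x = \<D> f x - \<D> g x"
    using W22_add(2)[OF open_J f m B] W22_scale(2)[OF open_J g B, of "-1"]
    unfolding e by eventually_elim simp
  show "AE x in lborel. x \<in> \<J> \<longrightarrow> \<D> (\<D> (\<lambda>x. f x - g x)) x = \<D> (\<D> f) x - \<D> (\<D> g) x"
    using W22_add(3)[OF open_J f m B B] W22_scale(3)[OF open_J g B B, of "-1"]
    unfolding e by eventually_elim simp
qed

lemma WJ_diff_norm:
  assumes f: "f \<in> W22 \<J>" and g: "g \<in> W22 \<J>"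
  shows "L2_norm \<J> (\<D> (\<lambda>x. f x - g x)) = L2_norm \<J> (\<lambda>x. \<D> f x - \<D> g x)"
    "L2_norm \<J> (\<D> (\<D> (\<lambda>x. f x - g x))) = L2_norm \<J> (\<lambda>x. \<D> (\<D> f) x - \<D> (\<D> g) x)"
  using WJ_L2[OF f] WJ_L2[OF g] WJ_L2[OF WJ1.diff_mem[OF f g]] WJ_diff[OF f g]
  by (auto intro!: L2_norm_cong L2.diff_mem)

text \<open>Weak differentiation is a closed operation: both sides of its defining identity are
  pairings with a fixed test function, hence continuous for mean-square convergence.\<close>

lemma has_weak_deriv_limit:
  assumes h: "\<And>n::nat. has_weak_deriv U b (u n) (w n)" and b: "b \<in> Basis" and v: "v \<in> L2 U" "z \<in> L2 U"
    and lim: "(\<lambda>n. L2_norm U (\<lambda>x. u n x - v x)) \<longlonglongrightarrow> 0" "(\<lambda>n. L2_norm U (\<lambda>x. w n x - z x)) \<longlonglongrightarrow> 0"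
  shows "has_weak_deriv U b v z"
  unfolding has_weak_deriv_def
proof (intro conjI ballI v)
  fix \<phi> assume p: "\<phi> \<in> test_functions U"
  have l: "(\<lambda>n. LINT x:U|lborel. u n x * g x) \<longlonglongrightarrow> (LINT x:U|lborel. v x * g x)"
    if "\<And>n. u n \<in> L2 U" "v \<in> L2 U" "g \<in> L2 U" "(\<lambda>n. L2_norm U (\<lambda>x. u n x - v x)) \<longlonglongrightarrow> 0" for u g v
    using L2.inner_tendsto[OF that(1,2) L2_cnj[OF that(3)] that(4)[unfolded L2_norm_eq]] by (simp add: L2_inner_def)
  note hL = has_weak_deriv_L2[OF h]
  have "(\<lambda>n. LINT x:U|lborel. u n x * partial_deriv b \<phi> x) \<longlonglongrightarrow> (LINT x:U|lborel. v x * partial_deriv b \<phi> x)"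
    by (rule l[OF hL(1) v(1) test_L2[OF test_partial[OF p b]] lim(1)])
  moreover have "(LINT x:U|lborel. u n x * partial_deriv b \<phi> x) = - (LINT x:U|lborel. w n x * \<phi> x)" for n
    using h p by (simp add: has_weak_deriv_def)
  moreover have "(\<lambda>n. - (LINT x:U|lborel. w n x * \<phi> x)) \<longlonglongrightarrow> - (LINT x:U|lborel. z x * \<phi> x)"
    by (intro tendsto_minus l[OF hL(2) v(2) test_L2[OF p] lim(2)])
  ultimately show "(LINT x:U|lborel. v x * partial_deriv b \<phi> x) = - (LINT x:U|lborel. z x * \<phi> x)"
    using LIMSEQ_unique by force
qed

text \<open>The functions and their first and second derivatives converge separately in the complete
  space of square integrable functions; closedness of weak differentiation identifies the last two
  limits as derivatives of the first.\<close>

lemma W22_0_complete_J: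
  assumes u: "\<And>n::nat. u n \<in> W22_0 \<J>"
    and c0: "\<And>e. e > 0 \<Longrightarrow> \<exists>N. \<forall>m\<ge>N. \<forall>n\<ge>N. L2_norm \<J> (\<lambda>x. u m x - u n x) < e"
    and c1: "\<And>e. e > 0 \<Longrightarrow> \<exists>N. \<forall>m\<ge>N. \<forall>n\<ge>N. L2_norm \<J> (\<D> (\<lambda>x. u m x - u n x)) < e"
    and c2: "\<And>e. e > 0 \<Longrightarrow> \<exists>N. \<forall>m\<ge>N. \<forall>n\<ge>N. L2_norm \<J> (\<D> (\<D> (\<lambda>x. u m x - u n x))) < e"
  obtains v where "v \<in> W22_0 \<J>" "(\<lambda>n. L2_norm \<J> (\<lambda>x. u n x - v x)) \<longlonglongrightarrow> 0"
    "(\<lambda>n. L2_norm \<J> (\<D> (\<lambda>x. u n x - v x))) \<longlonglongrightarrow> 0" "(\<lambda>n. L2_norm \<J> (\<D> (\<D> (\<lambda>x. u n x - v x)))) \<longlonglongrightarrow> 0"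
proof -
  have uW: "u n \<in> W22 \<J>" for n by (rule W22_0_sub[OF u])
  note cd = WJ_diff_norm[OF uW uW]
  have J: "\<J> \<in> sets lborel" "emeasure lborel \<J> < \<infinity>" by auto
  obtain v0 where v0: "v0 \<in> L2 \<J>" "(\<lambda>n. L2_norm \<J> (\<lambda>x. u n x - v0 x)) \<longlonglongrightarrow> 0"
    using L2_complete[OF J WJ_L2(1)[OF uW] c0] by blast
  obtain v1 where v1: "v1 \<in> L2 \<J>" "(\<lambda>n. L2_norm \<J> (\<lambda>x. \<D> (u n) x - v1 x)) \<longlonglongrightarrow> 0"
    using L2_complete[OF J WJ_L2(2)[OF uW] c1[unfolded cd]] by blast
  obtain v2 where v2: "v2 \<in> L2 \<J>" "(\<lambda>n. L2_norm \<J> (\<lambda>x. \<D> (\<D> (u n)) x - v2 x)) \<longlonglongrightarrow> 0"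
    using L2_complete[OF J WJ_L2(3)[OF uW] c2[unfolded cd]] by blast
  have h1: "has_weak_deriv \<J> 1 v0 v1"
    by (rule has_weak_deriv_limit[OF W22_D(2)[OF uW] _ v0(1) v1(1) v0(2) v1(2)]) simp_all
  have h2: "has_weak_deriv \<J> 1 v1 v2"
    by (rule has_weak_deriv_limit[OF W22_D(3)[OF uW] _ v1(1) v2(1) v1(2) v2(2)]) simp_all
  note W = W22_I[OF open_J v0(1), of "\<lambda>_. v1" "\<lambda>_ _. v2"]
  have vW: "v0 \<in> W22 \<J>" by (rule W(1)) (use h1 h2 in simp_all)
  have a1: "AE x in lborel. x \<in> \<J> \<longrightarrow> \<D> v0 x = v1 x" by (rule W(2)) (use h1 h2 in simp_all)
  have a2: "AE x in lborel. x \<in> \<J> \<longrightarrow> \<D> (\<D> v0) x = v2 x" by (rule W(3)) (use h1 h2 in simp_all)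
  have n1: "L2_norm \<J> (\<D> (\<lambda>x. u n x - v0 x)) = L2_norm \<J> (\<lambda>x. \<D> (u n) x - v1 x)" for n
    unfolding WJ_diff_norm(1)[OF uW vW]
    by (rule L2_norm_cong) (use a1 WJ_L2[OF uW[of n]] WJ_L2[OF vW] v1 in \<open>auto intro: L2.diff_mem\<close>)
  have n2: "L2_norm \<J> (\<D> (\<D> (\<lambda>x. u n x - v0 x))) = L2_norm \<J> (\<lambda>x. \<D> (\<D> (u n)) x - v2 x)" for n
    unfolding WJ_diff_norm(2)[OF uW vW]
    by (rule L2_norm_cong) (use a2 WJ_L2[OF uW[of n]] WJ_L2[OF vW] v2 in \<open>auto intro: L2.diff_mem\<close>)
  have l1: "(\<lambda>n. L2_norm \<J> (\<D> (\<lambda>x. u n x - v0 x))) \<longlonglongrightarrow> 0" unfolding n1 by (rule v1(2))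
  have l2: "(\<lambda>n. L2_norm \<J> (\<D> (\<D> (\<lambda>x. u n x - v0 x)))) \<longlonglongrightarrow> 0" unfolding n2 by (rule v2(2))
  interpret W: semi_inner "W22 \<J>" "W22_inner \<J>" by (rule semi_inner_W22[OF open_J])
  have N: "W22_norm \<J> = W.nrm" by (simp add: fun_eq_iff W22_norm_eq W.nrm_def)
  have "(\<lambda>n. (W22_norm \<J> (\<lambda>x. u n x - v0 x))\<^sup>2) \<longlonglongrightarrow> 0\<^sup>2 + 0\<^sup>2 + 0\<^sup>2"
    unfolding W22_norm_J by (intro tendsto_intros v0 l1 l2)
  then have lW: "(\<lambda>n. (W22_norm \<J> (\<lambda>x. u n x - v0 x))\<^sup>2) \<longlonglongrightarrow> 0" by simp
  have "v0 \<in> W22_0 \<J>"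
  proof (rule W22_0_limit[OF open_J vW])
    fix e :: real assume e: "e > 0"
    then obtain n where "(W22_norm \<J> (\<lambda>x. u n x - v0 x))\<^sup>2 < e\<^sup>2"
      using order_tendstoD(2)[OF lW, of "e\<^sup>2"] by (auto simp: eventually_sequentially)
    then have "W22_norm \<J> (\<lambda>x. u n x - v0 x) < e" using e by (intro power2_less_imp_less[of _ e]) auto
    then have "W22_norm \<J> (\<lambda>x. v0 x - u n x) < e" unfolding N W.nrm_diff_commute[OF vW uW] .
    then show "\<exists>g\<in>W22_0 \<J>. W22_norm \<J> (\<lambda>x. v0 x - g x) < e" using u by blast
  qed
  then show thesis using that v0(2) l1 l2 by blast
qed

text \<open>\<open>u n\<close> is replaced by a test function within \<open>1 / Suc n\<close> in the
  Sobolev norm. These test functions still have bounded derivatives, so \<open>test_compact\<close>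
  applies, and the replacement error tends to 0.\<close>

lemma W22_0_compact_J:
  assumes u: "\<And>n::nat. u n \<in> W22_0 \<J>" and M: "\<And>n. L2_norm \<J> (\<D> (u n)) \<le> M"
  shows "\<exists>k. strict_mono (k::nat\<Rightarrow>nat) \<and> (\<forall>e>0. \<exists>N. \<forall>m\<ge>N. \<forall>n\<ge>N. L2_norm \<J> (\<lambda>x. u (k m) x - u (k n) x) < e)"
proof -
  have uW: "u n \<in> W22 \<J>" for n by (rule W22_0_sub[OF u])
  have "\<exists>\<phi>. \<phi> \<in> test_functions \<J> \<and> W22_norm \<J> (\<lambda>x. u n x - \<phi> x) < 1 / Suc n" for n
    using W22_0_approx[OF u[of n], of "1 / Suc n"] by auto
  then have "\<forall>n. \<exists>\<phi>. \<phi> \<in> test_functions \<J> \<and> W22_norm \<J> (\<lambda>x. u n x - \<phi> x) < 1 / Suc n" ..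
  from choice[OF this] obtain \<phi> where p': "\<forall>n. \<phi> n \<in> test_functions \<J> \<and> W22_norm \<J> (\<lambda>x. u n x - \<phi> n x) < 1 / Suc n" ..
  have p: "\<phi> n \<in> test_functions \<J>" "W22_norm \<J> (\<lambda>x. u n x - \<phi> n x) < 1 / Suc n" for n
    using p'[rule_format, of n] by blast+
  have pW: "\<phi> n \<in> W22 \<J>" for n by (rule W22_test(1)[OF open_J p(1)])
  have le: "L2_norm \<J> f \<le> W22_norm \<J> f" "L2_norm \<J> (\<D> f) \<le> W22_norm \<J> f" for f
    by (rule power2_le_imp_le[OF _ W22_norm_nonneg], unfold W22_norm_J, simp)+
  have "L2_norm \<J> (partial_deriv 1 (\<phi> n)) \<le> M + 1" for n
  proof -
    have "L2_norm \<J> (partial_deriv 1 (\<phi> n)) = WJ1.nrm (\<phi> n)"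
      unfolding WJ_nrm
      by (rule L2_norm_cong) (use W22_test(2)[OF open_J p(1), of 1 n] test_L2[OF test_partial[OF p(1), of 1 n]] WJ_L2(2)[OF pW] in auto)
    also have "\<dots> \<le> WJ1.nrm (u n) + WJ1.nrm (\<lambda>x. u n x - \<phi> n x)"
      using WJ1.nrm_minus_le[OF uW pW, of n n] by linarith
    also have "WJ1.nrm (u n) \<le> M" unfolding WJ_nrm by (rule M)
    also have "WJ1.nrm (\<lambda>x. u n x - \<phi> n x) \<le> 1 / Suc n"
      unfolding WJ_nrm by (rule order_trans[OF le(2) less_imp_le[OF p(2)]])
    also have "1 / real (Suc n) \<le> 1" by simp
    finally show ?thesis by simp
  qed
  from test_compact[of \<phi>, OF p(1) this] obtain k where k: "strict_mono (k::nat\<Rightarrow>nat)"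
    and cau: "\<And>e. e > 0 \<Longrightarrow> \<exists>N. \<forall>m\<ge>N. \<forall>n\<ge>N. L2_norm \<J> (\<lambda>x. \<phi> (k m) x - \<phi> (k n) x) < e" by blast
  have "\<exists>N. \<forall>m\<ge>N. \<forall>n\<ge>N. L2_norm \<J> (\<lambda>x. u (k m) x - u (k n) x) < e" if e: "e > 0" for e
  proof -
    obtain N1 where N1: "\<forall>m\<ge>N1. \<forall>n\<ge>N1. L2_norm \<J> (\<lambda>x. \<phi> (k m) x - \<phi> (k n) x) < e / 3" using cau[of "e / 3"] e by auto
    obtain N2 where N2: "3 / e < real N2" using reals_Archimedean2 by blast
    have d: "L2_norm \<J> (\<lambda>x. u (k n) x - \<phi> (k n) x) < e / 3" if "n \<ge> N2" for n
    proof -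
      have "3 / e < Suc (k n)" using N2 that seq_suble[OF k, of n] by linarith
      then have "1 / Suc (k n) < e / 3" using e by (simp add: field_simps)
      then show ?thesis using order_le_less_trans[OF le(1) p(2)[of "k n"]] by linarith
    qed
    have "L2_norm \<J> (\<lambda>x. u (k m) x - u (k n) x) < e" if mn: "m \<ge> max N1 N2" "n \<ge> max N1 N2" for m n
    proof -
      note m = WJ_L2(1)[OF uW] WJ_L2(1)[OF pW]
      have "L2_norm \<J> (\<lambda>x. u (k m) x - u (k n) x) \<le>
          L2_norm \<J> (\<lambda>x. u (k m) x - \<phi> (k m) x) + L2_norm \<J> (\<lambda>x. \<phi> (k m) x - u (k n) x)"
        unfolding L2_norm_eq by (rule L2.nrm_diff_le[OF m(1) m(2) m(1)])
      also have "L2_norm \<J> (\<lambda>x. \<phi> (k m) x - u (k n) x) \<le>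
          L2_norm \<J> (\<lambda>x. \<phi> (k m) x - \<phi> (k n) x) + L2_norm \<J> (\<lambda>x. \<phi> (k n) x - u (k n) x)"
        unfolding L2_norm_eq by (rule L2.nrm_diff_le[OF m(2) m(2) m(1)])
      also have "L2_norm \<J> (\<lambda>x. \<phi> (k n) x - u (k n) x) = L2_norm \<J> (\<lambda>x. u (k n) x - \<phi> (k n) x)"
        unfolding L2_norm_eq by (rule L2.nrm_diff_commute[OF m(2) m(1)])
      finally show ?thesis using N1[rule_format, of m n] d[of m] d[of n] mn by simp
    qed
    then show ?thesis by blast
  qed
  then show ?thesis using k by blast
qed

lemma eigenspace_form_operator:
  assumes "D \<subseteq> L2 U"
  shows "f \<in> eigenspace (form_operator U D q) r \<longleftrightarrow> f \<in> D \<and> (\<forall>v\<in>D. q f v = of_real r * L2_inner U f v)"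
proof -
  have "f \<in> eigenspace (form_operator U D q) r \<longleftrightarrow>
    f \<in> D \<and> (\<lambda>x. of_real r * f x) \<in> L2 U \<and> (\<forall>v\<in>D. q f v = L2_inner U (\<lambda>x. of_real r * f x) v)"
    by (simp add: eigenspace_def form_operator_def)
  also have "\<dots> \<longleftrightarrow> f \<in> D \<and> (\<forall>v\<in>D. q f v = of_real r * L2_inner U f v)"
    using assms L2_scale[of f U "of_real r"] L2.scale_left[of f U _ "of_real r"] by (auto simp: subset_iff)
  finally show ?thesis .
qed

text \<open>With \<open>\<alpha> > 0\<close> the form is non-negative and controls the norms of both
  derivatives separately (\<open>q1\<close>, \<open>q2\<close>). A bound on the form thus bounds
  first derivatives, and a Cauchy sequence for the form is Cauchy in each derivative.\<close>

lemma compact_spectral_form_H: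
  assumes \<alpha>: "\<alpha> > 0"
  shows "compact_spectral_form (W22_0 \<J>) (L2_inner \<J>) (H_form \<alpha>) \<J> (H_op 1 \<alpha>)"
proof -
  have q: "semi_inner (W22_0 \<J>) (H_form \<alpha>)"
    unfolding H_form_def[abs_def]
    by (intro semi_inner_W22_0[OF open_J] semi_inner_plus semi_inner_scaled
        WJ1.semi_inner_axioms WJ2.semi_inner_axioms) (use \<alpha> in simp)
  interpret form_pair "W22_0 \<J>" "L2_inner \<J>" "H_form \<alpha>"
    by (rule form_pair.intro[OF WJ0.semi_inner_axioms q])
  interpret spectral_form "W22_0 \<J>" "L2_inner \<J>" "H_form \<alpha>" \<J> "H_op 1 \<alpha>"
  proof
    have sub: "W22_0 \<J> \<subseteq> L2 \<J>" using W22_0_sub W22_D(1) by blast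
    show "f \<in> eigenspace (H_op 1 \<alpha>) r \<longleftrightarrow> eigvec r f" for f r
      unfolding H_op_eq eigenspace_form_operator[OF sub] eigvec_def ..
    show "u \<in> W22_0 \<J> \<Longrightarrow> L2_inner \<J> u u = 0 \<longleftrightarrow> (AE x in lborel. x \<in> \<J> \<longrightarrow> u x = 0)" for u
      using L2_null_iff sub by blast
  qed
  have qn: "q.nrm f = sqrt ((L2_norm \<J> (\<D> (\<D> f)))\<^sup>2 + 2 * \<alpha> * (L2_norm \<J> (\<D> f))\<^sup>2)" for f
    by (simp add: q.nrm_def H_form_self)
  have q1: "L2_norm \<J> (\<D> f) \<le> q.nrm f / sqrt (2 * \<alpha>)" for f
  proof -
    have "sqrt (2 * \<alpha>) * L2_norm \<J> (\<D> f) = sqrt (2 * \<alpha> * (L2_norm \<J> (\<D> f))\<^sup>2)"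
      using \<alpha> by (simp add: real_sqrt_mult L2_norm_nonneg)
    also have "\<dots> \<le> q.nrm f" unfolding qn by simp
    finally show ?thesis using \<alpha> by (simp add: field_simps)
  qed
  have q2: "L2_norm \<J> (\<D> (\<D> f)) \<le> q.nrm f" for f
    unfolding qn using \<alpha> by (intro real_le_rsqrt) simp
  have sn: "WJ0.nrm f = L2_norm \<J> f" for f by (rule WJ_nrm)
  show ?thesis
  proof (unfold_locales, goal_cases)
    case (1 u C)
    have "L2_norm \<J> (\<D> (u n)) \<le> sqrt C / sqrt (2 * \<alpha>)" for n
    proof -
      have "q.nrm (u n) \<le> sqrt C" using 1(3)[of n] by (simp add: q.nrm_def)
      then have "q.nrm (u n) / sqrt (2 * \<alpha>) \<le> sqrt C / sqrt (2 * \<alpha>)" using \<alpha> by (intro divide_right_mono) auto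
      then show ?thesis using q1[of "u n"] by linarith
    qed
    from W22_0_compact_J[of u, OF 1(1) this] show ?case unfolding sn .
  next
    case (2 u)
    have c1: "\<exists>N. \<forall>m\<ge>N. \<forall>n\<ge>N. L2_norm \<J> (\<D> (\<lambda>x. u m x - u n x)) < e" if e: "e > 0" for e
    proof -
      have "e * sqrt (2 * \<alpha>) > 0" using e \<alpha> by simp
      from 2(3)[OF this] obtain N where N: "\<forall>m\<ge>N. \<forall>n\<ge>N. q.nrm (\<lambda>x. u m x - u n x) < e * sqrt (2 * \<alpha>)" by blast
      have "L2_norm \<J> (\<D> (\<lambda>x. u m x - u n x)) < e" if "m \<ge> N" "n \<ge> N" for m n
      proof -
        have "q.nrm (\<lambda>x. u m x - u n x) / sqrt (2 * \<alpha>) < e" using N that \<alpha> by (simp add: pos_divide_less_eq)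
        then show ?thesis using q1[of "\<lambda>x. u m x - u n x"] by linarith
      qed
      then show ?thesis by blast
    qed
    have c2: "\<exists>N. \<forall>m\<ge>N. \<forall>n\<ge>N. L2_norm \<J> (\<D> (\<D> (\<lambda>x. u m x - u n x))) < e" if e: "e > 0" for e
    proof -
      obtain N where N: "\<forall>m\<ge>N. \<forall>n\<ge>N. q.nrm (\<lambda>x. u m x - u n x) < e" using 2(3)[OF e] by blast
      have "L2_norm \<J> (\<D> (\<D> (\<lambda>x. u m x - u n x))) < e" if "m \<ge> N" "n \<ge> N" for m n
        using order_le_less_trans[OF q2 N[rule_format, OF that]] .
      then show ?thesis by blast
    qed
    obtain v where v: "v \<in> W22_0 \<J>" "(\<lambda>n. L2_norm \<J> (\<lambda>x. u n x - v x)) \<longlonglongrightarrow> 0"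
      "(\<lambda>n. L2_norm \<J> (\<D> (\<lambda>x. u n x - v x))) \<longlonglongrightarrow> 0" "(\<lambda>n. L2_norm \<J> (\<D> (\<D> (\<lambda>x. u n x - v x)))) \<longlonglongrightarrow> 0"
      using W22_0_complete_J[of u, OF 2(1) 2(2)[unfolded sn] c1 c2] by blast
    have "(\<lambda>n. q.nrm (\<lambda>x. u n x - v x)) \<longlonglongrightarrow> sqrt (0\<^sup>2 + 2 * \<alpha> * 0\<^sup>2)"
      unfolding qn by (intro tendsto_intros v)
    then show ?case using v(1,2) unfolding sn by (intro bexI[of _ v]) simp_all
  qed
qed

text \<open>Only the values of the eigenfunctions inside the interval matter, so they are cut off to zero outside.\<close>

lemma H_lower_bound:
  assumes \<alpha>: "\<alpha> > 0" and ev: "lists_eigenvalues \<J> (H_op 1 \<alpha>) \<rho>"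
  obtains \<phi> where "\<And>i. i < m \<Longrightarrow> \<phi> i \<in> L2 UNIV \<and> (\<forall>x. x \<notin> \<J> \<longrightarrow> \<phi> i x = 0) \<and>
        (\<phi> i = (\<lambda>x. 0) \<or> (LINT x|lborel. (cmod (\<phi> i x))\<^sup>2) = 1)"
    "\<And>u. u \<in> test_functions \<J> \<Longrightarrow>
      \<rho> (Suc m) * (LINT x|lborel. (cmod (u x))\<^sup>2)
        - (\<Sum>i<m. (\<rho> (Suc m) - \<rho> (Suc i)) * (cmod (LINT x|lborel. u x * cnj (\<phi> i x)))\<^sup>2)
      \<le> (LINT x|lborel. (cmod (partial_deriv 1 (partial_deriv 1 u) x))\<^sup>2)
        + 2 * \<alpha> * (LINT x|lborel. (cmod (partial_deriv 1 u x))\<^sup>2)"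
proof -
  interpret compact_spectral_form "W22_0 \<J>" "L2_inner \<J>" "H_form \<alpha>" \<J> "H_op 1 \<alpha>"
    by (rule compact_spectral_form_H[OF \<alpha>])
  obtain \<phi> where \<phi>: "\<And>i. i < m \<Longrightarrow> \<phi> i \<in> W22_0 \<J> \<and> (\<phi> i = (\<lambda>x. 0) \<or> L2_inner \<J> (\<phi> i) (\<phi> i) = 1)"
    and lb: "\<And>u. u \<in> W22_0 \<J> \<Longrightarrow> \<rho> (Suc m) * Re (L2_inner \<J> u u)
      - (\<Sum>i<m. (\<rho> (Suc m) - \<rho> (Suc i)) * (cmod (L2_inner \<J> u (\<phi> i)))\<^sup>2) \<le> Re (H_form \<alpha> u u)"
  proof (rule spectral_lower_bound[OF ev, of m])
    fix \<phi> assume "\<And>i. i < m \<Longrightarrow> \<phi> i \<in> W22_0 \<J> \<and> (\<phi> i = (\<lambda>x. 0) \<or> L2_inner \<J> (\<phi> i) (\<phi> i) = 1)"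
      "\<And>u. u \<in> W22_0 \<J> \<Longrightarrow> \<rho> (Suc m) * Re (L2_inner \<J> u u)
        - (\<Sum>i<m. (\<rho> (Suc m) - \<rho> (Suc i)) * (cmod (L2_inner \<J> u (\<phi> i)))\<^sup>2) \<le> Re (H_form \<alpha> u u)"
    then show thesis by (rule that)
  qed
  define \<psi> where "\<psi> i = (\<lambda>x. indicator \<J> x *\<^sub>R \<phi> i x)" for i
  have L: "\<phi> i \<in> L2 \<J>" if "i < m" for i using \<phi>[OF that] W22_0_sub W22_D(1) by blast
  show thesis
  proof (rule that[of \<psi>])
    fix i assume i: "i < m"
    have "\<psi> i \<in> L2 UNIV" using L[OF i] unfolding L2_iff \<psi>_def by simp
    moreover have "\<forall>x. x \<notin> \<J> \<longrightarrow> \<psi> i x = 0" by (simp add: \<psi>_def)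
    moreover have "\<psi> i = (\<lambda>x. 0) \<or> (LINT x|lborel. (cmod (\<psi> i x))\<^sup>2) = 1"
    proof (cases "\<phi> i = (\<lambda>x. 0)")
      case False
      then have "L2_inner \<J> (\<phi> i) (\<phi> i) = 1" using \<phi>[OF i] by blast
      then have "(LINT x:\<J>|lborel. (cmod (\<phi> i x))\<^sup>2) = 1" unfolding L2_inner_self by simp
      moreover have "indicator \<J> x *\<^sub>R (cmod (\<phi> i x))\<^sup>2 = (cmod (\<psi> i x))\<^sup>2" for x by (simp add: \<psi>_def indicator_def)
      ultimately show ?thesis by (simp add: set_lebesgue_integral_def)
    qed (simp add: \<psi>_def)
    ultimately show "\<psi> i \<in> L2 UNIV \<and> (\<forall>x. x \<notin> \<J> \<longrightarrow> \<psi> i x = 0) \<and>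
        (\<psi> i = (\<lambda>x. 0) \<or> (LINT x|lborel. (cmod (\<psi> i x))\<^sup>2) = 1)" by blast
  next
    fix u assume u: "u \<in> test_functions \<J>"
    have nt: "(L2_norm \<J> f)\<^sup>2 = (LINT x|lborel. (cmod (f x))\<^sup>2)" if "f \<in> test_functions \<J>" for f
    proof -
      have "indicator \<J> x *\<^sub>R (cmod (f x))\<^sup>2 = (cmod (f x))\<^sup>2" for x
        using that by (auto simp: indicator_def test_functions_iff)
      then have "(LINT x:\<J>|lborel. (cmod (f x))\<^sup>2) = (LINT x|lborel. (cmod (f x))\<^sup>2)"
        by (simp only: set_lebesgue_integral_def)
      then show ?thesis unfolding L2_norm_sq L2_inner_self by simp
    qed
    have B: "(1::real) \<in> Basis" by simp
    note d1 = test_partial[OF u B] and d2 = test_partial[OF test_partial[OF u B] B]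
    have uW: "u \<in> W22 \<J>" by (rule W22_test(1)[OF open_J u])
    have e1: "L2_norm \<J> (\<D> u) = L2_norm \<J> (partial_deriv 1 u)"
      by (rule L2_norm_cong[OF W22_test(2)[OF open_J u B] WJ_L2(2)[OF uW] test_L2[OF d1]])
    have e2: "L2_norm \<J> (\<D> (\<D> u)) = L2_norm \<J> (partial_deriv 1 (partial_deriv 1 u))"
      by (rule L2_norm_cong[OF W22_test(3)[OF open_J u B B] WJ_L2(3)[OF uW] test_L2[OF d2]])
    have ip: "L2_inner \<J> u (\<phi> i) = (LINT x|lborel. u x * cnj (\<psi> i x))" for i
      unfolding L2_inner_def set_lebesgue_integral_def \<psi>_def
      by (intro Bochner_Integration.integral_cong refl) (simp add: indicator_def)
    show "\<rho> (Suc m) * (LINT x|lborel. (cmod (u x))\<^sup>2)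
        - (\<Sum>i<m. (\<rho> (Suc m) - \<rho> (Suc i)) * (cmod (LINT x|lborel. u x * cnj (\<psi> i x)))\<^sup>2)
      \<le> (LINT x|lborel. (cmod (partial_deriv 1 (partial_deriv 1 u) x))\<^sup>2)
        + 2 * \<alpha> * (LINT x|lborel. (cmod (partial_deriv 1 u x))\<^sup>2)"
      using lb[OF W22_0_test[OF open_J u]]
      unfolding H_form_self L2_norm_sq[symmetric] e1 e2 nt[OF u] nt[OF d1] nt[OF d2] ip .
  qed
qed

section \<open>Smooth functions of two variables\<close>

abbreviation pX :: "(real \<times> real \<Rightarrow> complex) \<Rightarrow> real \<times> real \<Rightarrow> complex" where "pX \<equiv> partial_deriv (1, 0)"
abbreviation pY :: "(real \<times> real \<Rightarrow> complex) \<Rightarrow> real \<times> real \<Rightarrow> complex" where "pY \<equiv> partial_deriv (0, 1)"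

lemma Basis_XY: "(1::real, 0::real) \<in> Basis" "(0::real, 1::real) \<in> Basis" "(Basis :: (real \<times> real) set) = {(1, 0), (0, 1)}"
  by (auto simp: Basis_prod_def)

lemma sections_has_vector_derivative:
  assumes "smooth f"
  shows "((\<lambda>x. f (x, y)) has_vector_derivative pX f (x, y)) (at x within S)"
    "((\<lambda>y. f (x, y)) has_vector_derivative pY f (x, y)) (at y within T)"
proof -
  have d: "(f has_derivative frechet_derivative f (at p)) (at p)" for p
    by (rule Ck_has_derivative[OF smooth_Ck[OF assms]])
  then have l: "linear (frechet_derivative f (at p))" for p by (rule has_derivative_linear)
  have "((\<lambda>x. (x, y)) has_derivative (\<lambda>h. (h, 0))) (at x)" by (auto intro!: derivative_eq_intros)
  from has_derivative_compose[OF this d]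
  have "((\<lambda>x. f (x, y)) has_derivative (\<lambda>h. frechet_derivative f (at (x, y)) (h, 0))) (at x)" .
  moreover have "frechet_derivative f (at (x, y)) (h, 0) = h *\<^sub>R pX f (x, y)" for h
    using linear_scale[OF l, of "(x, y)" h "(1, 0)"] by (simp add: partial_deriv_def)
  ultimately show "((\<lambda>x. f (x, y)) has_vector_derivative pX f (x, y)) (at x within S)"
    by (simp add: has_vector_derivative_def has_derivative_at_withinI)
  have "((\<lambda>y. (x, y)) has_derivative (\<lambda>h. (0, h))) (at y)" by (auto intro!: derivative_eq_intros)
  from has_derivative_compose[OF this d]
  have "((\<lambda>y. f (x, y)) has_derivative (\<lambda>h. frechet_derivative f (at (x, y)) (0, h))) (at y)" .
  moreover have "frechet_derivative f (at (x, y)) (0, h) = h *\<^sub>R pY f (x, y)" for h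
    using linear_scale[OF l, of "(x, y)" h "(0, 1)"] by (simp add: partial_deriv_def)
  ultimately show "((\<lambda>y. f (x, y)) has_vector_derivative pY f (x, y)) (at y within T)"
    by (simp add: has_vector_derivative_def has_derivative_at_withinI)
qed

lemma partial_deriv_1_eq:
  "(f has_vector_derivative d) (at x) \<Longrightarrow> partial_deriv (1::real) f x = d"
  unfolding has_vector_derivative_def by (drule partial_deriv_eq[where b = 1]) simp

lemma sections_partial:
  assumes "smooth f"
  shows "partial_deriv 1 (\<lambda>x. f (x, y)) = (\<lambda>x. pX f (x, y))" "partial_deriv 1 (\<lambda>y. f (x, y)) = (\<lambda>y. pY f (x, y))"
  using partial_deriv_1_eq[OF sections_has_vector_derivative(1)[OF assms]]
    partial_deriv_1_eq[OF sections_has_vector_derivative(2)[OF assms]] by blast+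

text \<open>A family of functions closed under differentiation consists of smooth functions. The
  index records how the derivatives arise; the instances are slices, partial integrals and rescaled
  functions.\<close>

lemma smooth_vector_derivI:
  fixes F :: "'i \<Rightarrow> real \<Rightarrow> complex"
  assumes P: "\<And>i. P i \<Longrightarrow> P (s i)" and F: "\<And>i x. P i \<Longrightarrow> (F i has_vector_derivative F (s i) x) (at x)" and i: "P i"
  shows "smooth (F i)"
  unfolding smooth_def
proof
  show "Ck k (F i)" for k
    using i
  proof (induction k arbitrary: i)
    case 0
    have "isCont (F i) x" for x by (rule has_vector_derivative_continuous[OF F[OF 0]])
    then show ?case by (simp add: continuous_at_imp_continuous_on)
  next
    case (Suc k)
    show ?case
    proof (rule Ck_SucI)
      show "(F i has_derivative (\<lambda>h. h *\<^sub>R F (s i) x)) (at x)" for x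
        using F[OF Suc.prems] by (simp add: has_vector_derivative_def)
      show "Ck k (\<lambda>x. b *\<^sub>R F (s i) x)" if "b \<in> Basis" for b :: real
        using Suc.IH[OF P[OF Suc.prems]] that by simp
    qed
  qed
qed

lemma smooth_sections:
  fixes f :: "real \<times> real \<Rightarrow> complex"
  assumes f: "smooth f" shows "smooth (\<lambda>x. f (x, y))" "smooth (\<lambda>y. f (x, y))"
proof -
  show "smooth (\<lambda>x. f (x, y))"
    by (rule smooth_vector_derivI[of smooth pX "\<lambda>g x. g (x, y)", OF _ _ f])
       (use smooth_partial Basis_XY sections_has_vector_derivative(1) in blast)+
  show "smooth (\<lambda>y. f (x, y))"
    by (rule smooth_vector_derivI[of smooth pY "\<lambda>g y. g (x, y)", OF _ _ f])
       (use smooth_partial Basis_XY sections_has_vector_derivative(2) in blast)+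
qed

lemma test_sections:
  fixes f :: "real \<times> real \<Rightarrow> complex"
  assumes "f \<in> test_functions (A \<times> B)"
  shows "(\<lambda>x. f (x, y)) \<in> test_functions A" "(\<lambda>y. f (x, y)) \<in> test_functions B"
proof -
  obtain K where K: "smooth f" "compact K" "K \<subseteq> A \<times> B" "\<forall>p. p \<notin> K \<longrightarrow> f p = 0"
    using assms unfolding test_functions_iff by blast
  have "compact (fst ` K)" "compact (snd ` K)"
    using K(2) by (auto intro!: compact_continuous_image continuous_intros)
  moreover have "fst ` K \<subseteq> A" "snd ` K \<subseteq> B" using K(3) by auto
  moreover have "\<forall>x. x \<notin> fst ` K \<longrightarrow> f (x, y) = 0" "\<forall>y. y \<notin> snd ` K \<longrightarrow> f (x, y) = 0" using K(4) by force+
  ultimately show "(\<lambda>x. f (x, y)) \<in> test_functions A" "(\<lambda>y. f (x, y)) \<in> test_functions B"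
    unfolding test_functions_iff using smooth_sections[OF K(1)] by blast+
qed

lemma smooth_continuous: "smooth f \<Longrightarrow> continuous_on S f"
  using Ck_continuous[OF smooth_Ck] continuous_on_subset by blast

text \<open>Schwarz' theorem, by differentiating \<open>f(x,y) = f(x,a) + \<integral>\<^bsub>a\<^esub>\<^sup>y f\<^sub>y(x,t) dt\<close> under the integral sign.\<close>

lemma mixed_partials:
  assumes f: "smooth f" shows "pX (pY f) = pY (pX f)"
proof
  fix p :: "real \<times> real"
  obtain x y where p: "p = (x, y)" by (cases p)
  note sY = smooth_partial[OF f Basis_XY(2)] and sX = smooth_partial[OF f Basis_XY(1)]
  note sXY = smooth_partial[OF sY Basis_XY(1)]
  \<comment> \<open>Any base point below \<open>y\<close> serves; it makes \<open>y\<close> an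
    interior point of \<open>{a..y + 1}\<close>.\<close>
  define a where "a = y - 1"
  have FTC: "f (z, t) = f (z, a) + integral (cbox a t) (\<lambda>r. pY f (z, r))" if "a \<le> t" for z t
  proof -
    have "((\<lambda>r. pY f (z, r)) has_integral f (z, t) - f (z, a)) {a..t}"
      by (rule fundamental_theorem_of_calculus[OF that]) (rule sections_has_vector_derivative(2)[OF f])
    then show ?thesis by (simp add: integral_unique)
  qed
  have cont: "continuous_on S (\<lambda>r. g (z, r))" if "smooth g" for S z and g :: "real \<times> real \<Rightarrow> complex"
    using smooth_continuous[OF smooth_sections(2)[OF that]] .
  have dX: "pX f (x, t) = pX f (x, a) + integral (cbox a t) (\<lambda>r. pX (pY f) (x, r))" if t: "a \<le> t" for t
  proof -
    have "((\<lambda>z. integral (cbox a t) (\<lambda>r. pY f (z, r))) has_vector_derivative integral (cbox a t) (\<lambda>r. pX (pY f) (x, r))) (at x within UNIV)"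
    proof (rule leibniz_rule_vector_derivative)
      show "continuous_on (UNIV \<times> cbox a t) (\<lambda>(z, r). pX (pY f) (z, r))"
        using smooth_continuous[OF sXY] by (simp add: split_beta')
    qed (use sections_has_vector_derivative(1)[OF sY] cont[OF sY] in \<open>auto intro: integrable_continuous_interval\<close>)
    then have "((\<lambda>z. f (z, a) + integral (cbox a t) (\<lambda>r. pY f (z, r))) has_vector_derivative
        pX f (x, a) + integral (cbox a t) (\<lambda>r. pX (pY f) (x, r))) (at x)"
      by (intro has_vector_derivative_add sections_has_vector_derivative(1)[OF f]) simp
    then have "((\<lambda>z. f (z, t)) has_vector_derivative pX f (x, a) + integral (cbox a t) (\<lambda>r. pX (pY f) (x, r))) (at x)"
      unfolding FTC[OF t, symmetric] .
    then show ?thesis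
      by (rule vector_derivative_unique_at[OF sections_has_vector_derivative(1)[OF f]])
  qed
  have "((\<lambda>t. integral {a..t} (\<lambda>r. pX (pY f) (x, r))) has_vector_derivative pX (pY f) (x, y)) (at y within {a..y + 1})"
    by (rule integral_has_vector_derivative[OF cont[OF sXY]]) (simp add: a_def)
  then have I: "((\<lambda>t. pX f (x, a) + integral (cbox a t) (\<lambda>r. pX (pY f) (x, r))) has_vector_derivative pX (pY f) (x, y)) (at y within {a..y + 1})"
    by (auto intro!: derivative_eq_intros)
  have "((\<lambda>t. pX f (x, t)) has_vector_derivative pX (pY f) (x, y)) (at y within {a..y + 1})"
  proof (rule has_vector_derivative_transform[OF _ _ I])
    show "y \<in> {a..y + 1}" by (simp add: a_def)
    show "pX f (x, t) = pX f (x, a) + integral (cbox a t) (\<lambda>r. pX (pY f) (x, r))" if "t \<in> {a..y + 1}" for t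
      by (rule dX) (use that in simp)
  qed
  moreover have "at y within {a..y + 1} = at y" by (rule at_within_interior) (simp add: a_def)
  ultimately have "((\<lambda>t. pX f (x, t)) has_vector_derivative pX (pY f) (x, y)) (at y)" by simp
  then show "pX (pY f) p = pY (pX f) p"
    unfolding p by (rule vector_derivative_unique_at[OF _ sections_has_vector_derivative(2)[OF sX]])
qed

section \<open>Square integrals and Fubini's theorem\<close>

definition nsq :: "('a::euclidean_space \<Rightarrow> complex) \<Rightarrow> real" where
  "nsq f = (LINT x|lborel. (cmod (f x))\<^sup>2)"

lemma nsq_L2: "nsq f = Re (L2_inner UNIV f f)"
  by (simp add: nsq_def L2_inner_self set_lebesgue_integral_def)

lemma nsq_nonneg: "0 \<le> nsq f" by (simp add: nsq_def)

text \<open>Continuity and compact support provide the integrability for Fubini's theorem, and both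
  pass easily to products of test functions with a cotangent.\<close>

definition csupp :: "'a::euclidean_space set \<Rightarrow> ('a \<Rightarrow> complex) \<Rightarrow> bool" where
  "csupp U f \<longleftrightarrow> continuous_on UNIV f \<and> (\<exists>K. compact K \<and> K \<subseteq> U \<and> (\<forall>x. x \<notin> K \<longrightarrow> f x = 0))"

lemma csupp_test: "f \<in> test_functions U \<Longrightarrow> csupp U f"
  unfolding csupp_def using test_continuous by (auto simp: test_functions_iff)

lemma csupp_sq_integrable: "csupp U f \<Longrightarrow> integrable lborel (\<lambda>x. (cmod (f x))\<^sup>2)"
  unfolding csupp_def by (elim conjE exE, rule compact_support_integrable) (auto intro: continuous_intros)

lemma csupp_L2: assumes "csupp U f" shows "f \<in> L2 UNIV"
  using csupp_sq_integrable[OF assms] assms borel_measurable_continuous_onI[of f]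
  by (auto simp: L2_iff csupp_def measurable_lborel1)

lemma csupp_add: assumes "csupp U f" "csupp U g" shows "csupp U (\<lambda>x. f x + g x)"
proof -
  obtain K L where "compact K" "K \<subseteq> U" "\<forall>x. x \<notin> K \<longrightarrow> f x = 0" "compact L" "L \<subseteq> U" "\<forall>x. x \<notin> L \<longrightarrow> g x = 0"
    using assms unfolding csupp_def by blast
  then show ?thesis using assms unfolding csupp_def
    by (intro conjI exI[of _ "K \<union> L"] compact_Un continuous_intros) auto
qed

text \<open>The factor \<open>c\<close> may blow up at the boundary of \<open>U\<close>: near every
  point outside \<open>K\<close> the product is identically 0.\<close>

lemma csupp_mult:
  assumes f: "csupp U f" and c: "continuous_on U c" and U: "open U" shows "csupp U (\<lambda>x. c x * f x)"
proof -
  obtain K where K: "compact K" "K \<subseteq> U" "\<forall>x. x \<notin> K \<longrightarrow> f x = 0" using f unfolding csupp_def by blast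
  have "continuous_on (U \<union> - K) (\<lambda>x. c x * f x)"
  proof (rule continuous_on_open_Un[OF U open_Compl[OF compact_imp_closed[OF K(1)]]])
    show "continuous_on U (\<lambda>x. c x * f x)"
      using f c continuous_on_subset[of UNIV f U] by (auto simp: csupp_def intro: continuous_intros)
    show "continuous_on (- K) (\<lambda>x. c x * f x)"
      by (rule continuous_on_eq[OF continuous_on_const[of _ 0]]) (use K in auto)
  qed
  moreover have "U \<union> - K = UNIV" using K by auto
  ultimately show ?thesis using K unfolding csupp_def by auto
qed

lemma fubini:
  fixes G :: "real \<times> real \<Rightarrow> 'b::{banach, second_countable_topology}"
  assumes "integrable lborel G"
  shows "(LINT x|lborel. LINT y|lborel. G (x, y)) = (LINT p|lborel. G p)"
    "(LINT y|lborel. LINT x|lborel. G (x, y)) = (LINT p|lborel. G p)"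
    "integrable lborel (\<lambda>x. LINT y|lborel. G (x, y))" "integrable lborel (\<lambda>y. LINT x|lborel. G (x, y))"
proof -
  have i: "integrable (lborel \<Otimes>\<^sub>M lborel) G" using assms by (simp add: lborel_prod)
  then have i': "integrable (lborel \<Otimes>\<^sub>M lborel) (case_prod (\<lambda>x y. G (x, y)))" by (simp add: case_prod_eta)
  show "(LINT x|lborel. LINT y|lborel. G (x, y)) = (LINT p|lborel. G p)"
    using lborel_pair.integral_fst'[OF i] by (simp add: lborel_prod)
  show "(LINT y|lborel. LINT x|lborel. G (x, y)) = (LINT p|lborel. G p)"
    using lborel_pair.integral_snd[OF i'] by (simp add: lborel_prod case_prod_eta)
  show "integrable lborel (\<lambda>x. LINT y|lborel. G (x, y))" by (rule lborel_pair.integrable_fst'[OF i])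
  show "integrable lborel (\<lambda>y. LINT x|lborel. G (x, y))" by (rule lborel_pair.integrable_snd[OF i'])
qed

lemma fubini_nsq:
  fixes G :: "real \<times> real \<Rightarrow> complex"
  assumes "integrable lborel (\<lambda>p. (cmod (G p))\<^sup>2)"
  shows "(LINT x|lborel. nsq (\<lambda>y. G (x, y))) = nsq G" "(LINT y|lborel. nsq (\<lambda>x. G (x, y))) = nsq G"
    "integrable lborel (\<lambda>x. nsq (\<lambda>y. G (x, y)))" "integrable lborel (\<lambda>y. nsq (\<lambda>x. G (x, y)))"
  using fubini[OF assms] by (simp_all add: nsq_def)

section \<open>The one-dimensional Poincare inequality with remainder\<close>

lemma compact_subset_Ioo:
  assumes "compact K" "K \<subseteq> {0<..<L::real}" "L > 0"
  obtains a b where "0 < a" "a < b" "b < L" "K \<subseteq> {a<..<b}"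
proof (cases "K = {}")
  case True
  then show thesis using that[of "L/3" "L/2"] assms(3) by auto
next
  case False
  obtain i s where "i \<in> K" "\<forall>x\<in>K. i \<le> x" "s \<in> K" "\<forall>x\<in>K. x \<le> s"
    using compact_attains_inf[OF assms(1) False] compact_attains_sup[OF assms(1) False] by blast
  then show thesis using that[of "i / 2" "(s + L) / 2"] assms(2) by fastforce
qed

text \<open>Since \<open>(k cot kx)' = - k\<^sup>2 - (k cot kx)\<^sup>2\<close>, the difference of the two integrands is a derivative.\<close>

lemma poincare_identity:
  fixes u :: "real \<Rightarrow> complex"
  assumes u: "u \<in> test_functions {0<..<L}" and L: "L > 0"
  defines "k \<equiv> pi / L"
  shows "nsq (\<lambda>x. partial_deriv 1 u x - of_real (k * cot (k * x)) * u x) = nsq (partial_deriv 1 u) - k\<^sup>2 * nsq u"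
proof -
  let ?d = "partial_deriv 1 u"
  let ?c = "\<lambda>x. k * cot (k * x)"
  have d: "?d \<in> test_functions {0<..<L}" by (rule test_partial[OF u]) simp
  have k: "k > 0" using L by (simp add: k_def)
  obtain K where K: "compact K" "K \<subseteq> {0<..<L}" "\<forall>x. x \<notin> K \<longrightarrow> u x = 0" using u unfolding test_functions_iff by blast
  have dK: "?d x = 0" if "x \<notin> K" for x
    by (rule partial_deriv_zero_outside[OF compact_imp_closed[OF K(1)] K(3) that])
  \<comment> \<open>The cotangent is singular at 0 and \<open>L\<close>, so the integration is
    confined to an interval \<open>{a..b}\<close> whose interior contains the support; the boundary
    terms of \<open>w\<close> vanish at its ends.\<close>
  obtain a b where ab: "0 < a" "a < b" "b < L" "K \<subseteq> {a<..<b}" using compact_subset_Ioo[OF K(1,2) L] by blast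
  have s: "sin (k * x) \<noteq> 0" if "x \<in> {a..b}" for x
  proof -
    have "0 < k * x" "k * x < pi" using that ab k L by (auto simp: k_def field_simps)
    then show ?thesis using sin_gt_zero by fastforce
  qed
  define w where "w x = ?c x * (u x \<bullet> u x)" for x
  define w' where "w' x = ?c x * (2 * (u x \<bullet> ?d x)) - (k\<^sup>2 / (sin (k * x))\<^sup>2) * (u x \<bullet> u x)" for x
  have uv: "(u has_vector_derivative ?d x) (at x within S)" for x S
    using has_vector_derivative_partial[OF test_smooth[OF u]] has_vector_derivative_at_within by blast
  have wd: "(w has_vector_derivative w' x) (at x within {a..b})" if "x \<in> {a..b}" for x
  proof -
    have 1: "((\<lambda>x. u x \<bullet> u x) has_real_derivative 2 * (u x \<bullet> ?d x)) (at x within {a..b})"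
    proof -
      have "((\<lambda>x. u x \<bullet> u x) has_derivative (\<lambda>h. u x \<bullet> (h *\<^sub>R ?d x) + (h *\<^sub>R ?d x) \<bullet> u x)) (at x within {a..b})"
        using uv[of x "{a..b}"] unfolding has_vector_derivative_def by (rule has_derivative_inner[rotated])
           (use uv[of x "{a..b}"] in \<open>simp add: has_vector_derivative_def\<close>)
      then show ?thesis
        by (rule has_derivative_imp_has_field_derivative) (simp add: inner_commute algebra_simps)
    qed
    have 2: "(?c has_real_derivative - (k\<^sup>2 / (sin (k * x))\<^sup>2)) (at x within {a..b})"
    proof -
      have "((\<lambda>x. k * x) has_real_derivative k) (at x within {a..b})" by (auto intro!: derivative_eq_intros)
      from DERIV_cmult[OF DERIV_chain2[OF DERIV_cot[OF s[OF that]] this], of k]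
      show ?thesis by (rule DERIV_cong) (simp add: power2_eq_square divide_inverse)
    qed
    show ?thesis
      unfolding w_def[abs_def] has_real_derivative_iff_has_vector_derivative[symmetric]
      by (rule DERIV_cong[OF DERIV_mult[OF 2 1]]) (simp add: w'_def algebra_simps)
  qed
  have uc: "continuous_on S u" "continuous_on S ?d" for S
    using test_continuous[OF u] test_continuous[OF d] continuous_on_subset by blast+
  have w'c: "continuous_on {a..b} w'"
    unfolding w'_def[abs_def] cot_def by (intro continuous_intros uc) (use s in auto)
  have w'i: "integrable lborel (\<lambda>x. indicator {a..b} x *\<^sub>R w' x)"
    by (rule borel_integrable_compact[OF _ w'c]) simp
  have "(LINT x|lborel. indicator {a..b} x *\<^sub>R w' x) = w b - w a"
    by (rule integral_FTC_Icc[OF less_imp_le[OF ab(2)] wd w'c]) auto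
  also have "\<dots> = 0"
  proof -
    have "a \<notin> K" "b \<notin> K" using ab(4) by auto
    then show ?thesis using K(3) by (simp add: w_def)
  qed
  finally have w0: "(LINT x|lborel. indicator {a..b} x *\<^sub>R w' x) = 0" .
  have pt: "(cmod (?d x - of_real (?c x) * u x))\<^sup>2 = (cmod (?d x))\<^sup>2 - k\<^sup>2 * (cmod (u x))\<^sup>2 - indicator {a..b} x *\<^sub>R w' x" for x
  proof (cases "x \<in> {a..b}")
    case True
    have "k\<^sup>2 * (cos (k * x))\<^sup>2 + k\<^sup>2 * (sin (k * x))\<^sup>2 = k\<^sup>2"
      unfolding distrib_left[symmetric] by simp
    then have c2: "k\<^sup>2 / (sin (k * x))\<^sup>2 = ?c x ^ 2 + k\<^sup>2"
      using s[OF True] by (simp add: cot_def power_mult_distrib power_divide field_simps)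
    have "(cmod (?d x - of_real (?c x) * u x))\<^sup>2 = (?d x - ?c x *\<^sub>R u x) \<bullet> (?d x - ?c x *\<^sub>R u x)"
      by (simp add: power2_norm_eq_inner scaleR_conv_of_real)
    also have "\<dots> = ?d x \<bullet> ?d x - 2 * ?c x * (u x \<bullet> ?d x) + ?c x ^ 2 * (u x \<bullet> u x)"
      by (simp add: inner_diff_left inner_diff_right inner_commute power2_eq_square algebra_simps)
    also have "\<dots> = ?d x \<bullet> ?d x - k\<^sup>2 * (u x \<bullet> u x) - w' x"
      unfolding w'_def c2 by (simp add: algebra_simps)
    finally show ?thesis using True by (simp add: power2_norm_eq_inner)
  next
    case False
    then have "x \<notin> K" using ab(4) by auto
    then show ?thesis using K(3) dK False by simp
  qed
  have i: "integrable lborel (\<lambda>x. (cmod (?d x))\<^sup>2)" "integrable lborel (\<lambda>x. k\<^sup>2 * (cmod (u x))\<^sup>2)"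
    using csupp_sq_integrable[OF csupp_test[OF d]] csupp_sq_integrable[OF csupp_test[OF u]] by auto
  show ?thesis
    unfolding nsq_def pt
    using Bochner_Integration.integral_diff[OF Bochner_Integration.integrable_diff[OF i] w'i]
      Bochner_Integration.integral_diff[OF i] w0 by simp
qed

lemma poincare_inequality:
  assumes "u \<in> test_functions {0<..<L::real}" "L > 0"
  shows "(pi / L)\<^sup>2 * nsq u \<le> nsq (partial_deriv 1 u)"
  using poincare_identity[OF assms] nsq_nonneg[of "\<lambda>x. partial_deriv 1 u x - of_real (pi / L * cot (pi / L * x)) * u x"] by simp

section \<open>The form of the biharmonic operator on test functions\<close>

lemma open_rect: "open (rect h)" by (simp add: rect_def open_Times)

lemma test_rect_sections:
  assumes "f \<in> test_functions (rect h)"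
  shows "(\<lambda>x. f (x, y)) \<in> test_functions {0<..<h}" "(\<lambda>y. f (x, y)) \<in> test_functions {0<..<1}"
  using test_sections[of f "{0<..<h}" "{0<..<1}"] assms by (auto simp: rect_def)

lemma test_XY:
  assumes "f \<in> test_functions U" shows "pX f \<in> test_functions U" "pY f \<in> test_functions U"
  using test_partial[OF assms] Basis_XY by auto

text \<open>\<open>poincare_identity\<close> on each horizontal slice, integrated over
  \<open>y\<close>. As the coefficient depends on \<open>x\<close> alone, \<open>D\<close> commutes
  with differentiation in \<open>y\<close>.\<close>

lemma nsq_cot_derivative:
  assumes h: "h > 0" and g: "g \<in> test_functions (rect h)"
  defines "k \<equiv> pi / h"
  defines "D \<equiv> \<lambda>(x, y). pX g (x, y) - of_real (k * cot (k * x)) * g (x, y)"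
  shows "csupp (rect h) D" "nsq D = nsq (pX g) - k\<^sup>2 * nsq g"
proof -
  have "csupp (rect h) (\<lambda>p. (- of_real (k * cot (k * fst p))) * g p)"
  proof (rule csupp_mult[OF csupp_test[OF g] _ open_rect])
    have "sin (k * fst p) \<noteq> 0" if "p \<in> rect h" for p
    proof -
      have "0 < k * fst p" "k * fst p < pi" using that h by (auto simp: rect_def k_def field_simps)
      then show ?thesis using sin_gt_zero by fastforce
    qed
    then show "continuous_on (rect h) (\<lambda>p. - complex_of_real (k * cot (k * fst p)))"
      unfolding cot_def by (intro continuous_intros) auto
  qed
  from csupp_add[OF csupp_test[OF test_XY(1)[OF g]] this]
  show c: "csupp (rect h) D" by (simp add: D_def split_beta')
  note i = csupp_sq_integrable[OF c] csupp_sq_integrable[OF csupp_test[OF g]]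
    csupp_sq_integrable[OF csupp_test[OF test_XY(1)[OF g]]]
  have "nsq (\<lambda>x. D (x, y)) = nsq (\<lambda>x. pX g (x, y)) - k\<^sup>2 * nsq (\<lambda>x. g (x, y))" for y
    using poincare_identity[OF test_rect_sections(1)[OF g] h, of y]
    unfolding sections_partial(1)[OF test_smooth[OF g]] by (simp add: D_def k_def)
  then have "nsq D = (LINT y|lborel. nsq (\<lambda>x. pX g (x, y)) - k\<^sup>2 * nsq (\<lambda>x. g (x, y)))"
    using fubini_nsq(2)[OF i(1)] by simp
  also have "\<dots> = nsq (pX g) - k\<^sup>2 * nsq g"
    using fubini_nsq(2,4)[OF i(2)] fubini_nsq(2,4)[OF i(3)] by simp
  finally show "nsq D = nsq (pX g) - k\<^sup>2 * nsq g" .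
qed

text \<open>The tensor product of the two non-negative operators \<open>-\<partial>\<^sub>x\<^sup>2 - \<pi>\<^sup>2/h\<^sup>2\<close> and \<open>-\<partial>\<^sub>y\<^sup>2 - \<pi>\<^sup>2\<close> is non-negative.\<close>

lemma mixed_derivative_lower_bound:
  assumes h: "h > 0" and f: "f \<in> test_functions (rect h)"
  shows "pi\<^sup>2 * nsq (pX f) + (pi / h)\<^sup>2 * nsq (pY f) - pi\<^sup>2 * (pi / h)\<^sup>2 * nsq f \<le> nsq (pX (pY f))"
proof -
  define k where "k = pi / h"
  define D where "D g = (\<lambda>(x, y). pX g (x, y) - of_real (k * cot (k * x)) * g (x, y))" for g
  note T = test_XY[OF f]
  note Df = nsq_cot_derivative[OF h f, folded k_def, folded D_def]
  note DY = nsq_cot_derivative[OF h T(2), folded k_def, folded D_def]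
  \<comment> \<open>Poincare's inequality on the vertical slices of \<open>D f\<close>, whose
    derivative in \<open>y\<close> is \<open>D (pY f)\<close>. After integration, expanding both
    square norms by \<open>nsq_cot_derivative\<close> gives the claim.\<close>
  have "pi\<^sup>2 * nsq (\<lambda>y. D f (x, y)) \<le> nsq (\<lambda>y. D (pY f) (x, y))" for x
  proof -
    let ?c = "- complex_of_real (k * cot (k * x))"
    note sec = test_rect_sections(2)[OF T(1), of x] test_rect_sections(2)[OF f, of x]
    have t: "(\<lambda>y. pX f (x, y) + ?c * f (x, y)) \<in> test_functions {0<..<1}"
      by (rule test_add[OF sec(1) test_scale[OF sec(2)]])
    have "partial_deriv 1 (\<lambda>y. pX f (x, y) + ?c * f (x, y)) =
        (\<lambda>y. partial_deriv 1 (\<lambda>y. pX f (x, y)) y + ?c * partial_deriv 1 (\<lambda>y. f (x, y)) y)"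
      unfolding partial_deriv_add[OF smooth_Ck[OF test_smooth[OF sec(1)]] smooth_Ck[OF test_smooth[OF test_scale[OF sec(2)]]]]
        partial_deriv_scale[OF smooth_Ck[OF test_smooth[OF sec(2)]]] ..
    also have "\<dots> = (\<lambda>y. D (pY f) (x, y))"
      unfolding sections_partial(2)[OF test_smooth[OF T(1)]] sections_partial(2)[OF test_smooth[OF f]]
        mixed_partials[OF test_smooth[OF f], symmetric] by (simp add: D_def)
    finally have e: "partial_deriv 1 (\<lambda>y. pX f (x, y) + ?c * f (x, y)) = (\<lambda>y. D (pY f) (x, y))" .
    have "(\<lambda>y. pX f (x, y) + ?c * f (x, y)) = (\<lambda>y. D f (x, y))" by (simp add: D_def)
    then show ?thesis using poincare_inequality[OF t] e by simp
  qed
  then have "(LINT x|lborel. pi\<^sup>2 * nsq (\<lambda>y. D f (x, y))) \<le> (LINT x|lborel. nsq (\<lambda>y. D (pY f) (x, y)))"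
    using fubini_nsq(3)[OF csupp_sq_integrable[OF Df(1)]] fubini_nsq(3)[OF csupp_sq_integrable[OF DY(1)]]
    by (intro integral_mono integrable_mult_right) auto
  then have "pi\<^sup>2 * nsq (D f) \<le> nsq (D (pY f))"
    using fubini_nsq(1)[OF csupp_sq_integrable[OF Df(1)]] fubini_nsq(1)[OF csupp_sq_integrable[OF DY(1)]] by simp
  then show ?thesis unfolding Df(2) DY(2) by (simp add: k_def algebra_simps)
qed

lemma smooth_cnj:
  assumes "smooth f" shows "smooth (\<lambda>x. cnj (f x))" "partial_deriv b (\<lambda>x. cnj (f x)) = (\<lambda>x. cnj (partial_deriv b f x))"
proof -
  have d: "((\<lambda>x. cnj (g x)) has_derivative (\<lambda>h. cnj (frechet_derivative g (at x) h))) (at x)" if "Ck (Suc k) g" for g :: "'a \<Rightarrow> complex" and x k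
    by (rule bounded_linear.has_derivative[OF bounded_linear_cnj Ck_has_derivative[OF that]])
  have "Ck k g \<Longrightarrow> Ck k (\<lambda>x. cnj (g x))" for k and g :: "'a \<Rightarrow> complex"
  proof (induction k arbitrary: g)
    case (Suc k)
    show ?case
    proof (rule Ck_SucI[OF d[OF Suc.prems]])
      show "Ck k (\<lambda>x. cnj (frechet_derivative g (at x) b))" if "b \<in> Basis" for b
        using Suc.IH[OF Ck_partial[OF Suc.prems that]] by (simp add: partial_deriv_def)
    qed
  qed (auto intro: continuous_intros)
  then show "smooth (\<lambda>x. cnj (f x))" using assms by (simp add: smooth_def)
  show "partial_deriv b (\<lambda>x. cnj (f x)) = (\<lambda>x. cnj (partial_deriv b f x))"
    using partial_deriv_eq[OF d[OF smooth_Ck[OF assms, of "Suc 0"]], of b] by (auto simp: partial_deriv_def[of b f])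
qed

lemma test_cnj: "f \<in> test_functions U \<Longrightarrow> (\<lambda>x. cnj (f x)) \<in> test_functions U"
  unfolding test_functions_iff using smooth_cnj(1) by auto

text \<open>Two integrations by parts, one in each variable, turn the inner product of
  \<open>pX (pX f)\<close> and \<open>pY (pY f)\<close> into the square norm of the mixed
  derivative.\<close>

lemma nsq_laplacian:
  assumes f: "f \<in> test_functions U"
  shows "nsq (\<lambda>p. pX (pX f) p + pY (pY f) p) = nsq (pX (pX f)) + 2 * nsq (pX (pY f)) + nsq (pY (pY f))"
proof -
  note T = test_XY[OF f]
  note TX = test_XY[OF T(1)] and TY = test_XY[OF T(2)]
  have c: "(\<lambda>p. cnj (pY f p)) \<in> test_functions U" "(\<lambda>p. cnj (pY (pY f) p)) \<in> test_functions U"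
    by (rule test_cnj[OF T(2)] test_cnj[OF TY(2)])+
  have m: "pX (\<lambda>p. cnj (pY (pY f) p)) = pY (\<lambda>p. cnj (pX (pY f) p))"
    using mixed_partials[OF test_smooth[OF c(1)]]
    by (simp add: smooth_cnj(2)[OF test_smooth[OF T(2)]] smooth_cnj(2)[OF test_smooth[OF TY(2)]] smooth_cnj(2)[OF test_smooth[OF TY(1)]])
  have "(LINT p|lborel. pX (pX f) p * cnj (pY (pY f) p)) = - (LINT p|lborel. pX f p * pX (\<lambda>p. cnj (pY (pY f) p)) p)"
    using test_parts[OF T(1) c(2) Basis_XY(1)] by simp
  also have "\<dots> = - (LINT p|lborel. pX f p * pY (\<lambda>p. cnj (pX (pY f) p)) p)" unfolding m ..
  also have "\<dots> = (LINT p|lborel. pY (pX f) p * cnj (pX (pY f) p))"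
    using test_parts[OF T(1) test_cnj[OF TY(1)] Basis_XY(2)] by simp
  also have "\<dots> = L2_inner UNIV (pX (pY f)) (pX (pY f))"
    unfolding mixed_partials[OF test_smooth[OF f], symmetric] by (simp add: L2_inner_def set_lebesgue_integral_def)
  finally have "L2_inner UNIV (pX (pX f)) (pY (pY f)) = L2_inner UNIV (pX (pY f)) (pX (pY f))"
    by (simp add: L2_inner_def set_lebesgue_integral_def)
  then show ?thesis
    using L2.self_add[OF csupp_L2[OF csupp_test[OF TX(1)]] csupp_L2[OF csupp_test[OF TY(2)]]] by (simp add: nsq_L2)
qed

section \<open>Partial integration against a function of one variable\<close>

text \<open>The partial inner product in the second variable: for a unit vector
  \<open>\<psi>\<close>, the component of \<open>G\<close> along \<open>\<psi>\<close> is
  \<open>gint \<psi> G x * \<psi> y\<close>.\<close>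

definition gint :: "(real \<Rightarrow> complex) \<Rightarrow> (real \<times> real \<Rightarrow> complex) \<Rightarrow> real \<Rightarrow> complex" where
  "gint \<psi> G x = (LINT y|lborel. G (x, y) * cnj (\<psi> y))"

locale weight =
  fixes \<psi> :: "real \<Rightarrow> complex"
  assumes L2: "\<psi> \<in> L2 UNIV" and outside: "\<And>y. y \<notin> {0<..<1} \<Longrightarrow> \<psi> y = 0"
    and unit: "\<psi> = (\<lambda>y. 0) \<or> nsq \<psi> = 1"
begin

lemma integrable: "integrable lborel \<psi>"
proof -
  have e: "indicator {0<..<1} y *\<^sub>R \<psi> y = \<psi> y" for y using outside by (auto simp: indicator_def)
  have "\<psi> \<in> L2 {0<..<1}" using L2 by (simp add: L2_iff e)
  then have "set_integrable lborel {0<..<1} \<psi>" by (intro L2_imp_integrable) auto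
  then show ?thesis by (simp add: set_integrable_def e)
qed

lemma mult_integrable:
  assumes "g \<in> borel_measurable borel" "\<And>y. cmod (g y) \<le> M"
  shows "Bochner_Integration.integrable lborel (\<lambda>y. g y * cnj (\<psi> y))"
proof (rule Bochner_Integration.integrable_bound)
  show "Bochner_Integration.integrable lborel (\<lambda>y. M * cmod (\<psi> y))" using integrable by (intro integrable_mult_right integrable_norm)
  have [measurable]: "\<psi> \<in> borel_measurable lborel" using integrable by simp
  have [measurable]: "(\<lambda>y. cnj (\<psi> y)) \<in> borel_measurable lborel"
    using L2_cnj[OF L2] by (simp add: L2_iff)
  have [measurable]: "g \<in> borel_measurable lborel" using assms(1) by (simp add: measurable_lborel1)
  show "(\<lambda>y. g y * cnj (\<psi> y)) \<in> borel_measurable lborel" by measurable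
  have "0 \<le> M" using assms(2)[of 0] norm_ge_zero order_trans by blast
  then show "AE y in lborel. norm (g y * cnj (\<psi> y)) \<le> norm (M * cmod (\<psi> y))"
    using assms(2) by (intro AE_I2) (simp add: norm_mult mult_right_mono)
qed

lemma section_integrable:
  fixes G :: "real \<times> real \<Rightarrow> complex"
  assumes "G \<in> test_functions U"
  shows "Bochner_Integration.integrable lborel (\<lambda>y. G (x, y) * cnj (\<psi> y))"
proof -
  obtain M where "\<And>p. cmod (G p) \<le> M" using test_bounded[OF assms] by blast
  moreover have "(\<lambda>y. G (x, y)) \<in> borel_measurable borel"
    by (rule borel_measurable_continuous_onI[OF smooth_continuous[OF smooth_sections(2)[OF test_smooth[OF assms]]]])
  ultimately show ?thesis by (intro mult_integrable) auto
qed

text \<open>Differentiation under the integral by dominated convergence: the difference quotients of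
  \<open>G\<close> are bounded by \<open>M\<close>, and \<open>\<psi>\<close> is integrable because
  it is square integrable and lives on a bounded interval.\<close>

lemma gint_has_vector_derivative:
  assumes G: "G \<in> test_functions U"
  shows "(gint \<psi> G has_vector_derivative gint \<psi> (pX G) x) (at x)"
  unfolding has_vector_derivative_quotient tendsto_at_iff_sequentially
proof (intro allI impI)
  fix s :: "nat \<Rightarrow> real" assume s: "\<forall>i. s i \<in> UNIV - {0}" "s \<longlonglongrightarrow> 0"
  obtain M where M: "M \<ge> 0" "\<And>p. cmod (pX G p) \<le> M" using test_bounded[OF test_XY(1)[OF G]] by blast
  have e: "(gint \<psi> G (x + r) - gint \<psi> G x) /\<^sub>R r = (LINT y|lborel. ((G (x + r, y) - G (x, y)) /\<^sub>R r) * cnj (\<psi> y))" for r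
    unfolding gint_def
    by (subst Bochner_Integration.integral_diff[symmetric, OF section_integrable[OF G] section_integrable[OF G]],
        subst Bochner_Integration.integral_scaleR_right[symmetric]) (simp add: left_diff_distrib)
  have lim: "(\<lambda>n. LINT y|lborel. ((G (x + s n, y) - G (x, y)) /\<^sub>R s n) * cnj (\<psi> y)) \<longlonglongrightarrow> gint \<psi> (pX G) x"
    unfolding gint_def
  proof (rule integral_dominated_convergence)
    show "(\<lambda>y. pX G (x, y) * cnj (\<psi> y)) \<in> borel_measurable lborel"
      by (rule borel_measurable_integrable[OF section_integrable[OF test_XY(1)[OF G]]])
    show "(\<lambda>y. ((G (x + s n, y) - G (x, y)) /\<^sub>R s n) * cnj (\<psi> y)) \<in> borel_measurable lborel" for n
    proof -
      have "Bochner_Integration.integrable lborel (\<lambda>y. (G (x + s n, y) * cnj (\<psi> y) - G (x, y) * cnj (\<psi> y)) /\<^sub>R s n)"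
        by (intro integrable_scaleR_right Bochner_Integration.integrable_diff section_integrable[OF G])
      then show ?thesis by (intro borel_measurable_integrable) (simp add: left_diff_distrib)
    qed
    show "Bochner_Integration.integrable lborel (\<lambda>y. M * cmod (\<psi> y))" using integrable by (intro integrable_mult_right integrable_norm)
    show "AE y in lborel. (\<lambda>n. ((G (x + s n, y) - G (x, y)) /\<^sub>R s n) * cnj (\<psi> y)) \<longlonglongrightarrow> pX G (x, y) * cnj (\<psi> y)"
    proof (rule AE_I2)
      fix y
      have "((\<lambda>r. (G (x + r, y) - G (x, y)) /\<^sub>R r) \<longlongrightarrow> pX G (x, y)) (at 0)"
        using sections_has_vector_derivative(1)[OF test_smooth[OF G], where S = UNIV]
        unfolding has_vector_derivative_quotient .
      then have "(\<lambda>n. (G (x + s n, y) - G (x, y)) /\<^sub>R s n) \<longlonglongrightarrow> pX G (x, y)"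
        using s unfolding tendsto_at_iff_sequentially o_def by blast
      then show "(\<lambda>n. ((G (x + s n, y) - G (x, y)) /\<^sub>R s n) * cnj (\<psi> y)) \<longlonglongrightarrow> pX G (x, y) * cnj (\<psi> y)"
        by (intro tendsto_mult tendsto_const)
    qed
    show "AE y in lborel. norm (((G (x + s n, y) - G (x, y)) /\<^sub>R s n) * cnj (\<psi> y)) \<le> M * cmod (\<psi> y)" for n
    proof (rule AE_I2)
      fix y
      have sn: "s n \<noteq> 0" using s(1) by auto
      have "cmod (G (x + s n, y) - G (x, y)) \<le> M * \<bar>s n\<bar>"
        using test_increment_bound[OF G Basis_XY(1) M(2), of "(x, y)" "s n"] by simp
      then have "cmod (G (x + s n, y) - G (x, y)) / \<bar>s n\<bar> \<le> M" using sn by (simp add: pos_divide_le_eq)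
      then have "cmod ((G (x + s n, y) - G (x, y)) /\<^sub>R s n) \<le> M"
        by (simp only: norm_scaleR abs_inverse divide_inverse mult.commute)
      then show "norm (((G (x + s n, y) - G (x, y)) /\<^sub>R s n) * cnj (\<psi> y)) \<le> M * cmod (\<psi> y)"
        unfolding norm_mult complex_mod_cnj by (rule mult_right_mono) simp
    qed
  qed
  show "((\<lambda>s. (gint \<psi> G (x + s) - gint \<psi> G x) /\<^sub>R s) \<circ> s) \<longlonglongrightarrow> gint \<psi> (pX G) x"
    unfolding o_def e by (rule lim)
qed

lemma gint_test:
  assumes G: "G \<in> test_functions (rect h)"
  shows "gint \<psi> G \<in> test_functions {0<..<h}" "partial_deriv 1 (gint \<psi> G) = gint \<psi> (pX G)"
proof -
  have s: "smooth (gint \<psi> G)"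
    by (rule smooth_vector_derivI[of "\<lambda>G. G \<in> test_functions (rect h)" pX "gint \<psi>", OF test_XY(1) gint_has_vector_derivative G])
  obtain K where K: "compact K" "K \<subseteq> rect h" "\<forall>p. p \<notin> K \<longrightarrow> G p = 0" using G unfolding test_functions_iff by blast
  have "compact (fst ` K)" using K by (auto intro!: compact_continuous_image continuous_intros)
  moreover have "fst ` K \<subseteq> {0<..<h}" using K by (auto simp: rect_def)
  moreover have "\<forall>x. x \<notin> fst ` K \<longrightarrow> gint \<psi> G x = 0"
  proof (intro allI impI)
    fix x assume "x \<notin> fst ` K"
    then have "G (x, y) = 0" for y using K(3) by force
    then show "gint \<psi> G x = 0" by (simp add: gint_def)
  qed
  ultimately show "gint \<psi> G \<in> test_functions {0<..<h}" using s unfolding test_functions_iff by blast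
  show "partial_deriv 1 (gint \<psi> G) = gint \<psi> (pX G)"
    using partial_deriv_1_eq[OF gint_has_vector_derivative[OF G]] by blast
qed

end

lemma L2_tensor:
  fixes a b :: "real \<Rightarrow> complex"
  assumes a: "a \<in> L2 UNIV" and b: "b \<in> L2 UNIV"
  shows "(\<lambda>p. a (fst p) * b (snd p)) \<in> L2 UNIV"
proof -
  have m[measurable]: "a \<in> borel_measurable borel" "b \<in> borel_measurable borel"
    using a b by (simp_all add: L2_iff measurable_lborel1)
  have i: "integrable lborel (\<lambda>x. (cmod (a x))\<^sup>2)" "integrable lborel (\<lambda>x. (cmod (b x))\<^sup>2)"
    using a b by (simp_all add: L2_iff)
  have m2: "(\<lambda>p. a (fst p) * b (snd p)) \<in> borel_measurable (borel \<Otimes>\<^sub>M borel)" by measurable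
  then have m3: "(\<lambda>p. a (fst p) * b (snd p)) \<in> borel_measurable (lborel :: (real \<times> real) measure)"
    by (simp add: borel_prod measurable_lborel1)
  have "integrable (lborel \<Otimes>\<^sub>M lborel) (\<lambda>p. (cmod (a (fst p) * b (snd p)))\<^sup>2)"
  proof (rule lborel_pair.Fubini_integrable)
    show "(\<lambda>p. (cmod (a (fst p) * b (snd p)))\<^sup>2) \<in> borel_measurable (lborel \<Otimes>\<^sub>M lborel)"
      using m3 by (simp add: lborel_prod)
    show "integrable lborel (\<lambda>x. LINT y|lborel. norm ((cmod (a (fst (x, y)) * b (snd (x, y))))\<^sup>2))"
      using i by (simp add: norm_mult power_mult_distrib)
    show "AE x in lborel. integrable lborel (\<lambda>y. (cmod (a (fst (x, y)) * b (snd (x, y))))\<^sup>2)"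
      using i by (simp add: norm_mult power_mult_distrib)
  qed
  then have "integrable lborel (\<lambda>p. (cmod (a (fst p) * b (snd p)))\<^sup>2)" by (simp add: lborel_prod)
  then show ?thesis using m3 by (simp add: L2_iff)
qed

context weight
begin

text \<open>Pythagoras in \<open>y\<close> for each fixed \<open>x\<close>, then integration over
  \<open>x\<close>. In the case \<open>\<psi> = 0\<close> the component vanishes and the identity is
  trivial.\<close>

lemma residual_nsq:
  assumes G: "G \<in> test_functions (rect h)"
  defines "R \<equiv> \<lambda>p. G p - gint \<psi> G (fst p) * \<psi> (snd p)"
  shows "Bochner_Integration.integrable lborel (\<lambda>p. (cmod (R p))\<^sup>2)" "nsq R = nsq G - nsq (gint \<psi> G)"
proof -
  note g = gint_test(1)[OF G]
  have gL: "gint \<psi> G \<in> L2 UNIV" by (rule csupp_L2[OF csupp_test[OF g]])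
  have "R \<in> L2 UNIV" unfolding R_def by (rule L2.diff_mem[OF csupp_L2[OF csupp_test[OF G]] L2_tensor[OF gL L2]])
  then show Ri: "Bochner_Integration.integrable lborel (\<lambda>p. (cmod (R p))\<^sup>2)" by (simp add: L2_iff)
  have sec: "nsq (\<lambda>y. R (x, y)) = nsq (\<lambda>y. G (x, y)) - (cmod (gint \<psi> G x))\<^sup>2" for x
  proof -
    have GL: "(\<lambda>y. G (x, y)) \<in> L2 UNIV" by (rule csupp_L2[OF csupp_test[OF test_rect_sections(2)[OF G]]])
    have ip: "L2_inner UNIV (\<lambda>y. G (x, y)) \<psi> = gint \<psi> G x"
      by (simp add: L2_inner_def gint_def set_lebesgue_integral_def)
    have "L2_inner UNIV (\<lambda>y. G (x, y)) (\<lambda>y. gint \<psi> G x * \<psi> y) = cnj (gint \<psi> G x) * gint \<psi> G x"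
      by (simp add: L2.scale_right[OF L2 GL] ip)
    then have 1: "Re (L2_inner UNIV (\<lambda>y. G (x, y)) (\<lambda>y. gint \<psi> G x * \<psi> y)) = (cmod (gint \<psi> G x))\<^sup>2"
      by (metis complex_norm_square mult.commute Re_complex_of_real)
    have 2: "nsq (\<lambda>y. gint \<psi> G x * \<psi> y) = (cmod (gint \<psi> G x))\<^sup>2"
      using unit
    proof
      assume "\<psi> = (\<lambda>y. 0)"
      then show ?thesis by (simp add: nsq_def gint_def)
    next
      assume "nsq \<psi> = 1"
      then show ?thesis by (simp add: nsq_L2 L2.self_scale[OF L2])
    qed
    show ?thesis
      using L2.self_diff[OF GL L2.scale_mem[OF L2, of "gint \<psi> G x"]] 1 2 by (simp add: nsq_L2 R_def)
  qed
  have "nsq R = (LINT x|lborel. nsq (\<lambda>y. G (x, y)) - (cmod (gint \<psi> G x))\<^sup>2)"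
    using fubini_nsq(1)[OF Ri] by (simp only: sec)
  also have "\<dots> = nsq G - nsq (gint \<psi> G)"
    using fubini_nsq(1,3)[OF csupp_sq_integrable[OF csupp_test[OF G]]] csupp_sq_integrable[OF csupp_test[OF g]]
    by (simp add: nsq_def[of "gint \<psi> G"])
  finally show "nsq R = nsq G - nsq (gint \<psi> G)" .
qed

text \<open>For fixed \<open>y\<close> the remainder \<open>R f\<close> is a test function of
  \<open>x\<close>, and \<open>R\<close> commutes with \<open>pX\<close> since \<open>\<psi>\<close>
  depends on \<open>y\<close> alone. So the hypothesis applies to every slice of the remainder, and
  \<open>residual_nsq\<close> evaluates the integrals.\<close>

lemma x_form_lower_bound:
  assumes f: "f \<in> test_functions (rect h)"
    and A: "\<And>v. v \<in> test_functions {0<..<h} \<Longrightarrow>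
      a * nsq v \<le> nsq (partial_deriv 1 (partial_deriv 1 v)) + c * nsq (partial_deriv 1 v)"
  shows "a * (nsq f - nsq (gint \<psi> f)) \<le>
    (nsq (pX (pX f)) - nsq (gint \<psi> (pX (pX f)))) + c * (nsq (pX f) - nsq (gint \<psi> (pX f)))"
proof -
  define R where "R G = (\<lambda>p. G p - gint \<psi> G (fst p) * \<psi> (snd p))" for G
  note T = test_XY(1)[OF f]
  note T2 = test_XY(1)[OF T]
  have t: "(\<lambda>x. R G (x, y)) \<in> test_functions {0<..<h} \<and> partial_deriv 1 (\<lambda>x. R G (x, y)) = (\<lambda>x. R (pX G) (x, y))"
    if G: "G \<in> test_functions (rect h)" for G y
  proof -
    note tests = test_rect_sections(1)[OF G, of y] test_scale[OF gint_test(1)[OF G], of "- \<psi> y"]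
    have "partial_deriv 1 (\<lambda>x. G (x, y) + (- \<psi> y) * gint \<psi> G x) = (\<lambda>x. pX G (x, y) + (- \<psi> y) * gint \<psi> (pX G) x)"
      unfolding partial_deriv_add[OF tests[THEN test_smooth, THEN smooth_Ck]]
        partial_deriv_scale[OF smooth_Ck[OF test_smooth[OF gint_test(1)[OF G]]]]
        sections_partial(1)[OF test_smooth[OF G]] gint_test(2)[OF G] ..
    then show ?thesis using test_add[OF tests] by (simp add: R_def mult.commute)
  qed
  have I: "Bochner_Integration.integrable lborel (\<lambda>p. (cmod (R G p))\<^sup>2)" "nsq (R G) = nsq G - nsq (gint \<psi> G)"
    if "G \<in> test_functions (rect h)" for G
    using residual_nsq[OF that] by (simp_all add: R_def)
  note F = fubini_nsq(2,4)[OF I(1)[OF f]] fubini_nsq(2,4)[OF I(1)[OF T]] fubini_nsq(2,4)[OF I(1)[OF T2]]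
  have "a * nsq (\<lambda>x. R f (x, y)) \<le> nsq (\<lambda>x. R (pX (pX f)) (x, y)) + c * nsq (\<lambda>x. R (pX f) (x, y))" for y
    using A[of "\<lambda>x. R f (x, y)"] t[OF f, of y] t[OF T, of y] by simp
  then have "(LINT y|lborel. a * nsq (\<lambda>x. R f (x, y))) \<le>
      (LINT y|lborel. nsq (\<lambda>x. R (pX (pX f)) (x, y)) + c * nsq (\<lambda>x. R (pX f) (x, y)))"
    using F by (intro integral_mono Bochner_Integration.integrable_add integrable_mult_right) auto
  then have "a * nsq (R f) \<le> nsq (R (pX (pX f))) + c * nsq (R (pX f))" using F by simp
  then show ?thesis by (simp add: I f T T2)
qed

text \<open>The hypothesis is applied to the vertical slices of \<open>f\<close> itself: the pairing
  in its correction is \<open>gint \<psi> f x\<close>, so integration over \<open>x\<close> turns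
  the correction into \<open>e * nsq (gint \<psi> f)\<close>.\<close>

lemma y_form_lower_bound:
  assumes f: "f \<in> test_functions (rect h)"
    and B: "\<And>u. u \<in> test_functions {0<..<1} \<Longrightarrow>
      b * nsq u - e * (cmod (LINT y|lborel. u y * cnj (\<psi> y)))\<^sup>2 \<le>
        nsq (partial_deriv 1 (partial_deriv 1 u)) + c * nsq (partial_deriv 1 u)"
  shows "b * nsq f - e * nsq (gint \<psi> f) \<le> nsq (pY (pY f)) + c * nsq (pY f)"
proof -
  note T = test_XY(2)[OF f]
  note T2 = test_XY(2)[OF T]
  note F = fubini_nsq(1,3)[OF csupp_sq_integrable[OF csupp_test[OF f]]]
    fubini_nsq(1,3)[OF csupp_sq_integrable[OF csupp_test[OF T]]]
    fubini_nsq(1,3)[OF csupp_sq_integrable[OF csupp_test[OF T2]]]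
  have gi: "Bochner_Integration.integrable lborel (\<lambda>x. (cmod (gint \<psi> f x))\<^sup>2)"
    by (rule csupp_sq_integrable[OF csupp_test[OF gint_test(1)[OF f]]])
  have "b * nsq (\<lambda>y. f (x, y)) - e * (cmod (gint \<psi> f x))\<^sup>2 \<le> nsq (\<lambda>y. pY (pY f) (x, y)) + c * nsq (\<lambda>y. pY f (x, y))" for x
    using B[OF test_rect_sections(2)[OF f, of x]]
    by (simp add: sections_partial(2)[OF test_smooth[OF f]] sections_partial(2)[OF test_smooth[OF T]] gint_def)
  then have "(LINT x|lborel. b * nsq (\<lambda>y. f (x, y)) - e * (cmod (gint \<psi> f x))\<^sup>2) \<le>
      (LINT x|lborel. nsq (\<lambda>y. pY (pY f) (x, y)) + c * nsq (\<lambda>y. pY f (x, y)))"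
    using F gi by (intro integral_mono Bochner_Integration.integrable_add Bochner_Integration.integrable_diff integrable_mult_right) auto
  then show ?thesis using F gi by (simp add: nsq_def[of "gint \<psi> f"])
qed

text \<open>Splitting \<open>f\<close> into its component along \<open>\<psi>\<close> (in the variable \<open>y\<close>) and the remainder, the form of the
  tensor sum is at least \<open>a3 + b1\<close> on the former and at least \<open>a1 + b2\<close> on the latter.\<close>

lemma biharmonic_form_lower_bound:
  assumes h: "h > 0" and f: "f \<in> test_functions (rect h)"
    and A1: "\<And>v. v \<in> test_functions {0<..<h} \<Longrightarrow>
      a1 * nsq v \<le> nsq (partial_deriv 1 (partial_deriv 1 v)) + 2 * pi\<^sup>2 * nsq (partial_deriv 1 v)"
    and A3: "\<And>v. v \<in> test_functions {0<..<h} \<Longrightarrow>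
      a3 * nsq v - P v \<le> nsq (partial_deriv 1 (partial_deriv 1 v)) + 2 * pi\<^sup>2 * nsq (partial_deriv 1 v)"
    and B2: "\<And>u. u \<in> test_functions {0<..<1} \<Longrightarrow>
      b2 * nsq u - (b2 - b1) * (cmod (LINT y|lborel. u y * cnj (\<psi> y)))\<^sup>2 \<le>
        nsq (partial_deriv 1 (partial_deriv 1 u)) + 2 * (pi\<^sup>2 / h\<^sup>2) * nsq (partial_deriv 1 u)"
  shows "(min (a1 + b2) (a3 + b1) - 2 * pi ^ 4 / h\<^sup>2) * nsq f - P (gint \<psi> f)
    \<le> nsq (\<lambda>p. pX (pX f) p + pY (pY f) p)"
proof -
  let ?g = "gint \<psi> f"
  note g = gint_test[OF f]
  have g2: "partial_deriv 1 (partial_deriv 1 ?g) = gint \<psi> (pX (pX f))"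
    unfolding g(2) by (rule gint_test(2)[OF test_XY(1)[OF f]])
  have X: "a1 * (nsq f - nsq ?g) \<le>
    (nsq (pX (pX f)) - nsq (gint \<psi> (pX (pX f)))) + 2 * pi\<^sup>2 * (nsq (pX f) - nsq (gint \<psi> (pX f)))"
    by (rule x_form_lower_bound[OF f A1])
  have G: "a3 * nsq ?g - P ?g \<le> nsq (gint \<psi> (pX (pX f))) + 2 * pi\<^sup>2 * nsq (gint \<psi> (pX f))"
    using A3[OF g(1)] unfolding g2 unfolding g(2) .
  have Y: "b2 * nsq f - (b2 - b1) * nsq ?g \<le> nsq (pY (pY f)) + 2 * (pi\<^sup>2 / h\<^sup>2) * nsq (pY f)"
    by (rule y_form_lower_bound[OF f B2])
  \<comment> \<open>Used twice, for the summand \<open>2 * nsq (pX (pY f))\<close> of the biharmonic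
    form: it supplies the first-order terms required by \<open>X\<close>, \<open>G\<close> and
    \<open>Y\<close>, at the price of the shift.\<close>
  have M: "pi\<^sup>2 * nsq (pX f) + pi\<^sup>2 / h\<^sup>2 * nsq (pY f) - pi ^ 4 / h\<^sup>2 * nsq f \<le> nsq (pX (pY f))"
    using mixed_derivative_lower_bound[OF h f] by (simp add: power_divide power_mult_distrib power2_eq_square power4_eq_xxxx)
  have gn: "nsq ?g \<le> nsq f"
    using residual_nsq(2)[OF f] nsq_nonneg[of "\<lambda>p. f p - ?g (fst p) * \<psi> (snd p)"] by simp
  let ?m = "min (a1 + b2) (a3 + b1)"
  \<comment> \<open>The square norm of \<open>f\<close> is divided between the remainder and the
    component; \<open>?m\<close> is below the coefficient of each, and both weights are non-negative
    by \<open>gn\<close>.\<close>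
  have "?m * nsq f = ?m * (nsq f - nsq ?g) + ?m * nsq ?g" by (simp add: algebra_simps)
  also have "\<dots> \<le> (a1 + b2) * (nsq f - nsq ?g) + (a3 + b1) * nsq ?g"
    using gn nsq_nonneg by (intro add_mono mult_right_mono) auto
  finally have "?m * nsq f \<le> (a1 + b2) * (nsq f - nsq ?g) + (a3 + b1) * nsq ?g" .
  moreover have "(a1 + b2) * (nsq f - nsq ?g) + (a3 + b1) * nsq ?g =
      a1 * (nsq f - nsq ?g) + a3 * nsq ?g + (b2 * nsq f - (b2 - b1) * nsq ?g)"
    by (simp add: algebra_simps)
  moreover have "(?m - 2 * pi ^ 4 / h\<^sup>2) * nsq f = ?m * nsq f - 2 * (pi ^ 4 / h\<^sup>2 * nsq f)"
    by (simp add: left_diff_distrib)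
  moreover have "2 * pi\<^sup>2 * (nsq (pX f) - nsq (gint \<psi> (pX f))) = 2 * (pi\<^sup>2 * nsq (pX f)) - 2 * (pi\<^sup>2 * nsq (gint \<psi> (pX f)))"
    by (simp add: right_diff_distrib)
  moreover note X M G[unfolded mult.assoc] Y[unfolded mult.assoc]
  ultimately show ?thesis unfolding nsq_laplacian[OF f] by linarith
qed

end

section \<open>Rescaling the one-dimensional bound\<close>

lemma test_rescale:
  assumes h: "h > 0" and v: "v \<in> test_functions {0<..<h}"
  shows "(\<lambda>x. v (h * x)) \<in> test_functions {0<..<1}"
    "partial_deriv 1 (\<lambda>x. v (h * x)) = (\<lambda>x. of_real h * partial_deriv 1 v (h * x))"
proof -
  have d: "((\<lambda>x. c * g (h * x)) has_vector_derivative (c * of_real h) * partial_deriv 1 g (h * x)) (at x)"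
    if "smooth g" for g x c
  proof -
    have "((\<lambda>x. h * x) has_vector_derivative h) (at x)"
      by (auto intro!: derivative_eq_intros simp: has_real_derivative_iff_has_vector_derivative[symmetric])
    from vector_diff_chain_at[OF this has_vector_derivative_partial[OF that]]
    have "((\<lambda>x. g (h * x)) has_vector_derivative h *\<^sub>R partial_deriv 1 g (h * x)) (at x)" by (simp add: o_def)
    from has_vector_derivative_mult_right[OF this, of c] show ?thesis by (simp add: scaleR_conv_of_real mult.assoc)
  qed
  \<comment> \<open>The index is a pair, since each differentiation produces a factor:
    \<open>(c, g)\<close> becomes \<open>(c * of_real h, partial_deriv 1 g)\<close>.\<close>
  have s: "smooth (\<lambda>x. 1 * v (h * x))"
    using smooth_vector_derivI[of "\<lambda>(c, g). smooth g" "\<lambda>(c, g). (c * of_real h, partial_deriv 1 g)"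
        "\<lambda>(c, g) x. c * g (h * x)" "(1, v)"] d smooth_partial[where b = "1::real"] test_smooth[OF v] by auto
  obtain K where K: "compact K" "K \<subseteq> {0<..<h}" "\<forall>x. x \<notin> K \<longrightarrow> v x = 0" using v unfolding test_functions_iff by blast
  have "compact ((\<lambda>x. x / h) ` K)" using K by (intro compact_continuous_image continuous_intros) (use h in auto)
  moreover have "(\<lambda>x. x / h) ` K \<subseteq> {0<..<1}" using K h by (auto simp: subset_iff)
  moreover have "\<forall>x. x \<notin> (\<lambda>x. x / h) ` K \<longrightarrow> v (h * x) = 0"
  proof (intro allI impI)
    fix x assume "x \<notin> (\<lambda>x. x / h) ` K"
    then have "h * x \<notin> K" using h by (metis image_eqI nonzero_mult_div_cancel_left less_numeral_extra(3))
    then show "v (h * x) = 0" using K by blast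
  qed
  ultimately show "(\<lambda>x. v (h * x)) \<in> test_functions {0<..<1}" using s unfolding test_functions_iff by auto
  show "partial_deriv 1 (\<lambda>x. v (h * x)) = (\<lambda>x. of_real h * partial_deriv 1 v (h * x))"
    using partial_deriv_1_eq[OF d[OF test_smooth[OF v], of 1]] by auto
qed

lemma nsq_rescale:
  assumes "h > 0" shows "nsq (\<lambda>x. f (h * x)) = nsq f / h"
proof -
  have "nsq f = h * nsq (\<lambda>x. f (h * x))"
    using lborel_integral_real_affine[of h "\<lambda>x. (cmod (f x))\<^sup>2" 0] assms by (simp add: nsq_def)
  then show ?thesis using assms by simp
qed

lemma nsq_scale: "nsq (\<lambda>x. c * f x) = (cmod c)\<^sup>2 * nsq f"
  by (simp add: nsq_def norm_mult power_mult_distrib)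

text \<open>For u(x) = v(h x), the square norms of u, u' and u'' are those of v, v' and v'' times
  1/h, h and h^3. Dividing the bound on the unit interval by h^3 turns the coefficient
  \<open>pi\<^sup>2 * h\<^sup>2\<close> into \<open>pi\<^sup>2\<close> and the eigenvalue into its
  quotient by \<open>h ^ 4\<close>.\<close>

lemma H_lower_bound_rescaled:
  assumes h: "h > 0" and ev: "lists_eigenvalues {0<..<1} (H_op 1 (pi\<^sup>2 * h\<^sup>2)) \<rho>"
  obtains \<Phi> e where "\<And>i. i < m \<Longrightarrow> \<Phi> i \<in> L2 UNIV"
    "\<And>v. v \<in> test_functions {0<..<h} \<Longrightarrow>
      \<rho> (Suc m) / h ^ 4 * nsq v - (\<Sum>i<m. e i * (cmod (LINT x|lborel. v x * cnj (\<Phi> i x)))\<^sup>2)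
      \<le> nsq (partial_deriv 1 (partial_deriv 1 v)) + 2 * pi\<^sup>2 * nsq (partial_deriv 1 v)"
proof -
  have \<alpha>: "pi\<^sup>2 * h\<^sup>2 > 0" using h by simp
  obtain \<phi> :: "nat \<Rightarrow> real \<Rightarrow> complex" where \<phi>: "\<And>i. i < m \<Longrightarrow> \<phi> i \<in> L2 UNIV"
    and lb: "\<And>u. u \<in> test_functions {0<..<1} \<Longrightarrow>
      \<rho> (Suc m) * nsq u - (\<Sum>i<m. (\<rho> (Suc m) - \<rho> (Suc i)) * (cmod (LINT x|lborel. u x * cnj (\<phi> i x)))\<^sup>2)
      \<le> nsq (partial_deriv 1 (partial_deriv 1 u)) + 2 * (pi\<^sup>2 * h\<^sup>2) * nsq (partial_deriv 1 u)"
  proof (rule H_lower_bound[OF \<alpha> ev, of m])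
    fix \<phi> :: "nat \<Rightarrow> real \<Rightarrow> complex" assume 1: "\<And>i. i < m \<Longrightarrow> \<phi> i \<in> L2 UNIV \<and> (\<forall>x. x \<notin> {0<..<1} \<longrightarrow> \<phi> i x = 0) \<and>
        (\<phi> i = (\<lambda>x. 0) \<or> (LINT x|lborel. (cmod (\<phi> i x))\<^sup>2) = 1)"
      and 2: "\<And>u::real \<Rightarrow> complex. u \<in> test_functions {0<..<1} \<Longrightarrow>
      \<rho> (Suc m) * (LINT x|lborel. (cmod (u x))\<^sup>2)
        - (\<Sum>i<m. (\<rho> (Suc m) - \<rho> (Suc i)) * (cmod (LINT x|lborel. u x * cnj (\<phi> i x)))\<^sup>2)
      \<le> (LINT x|lborel. (cmod (partial_deriv 1 (partial_deriv 1 u) x))\<^sup>2)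
        + 2 * (pi\<^sup>2 * h\<^sup>2) * (LINT x|lborel. (cmod (partial_deriv 1 u x))\<^sup>2)"
    show thesis by (rule that[of \<phi>, unfolded nsq_def, OF conjunct1[OF 1] 2])
  qed
  define \<Phi> where "\<Phi> i x = \<phi> i (x / h)" for i x
  show thesis
  \<comment> \<open>Each pairing loses a factor \<open>h\<close> under the substitution, so its
    square contributes \<open>h\<^sup>2\<close>; the common division contributes
    \<open>h ^ 3\<close>.\<close>
  proof (rule that[of \<Phi> "\<lambda>i. (\<rho> (Suc m) - \<rho> (Suc i)) / h ^ 5"])
    fix i assume i: "i < m"
    have m: "\<phi> i \<in> borel_measurable borel" and int: "integrable lborel (\<lambda>x. (cmod (\<phi> i x))\<^sup>2)"
      using \<phi>[OF i] by (simp_all add: L2_iff measurable_lborel1)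
    have "\<Phi> i \<in> borel_measurable borel" unfolding \<Phi>_def[abs_def] using m by measurable
    moreover have "integrable lborel (\<lambda>x. (cmod (\<Phi> i x))\<^sup>2)"
      using lborel_integrable_real_affine[OF int, of "1 / h" 0] h by (simp add: \<Phi>_def)
    ultimately show "\<Phi> i \<in> L2 UNIV" by (simp add: L2_iff measurable_lborel1)
  next
    fix v assume v: "v \<in> test_functions {0<..<h}"
    let ?u = "\<lambda>x. v (h * x)"
    let ?v1 = "partial_deriv 1 v" and ?v2 = "partial_deriv 1 (partial_deriv 1 v)"
    have v1: "?v1 \<in> test_functions {0<..<h}" by (rule test_partial[OF v]) simp
    note u = test_rescale[OF h v] and u1 = test_rescale[OF h v1]
    have u2: "partial_deriv 1 (partial_deriv 1 ?u) = (\<lambda>x. (of_real h * of_real h) * ?v2 (h * x))"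
      unfolding u(2) partial_deriv_scale[OF smooth_Ck[OF test_smooth[OF u1(1)]]] u1(2) by (simp add: mult.assoc)
    have ip: "(LINT x|lborel. ?u x * cnj (\<phi> i x)) = (LINT x|lborel. v x * cnj (\<Phi> i x)) / of_real h" for i
    proof -
      have "(LINT x|lborel. v x * cnj (\<Phi> i x)) = h *\<^sub>R (LINT x|lborel. ?u x * cnj (\<phi> i x))"
        using lborel_integral_real_affine[of h "\<lambda>x. v x * cnj (\<Phi> i x)" 0] h by (simp add: \<Phi>_def)
      then show ?thesis using h by (simp add: scaleR_conv_of_real)
    qed
    have n2: "nsq (partial_deriv 1 (partial_deriv 1 ?u)) = h ^ 3 * nsq ?v2"
      unfolding u2 nsq_scale nsq_rescale[OF h] using h by (simp add: norm_mult power2_eq_square power3_eq_cube field_simps)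
    have n1: "nsq (partial_deriv 1 ?u) = h * nsq ?v1"
      unfolding u(2) nsq_scale nsq_rescale[OF h] using h by (simp add: power2_eq_square)
    have S: "(\<Sum>i<m. (\<rho> (Suc m) - \<rho> (Suc i)) * (cmod (LINT x|lborel. ?u x * cnj (\<phi> i x)))\<^sup>2) =
        h ^ 3 * (\<Sum>i<m. (\<rho> (Suc m) - \<rho> (Suc i)) / h ^ 5 * (cmod (LINT x|lborel. v x * cnj (\<Phi> i x)))\<^sup>2)"
      unfolding sum_distrib_left ip
      by (rule sum.cong) (use h in \<open>simp_all add: norm_divide power_divide field_simps power2_eq_square eval_nat_numeral\<close>)
    have "h ^ 3 * (\<rho> (Suc m) / h ^ 4 * nsq v) = \<rho> (Suc m) * nsq ?u"
      unfolding nsq_rescale[OF h] using h by (simp add: field_simps eval_nat_numeral)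
    moreover have "h ^ 3 * (nsq ?v2 + 2 * pi\<^sup>2 * nsq ?v1) =
        nsq (partial_deriv 1 (partial_deriv 1 ?u)) + 2 * (pi\<^sup>2 * h\<^sup>2) * nsq (partial_deriv 1 ?u)"
      unfolding n1 n2 by (simp add: algebra_simps power2_eq_square power3_eq_cube)
    ultimately have "h ^ 3 * (\<rho> (Suc m) / h ^ 4 * nsq v - (\<Sum>i<m. (\<rho> (Suc m) - \<rho> (Suc i)) / h ^ 5 * (cmod (LINT x|lborel. v x * cnj (\<Phi> i x)))\<^sup>2))
        \<le> h ^ 3 * (nsq ?v2 + 2 * pi\<^sup>2 * nsq ?v1)"
      using lb[OF u(1)] unfolding S right_diff_distrib by simp
    then show "\<rho> (Suc m) / h ^ 4 * nsq v - (\<Sum>i<m. (\<rho> (Suc m) - \<rho> (Suc i)) / h ^ 5 * (cmod (LINT x|lborel. v x * cnj (\<Phi> i x)))\<^sup>2)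
        \<le> nsq ?v2 + 2 * pi\<^sup>2 * nsq ?v1"
      using h by simp
  qed
qed

section \<open>The biharmonic operator\<close>

lemma weak_laplacian_rect:
  "weak_laplacian U f x = weak_deriv U (1, 0) (weak_deriv U (1, 0) f) x + weak_deriv U (0, 1) (weak_deriv U (0, 1) f) x"
  for U :: "(real \<times> real) set"
  by (simp add: weak_laplacian_def Basis_XY(3))

lemma weak_laplacian_L2:
  fixes U :: "(real \<times> real) set"
  assumes "f \<in> W22 U" shows "weak_laplacian U f \<in> L2 U"
  unfolding weak_laplacian_rect[abs_def]
  by (rule L2_add[OF W22_D_L2(2)[OF assms Basis_XY(1) Basis_XY(1)] W22_D_L2(2)[OF assms Basis_XY(2) Basis_XY(2)]])

definition biharmonic_form :: "real \<Rightarrow> (real \<times> real \<Rightarrow> complex) \<Rightarrow> (real \<times> real \<Rightarrow> complex) \<Rightarrow> complex" where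
  "biharmonic_form h f g = L2_inner (rect h) (weak_laplacian (rect h) f) (weak_laplacian (rect h) g)"

lemma semi_inner_biharmonic: "semi_inner (W22 (rect h)) (biharmonic_form h)"
  unfolding biharmonic_form_def[abs_def]
proof (rule semi_inner_pullback[where T = "weak_laplacian (rect h)",
      OF W22_zero[OF open_rect] W22_add(1)[OF open_rect] W22_scale(1)[OF open_rect] weak_laplacian_L2])
  fix u v and c :: complex assume u: "u \<in> W22 (rect h)"
  show "AE x in lborel. x \<in> rect h \<longrightarrow> weak_laplacian (rect h) (\<lambda>x. c * u x) x = c * weak_laplacian (rect h) u x"
    using W22_scale(3)[OF open_rect u Basis_XY(1) Basis_XY(1), of c] W22_scale(3)[OF open_rect u Basis_XY(2) Basis_XY(2), of c]
    by eventually_elim (simp add: weak_laplacian_rect distrib_left)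
  assume v: "v \<in> W22 (rect h)"
  show "AE x in lborel. x \<in> rect h \<longrightarrow>
      weak_laplacian (rect h) (\<lambda>x. u x + v x) x = weak_laplacian (rect h) u x + weak_laplacian (rect h) v x"
    using W22_add(3)[OF open_rect u v Basis_XY(1) Basis_XY(1)] W22_add(3)[OF open_rect u v Basis_XY(2) Basis_XY(2)]
    by eventually_elim (simp add: weak_laplacian_rect)
qed

lemma L2_norm_components_le:
  assumes "f \<in> W22 U"
  shows "L2_norm U f \<le> W22_norm U f" "b \<in> Basis \<Longrightarrow> c \<in> Basis \<Longrightarrow> L2_norm U (weak_deriv U c (weak_deriv U b f)) \<le> W22_norm U f"
proof -
  let ?A = "\<Sum>b\<in>Basis. (L2_norm U (weak_deriv U b f))\<^sup>2"
  let ?B = "\<Sum>b\<in>Basis. \<Sum>c\<in>Basis. (L2_norm U (weak_deriv U c (weak_deriv U b f)))\<^sup>2"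
  have n: "0 \<le> ?A" "0 \<le> ?B" by (simp_all add: sum_nonneg)
  have e: "(W22_norm U f)\<^sup>2 = (L2_norm U f)\<^sup>2 + ?A + ?B"
    by (simp add: W22_norm_sq W22_inner_def L2_norm_sq)
  have "(L2_norm U f)\<^sup>2 \<le> (W22_norm U f)\<^sup>2" unfolding e using n by linarith
  then show "L2_norm U f \<le> W22_norm U f" by (rule power2_le_imp_le[OF _ W22_norm_nonneg])
  assume b: "b \<in> Basis" and c: "c \<in> Basis"
  have "(L2_norm U (weak_deriv U c (weak_deriv U b f)))\<^sup>2 \<le> (\<Sum>c\<in>Basis. (L2_norm U (weak_deriv U c (weak_deriv U b f)))\<^sup>2)"
    by (rule member_le_sum[OF c]) auto
  also have "\<dots> \<le> ?B"
    by (rule member_le_sum[OF b, of "\<lambda>b. \<Sum>c\<in>Basis. (L2_norm U (weak_deriv U c (weak_deriv U b f)))\<^sup>2"]) (auto intro: sum_nonneg)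
  also have "\<dots> \<le> (W22_norm U f)\<^sup>2" unfolding e using n by simp
  finally show "L2_norm U (weak_deriv U c (weak_deriv U b f)) \<le> W22_norm U f"
    by (rule power2_le_imp_le[OF _ W22_norm_nonneg])
qed

lemma nsq_test_L2: "f \<in> test_functions U \<Longrightarrow> nsq f = Re (L2_inner U f f)"
proof -
  assume f: "f \<in> test_functions U"
  have "indicator U x *\<^sub>R (cmod (f x))\<^sup>2 = (cmod (f x))\<^sup>2" for x
    using f by (auto simp: indicator_def test_functions_iff)
  then have "(LINT x:U|lborel. (cmod (f x))\<^sup>2) = (LINT x|lborel. (cmod (f x))\<^sup>2)" by (simp only: set_lebesgue_integral_def)
  then show ?thesis by (simp add: L2_inner_self nsq_def)
qed

lemma biharmonic_form_test:
  assumes f: "f \<in> test_functions (rect h)"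
  shows "nsq (\<lambda>p. pX (pX f) p + pY (pY f) p) = Re (biharmonic_form h f f)"
proof -
  have t: "(\<lambda>p. pX (pX f) p + pY (pY f) p) \<in> test_functions (rect h)"
    by (intro test_add test_XY f)
  have AE: "AE p in lborel. p \<in> rect h \<longrightarrow> weak_laplacian (rect h) f p = pX (pX f) p + pY (pY f) p"
    using W22_test(3)[OF open_rect f Basis_XY(1) Basis_XY(1)] W22_test(3)[OF open_rect f Basis_XY(2) Basis_XY(2)]
    by eventually_elim (simp add: weak_laplacian_rect)
  note L = weak_laplacian_L2[OF W22_test(1)[OF open_rect f]] test_L2[OF t]
  show ?thesis unfolding nsq_test_L2[OF t] biharmonic_form_def using L2_inner_cong[OF AE AE L L] by simp
qed

text \<open>Both sides are continuous in the Sobolev norm: the Laplacian is bounded by twice that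
  norm, and the correction consists of finitely many pairings with fixed square integrable
  functions.\<close>

lemma biharmonic_lower_bound_closure:
  assumes test: "\<And>\<phi>. \<phi> \<in> test_functions (rect h) \<Longrightarrow>
      c * nsq \<phi> - (\<Sum>i<d. e i * (cmod (L2_inner (rect h) \<phi> (\<eta> i)))\<^sup>2) \<le> nsq (\<lambda>p. pX (pX \<phi>) p + pY (pY \<phi>) p)"
    and \<eta>: "\<And>i. i < d \<Longrightarrow> \<eta> i \<in> L2 (rect h)" and f: "f \<in> W22_0 (rect h)"
  shows "c * Re (L2_inner (rect h) f f) - (\<Sum>i<d. e i * (cmod (L2_inner (rect h) f (\<eta> i)))\<^sup>2) \<le> Re (biharmonic_form h f f)"
proof -
  let ?U = "rect h"
  interpret W: semi_inner "W22 ?U" "W22_inner ?U" by (rule semi_inner_W22[OF open_rect])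
  interpret Q: semi_inner "W22 ?U" "biharmonic_form h" by (rule semi_inner_biharmonic)
  note fW = W22_0_sub[OF f]
  have "\<forall>n. \<exists>\<phi>. \<phi> \<in> test_functions ?U \<and> W22_norm ?U (\<lambda>x. f x - \<phi> x) < 1 / Suc n"
    using W22_0_approx[OF f] by (auto simp: Bex_def)
  from choice[OF this] obtain \<phi> where \<phi>: "\<forall>n. \<phi> n \<in> test_functions ?U \<and> W22_norm ?U (\<lambda>x. f x - \<phi> n x) < 1 / Suc n" ..
  have t: "\<phi> n \<in> test_functions ?U" for n using \<phi> by blast
  have tW: "\<phi> n \<in> W22 ?U" for n by (rule W22_test(1)[OF open_rect t])
  have dW: "(\<lambda>x. \<phi> n x - f x) \<in> W22 ?U" for n by (rule W.diff_mem[OF tW fW])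
  have wl: "(\<lambda>n. W22_norm ?U (\<lambda>x. \<phi> n x - f x)) \<longlonglongrightarrow> 0"
  proof (rule tendsto_sandwich[OF _ _ tendsto_const LIMSEQ_Suc[OF lim_1_over_n]])
    show "\<forall>\<^sub>F n in sequentially. 0 \<le> W22_norm ?U (\<lambda>x. \<phi> n x - f x)" by (simp add: W22_norm_nonneg)
    have "W22_norm ?U (\<lambda>x. \<phi> n x - f x) \<le> 1 / Suc n" for n
    proof -
      have "W22_norm ?U (\<lambda>x. \<phi> n x - f x) = W22_norm ?U (\<lambda>x. f x - \<phi> n x)"
        using W.nrm_diff_commute[OF tW fW] by (simp add: W22_norm_eq W.nrm_def)
      then show ?thesis using \<phi>[rule_format, of n] by simp
    qed
    then show "\<forall>\<^sub>F n in sequentially. W22_norm ?U (\<lambda>x. \<phi> n x - f x) \<le> 1 / Suc n" by (intro always_eventually allI)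
  qed
  have l0: "(\<lambda>n. L2_norm ?U (\<lambda>x. \<phi> n x - f x)) \<longlonglongrightarrow> 0"
    by (rule tendsto_sandwich[OF _ _ tendsto_const wl])
       (intro always_eventually allI L2_norm_nonneg L2_norm_components_le(1)[OF dW])+
  have "Q.nrm (\<lambda>x. \<phi> n x - f x) \<le> 2 * W22_norm ?U (\<lambda>x. \<phi> n x - f x)" for n
  proof -
    note D = W22_D_L2(2)[OF dW Basis_XY(1) Basis_XY(1)] W22_D_L2(2)[OF dW Basis_XY(2) Basis_XY(2)]
    have "Q.nrm (\<lambda>x. \<phi> n x - f x) = L2_norm ?U (weak_laplacian ?U (\<lambda>x. \<phi> n x - f x))"
      unfolding L2_norm_eq L2.nrm_def Q.nrm_def biharmonic_form_def ..
    also have "\<dots> \<le> L2_norm ?U (weak_deriv ?U (1, 0) (weak_deriv ?U (1, 0) (\<lambda>x. \<phi> n x - f x))) +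
        L2_norm ?U (weak_deriv ?U (0, 1) (weak_deriv ?U (0, 1) (\<lambda>x. \<phi> n x - f x)))"
      unfolding weak_laplacian_rect[abs_def] L2_norm_eq by (rule L2.nrm_triangle[OF D])
    also have "\<dots> \<le> W22_norm ?U (\<lambda>x. \<phi> n x - f x) + W22_norm ?U (\<lambda>x. \<phi> n x - f x)"
      by (rule add_mono[OF L2_norm_components_le(2)[OF dW Basis_XY(1) Basis_XY(1)] L2_norm_components_le(2)[OF dW Basis_XY(2) Basis_XY(2)]])
    finally show ?thesis by simp
  qed
  then have qb: "\<forall>\<^sub>F n in sequentially. Q.nrm (\<lambda>x. \<phi> n x - f x) \<le> 2 * W22_norm ?U (\<lambda>x. \<phi> n x - f x)"
    by (intro always_eventually allI)
  have lq: "(\<lambda>n. Q.nrm (\<lambda>x. \<phi> n x - f x)) \<longlonglongrightarrow> 0"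
  proof (rule tendsto_sandwich[OF _ qb tendsto_const])
    show "(\<lambda>n. 2 * W22_norm ?U (\<lambda>x. \<phi> n x - f x)) \<longlonglongrightarrow> 0" using tendsto_mult_right_zero[OF wl] .
    show "\<forall>\<^sub>F n in sequentially. 0 \<le> Q.nrm (\<lambda>x. \<phi> n x - f x)"
      by (intro always_eventually allI Q.nrm_nonneg dW)
  qed
  have tL: "\<phi> n \<in> L2 ?U" for n by (rule test_L2[OF t])
  have fL: "f \<in> L2 ?U" by (rule W22_D(1)[OF fW])
  have "(\<lambda>n. (L2.nrm ?U (\<phi> n))\<^sup>2) \<longlonglongrightarrow> (L2.nrm ?U f)\<^sup>2"
    by (intro tendsto_power L2.nrm_tendsto[OF tL fL l0[unfolded L2_norm_eq]])
  then have m0: "(\<lambda>n. nsq (\<phi> n)) \<longlonglongrightarrow> Re (L2_inner ?U f f)"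
    unfolding nsq_test_L2[OF t] L2.nrm_sq[OF tL] L2.nrm_sq[OF fL] .
  have "(\<lambda>n. (Q.nrm (\<phi> n))\<^sup>2) \<longlonglongrightarrow> (Q.nrm f)\<^sup>2"
    by (intro tendsto_power Q.nrm_tendsto[OF tW fW lq])
  then have mq: "(\<lambda>n. nsq (\<lambda>p. pX (pX (\<phi> n)) p + pY (pY (\<phi> n)) p)) \<longlonglongrightarrow> Re (biharmonic_form h f f)"
    unfolding biharmonic_form_test[OF t] Q.nrm_sq[OF tW] Q.nrm_sq[OF fW] .
  have mi: "(\<lambda>n. L2_inner ?U (\<phi> n) (\<eta> i)) \<longlonglongrightarrow> L2_inner ?U f (\<eta> i)" if "i \<in> {..<d}" for i
    using L2.inner_tendsto[OF tL fL \<eta> l0[unfolded L2_norm_eq]] that by simp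
  show ?thesis
  proof (rule LIMSEQ_le[OF _ mq])
    show "(\<lambda>n. c * nsq (\<phi> n) - (\<Sum>i<d. e i * (cmod (L2_inner ?U (\<phi> n) (\<eta> i)))\<^sup>2)) \<longlonglongrightarrow>
        c * Re (L2_inner ?U f f) - (\<Sum>i<d. e i * (cmod (L2_inner ?U f (\<eta> i)))\<^sup>2)"
      by (intro tendsto_diff tendsto_mult tendsto_const m0 tendsto_sum tendsto_power tendsto_norm mi)
  qed (use test[OF t] in blast)
qed

text \<open>Among the combinations of the first \<open>k\<close> eigenfunctions there is one
  orthogonal to the \<open>d < k\<close> functions \<open>\<eta> i\<close>. The correction vanishes
  on it, and its Rayleigh quotient lies between \<open>c\<close> and \<open>\<mu> k\<close>.\<close>

lemma biharmonic_eigenvalue_lower_bound: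
  assumes ev: "lists_eigenvalues (rect h) (biharmonic_dir h) \<mu>" and dk: "d < k"
    and test: "\<And>\<phi>. \<phi> \<in> test_functions (rect h) \<Longrightarrow>
      c * nsq \<phi> - (\<Sum>i<d. e i * (cmod (L2_inner (rect h) \<phi> (\<eta> i)))\<^sup>2) \<le> nsq (\<lambda>p. pX (pX \<phi>) p + pY (pY \<phi>) p)"
    and \<eta>: "\<And>i. i < d \<Longrightarrow> \<eta> i \<in> L2 (rect h)"
  shows "c \<le> \<mu> k"
proof -
  let ?U = "rect h"
  have sub: "W22_0 ?U \<subseteq> L2 ?U" using W22_0_sub W22_D(1) by blast
  interpret form_pair "W22_0 ?U" "L2_inner ?U" "biharmonic_form h"
    by (rule form_pair.intro[OF semi_inner_W22_0[OF open_rect semi_inner_W22_parts(1)[OF open_rect]]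
          semi_inner_W22_0[OF open_rect semi_inner_biharmonic]])
  have T: "biharmonic_dir h = form_operator ?U (W22_0 ?U) (biharmonic_form h)"
    by (simp add: biharmonic_dir_def biharmonic_form_def[abs_def])
  interpret spectral_form "W22_0 ?U" "L2_inner ?U" "biharmonic_form h" ?U "biharmonic_dir h"
  proof
    show "f \<in> eigenspace (biharmonic_dir h) r \<longleftrightarrow> eigvec r f" for f r
      unfolding T eigenspace_form_operator[OF sub] eigvec_def ..
    show "u \<in> W22_0 ?U \<Longrightarrow> L2_inner ?U u u = 0 \<longleftrightarrow> (AE x in lborel. x \<in> ?U \<longrightarrow> u x = 0)" for u
      using L2_null_iff sub by blast
  qed
  obtain f where f: "f \<in> W22_0 ?U" "L2_inner ?U f f \<noteq> 0" "\<And>j. j < d \<Longrightarrow> L2_inner ?U f (\<eta> j) = 0"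
    "Re (biharmonic_form h f f) \<le> \<mu> k * Re (L2_inner ?U f f)"
  proof (rule span_of_first_eigenvectors[OF ev dk, of "\<lambda>j f. L2_inner ?U f (\<eta> j)"])
    fix j a g assume j: "j < d" and g: "\<And>i. i < k \<Longrightarrow> g i \<in> W22_0 ?U"
    show "L2_inner ?U (\<lambda>x. \<Sum>i<k. a i * g i x) (\<eta> j) = (\<Sum>i<k. a i * L2_inner ?U (g i) (\<eta> j))"
      by (rule L2.sum_left[OF _ \<eta>[OF j]]) (use g sub in auto)
  qed blast
  have fL: "f \<in> L2 ?U" using f(1) sub by blast
  have "(\<Sum>i<d. e i * (cmod (L2_inner ?U f (\<eta> i)))\<^sup>2) = 0" using f(3) by simp
  with biharmonic_lower_bound_closure[OF test \<eta> f(1)] f(4)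
  have le: "c * Re (L2_inner ?U f f) \<le> \<mu> k * Re (L2_inner ?U f f)" by simp
  have "Re (L2_inner ?U f f) \<noteq> 0" using L2.self_real[OF fL] f(2) by auto
  then have "Re (L2_inner ?U f f) > 0" using L2.nonneg[OF fL] by simp
  then show ?thesis using le by simp
qed

theorem theorem3:
  fixes h :: real and \<mu> :: "nat \<Rightarrow> real" and \<rho> :: "nat \<Rightarrow> real \<Rightarrow> real"
  assumes "h > 0"
    and "lists_eigenvalues (rect h) (biharmonic_dir h) \<mu>"
    and "\<And>\<alpha>. lists_eigenvalues {0<..<1} (H_op 1 \<alpha>) (\<lambda>n. \<rho> n \<alpha>)"
  shows "\<rho> 1 (pi\<^sup>2 * h\<^sup>2) / h ^ 4 + \<rho> 1 (pi\<^sup>2 / h\<^sup>2) - 2 * pi ^ 4 / h\<^sup>2 \<le> \<mu> 1 \<and>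
         min (\<rho> 1 (pi\<^sup>2 * h\<^sup>2) / h ^ 4 + \<rho> 2 (pi\<^sup>2 / h\<^sup>2) - 2 * pi ^ 4 / h\<^sup>2)
              (\<rho> 3 (pi\<^sup>2 * h\<^sup>2) / h ^ 4 + \<rho> 1 (pi\<^sup>2 / h\<^sup>2) - 2 * pi ^ 4 / h\<^sup>2) \<le> \<mu> 3"
proof -
  note h = assms(1) and ev = assms(2) and evA = assms(3)[of "pi\<^sup>2 * h\<^sup>2"] and evB = assms(3)[of "pi\<^sup>2 / h\<^sup>2"]
  have \<beta>: "pi\<^sup>2 / h\<^sup>2 > 0" using h by simp
  let ?r = "\<lambda>n. \<rho> n (pi\<^sup>2 * h\<^sup>2)" and ?t = "\<lambda>n. \<rho> n (pi\<^sup>2 / h\<^sup>2)"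
  have A1: "?r 1 / h ^ 4 * nsq v \<le> nsq (partial_deriv 1 (partial_deriv 1 v)) + 2 * pi\<^sup>2 * nsq (partial_deriv 1 v)"
    if v: "v \<in> test_functions {0<..<h}" for v
  proof (rule H_lower_bound_rescaled[OF h evA, of 0])
    fix \<Phi> :: "nat \<Rightarrow> real \<Rightarrow> complex" and e :: "nat \<Rightarrow> real" assume 2: "\<And>v. v \<in> test_functions {0<..<h} \<Longrightarrow>
      ?r (Suc 0) / h ^ 4 * nsq v - (\<Sum>i<0. e i * (cmod (LINT x|lborel. v x * cnj (\<Phi> i x)))\<^sup>2)
      \<le> nsq (partial_deriv 1 (partial_deriv 1 v)) + 2 * pi\<^sup>2 * nsq (partial_deriv 1 v)"
    show ?thesis using 2[OF v] by simp
  qed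
  obtain \<Phi> :: "nat \<Rightarrow> real \<Rightarrow> complex" and e :: "nat \<Rightarrow> real" where \<Phi>: "\<And>i. i < 2 \<Longrightarrow> \<Phi> i \<in> L2 UNIV"
    and A3: "\<And>v. v \<in> test_functions {0<..<h} \<Longrightarrow>
      ?r (Suc 2) / h ^ 4 * nsq v - (\<Sum>i<2. e i * (cmod (LINT x|lborel. v x * cnj (\<Phi> i x)))\<^sup>2)
      \<le> nsq (partial_deriv 1 (partial_deriv 1 v)) + 2 * pi\<^sup>2 * nsq (partial_deriv 1 v)"
  proof (rule H_lower_bound_rescaled[OF h evA, of 2])
    fix \<Phi> :: "nat \<Rightarrow> real \<Rightarrow> complex" and e :: "nat \<Rightarrow> real" assume "\<And>i. i < 2 \<Longrightarrow> \<Phi> i \<in> L2 UNIV"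
      "\<And>v. v \<in> test_functions {0<..<h} \<Longrightarrow>
      ?r (Suc 2) / h ^ 4 * nsq v - (\<Sum>i<2. e i * (cmod (LINT x|lborel. v x * cnj (\<Phi> i x)))\<^sup>2)
      \<le> nsq (partial_deriv 1 (partial_deriv 1 v)) + 2 * pi\<^sup>2 * nsq (partial_deriv 1 v)"
    then show thesis by (rule that)
  qed
  have B1: "?t 1 * nsq u \<le> nsq (partial_deriv 1 (partial_deriv 1 u)) + 2 * (pi\<^sup>2 / h\<^sup>2) * nsq (partial_deriv 1 u)"
    if u: "u \<in> test_functions {0<..<1}" for u :: "real \<Rightarrow> complex"
  proof (rule H_lower_bound[OF \<beta> evB, of 0])
    fix \<phi> :: "nat \<Rightarrow> real \<Rightarrow> complex" assume 2: "\<And>u::real \<Rightarrow> complex. u \<in> test_functions {0<..<1} \<Longrightarrow>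
      ?t (Suc 0) * (LINT x|lborel. (cmod (u x))\<^sup>2)
        - (\<Sum>i<0. (?t (Suc 0) - ?t (Suc i)) * (cmod (LINT x|lborel. u x * cnj (\<phi> i x)))\<^sup>2)
      \<le> (LINT x|lborel. (cmod (partial_deriv 1 (partial_deriv 1 u) x))\<^sup>2)
        + 2 * (pi\<^sup>2 / h\<^sup>2) * (LINT x|lborel. (cmod (partial_deriv 1 u x))\<^sup>2)"
    show ?thesis using 2[OF u] by (simp add: nsq_def)
  qed
  \<comment> \<open>The single function in the correction for \<open>m = 1\<close>; it takes the
    part of the lowest eigenfunction in \<open>y\<close>.\<close>
  obtain \<psi> :: "real \<Rightarrow> complex" where \<psi>: "\<psi> \<in> L2 UNIV \<and> (\<forall>x. x \<notin> {0<..<1} \<longrightarrow> \<psi> x = 0) \<and> (\<psi> = (\<lambda>x. 0) \<or> nsq \<psi> = 1)"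
    and B2: "\<And>u. u \<in> test_functions {0<..<1} \<Longrightarrow>
      ?t 2 * nsq u - (?t 2 - ?t 1) * (cmod (LINT x|lborel. u x * cnj (\<psi> x)))\<^sup>2
      \<le> nsq (partial_deriv 1 (partial_deriv 1 u)) + 2 * (pi\<^sup>2 / h\<^sup>2) * nsq (partial_deriv 1 u)"
  proof (rule H_lower_bound[OF \<beta> evB, of 1])
    fix \<phi> :: "nat \<Rightarrow> real \<Rightarrow> complex" assume 1: "\<And>i::nat. i < 1 \<Longrightarrow> \<phi> i \<in> L2 UNIV \<and> (\<forall>x. x \<notin> {0<..<1} \<longrightarrow> \<phi> i x = 0) \<and>
        (\<phi> i = (\<lambda>x. 0) \<or> (LINT x|lborel. (cmod (\<phi> i x))\<^sup>2) = 1)"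
      and 2: "\<And>u::real \<Rightarrow> complex. u \<in> test_functions {0<..<1} \<Longrightarrow>
      ?t (Suc 1) * (LINT x|lborel. (cmod (u x))\<^sup>2)
        - (\<Sum>i<1. (?t (Suc 1) - ?t (Suc i)) * (cmod (LINT x|lborel. u x * cnj (\<phi> i x)))\<^sup>2)
      \<le> (LINT x|lborel. (cmod (partial_deriv 1 (partial_deriv 1 u) x))\<^sup>2)
        + 2 * (pi\<^sup>2 / h\<^sup>2) * (LINT x|lborel. (cmod (partial_deriv 1 u x))\<^sup>2)"
    show thesis
      by (rule that[of "\<phi> 0"]) (use 1[of 0] 2 in \<open>simp_all add: nsq_def numeral_2_eq_2\<close>)
  qed
  interpret w0: weight "\<lambda>_. 0" by standard (simp_all add: L2_zero)
  interpret w: weight \<psi> by standard (use \<psi> in auto)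
  have "?r 1 / h ^ 4 + ?t 1 - 2 * pi ^ 4 / h\<^sup>2 \<le> \<mu> 1"
  proof (rule biharmonic_eigenvalue_lower_bound[OF ev, of 0 1 _ "\<lambda>_. 0" "\<lambda>_ _. 0"])
    fix \<phi> assume \<phi>: "\<phi> \<in> test_functions (rect h)"
    show "(?r 1 / h ^ 4 + ?t 1 - 2 * pi ^ 4 / h\<^sup>2) * nsq \<phi> - (\<Sum>i<(0::nat). 0 * (cmod (L2_inner (rect h) \<phi> (\<lambda>_. 0)))\<^sup>2)
        \<le> nsq (\<lambda>p. pX (pX \<phi>) p + pY (pY \<phi>) p)"
      \<comment> \<open>With the zero weight all of \<open>\<phi>\<close> is remainder; taking
        \<open>a3 = a1\<close> and \<open>b2 = b1\<close> makes the two entries of the minimum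
        equal.\<close>
      using w0.biharmonic_form_lower_bound[OF h \<phi> A1, of "?r 1 / h ^ 4" "\<lambda>_. 0" "?t 1" "?t 1"] A1 B1 by simp
  qed simp_all
  moreover have "min (?r 1 / h ^ 4 + ?t 2) (?r 3 / h ^ 4 + ?t 1) - 2 * pi ^ 4 / h\<^sup>2 \<le> \<mu> 3"
  proof (rule biharmonic_eigenvalue_lower_bound[OF ev])
    show "(2::nat) < 3" by simp
    have \<eta>: "(\<lambda>p. \<Phi> i (fst p) * \<psi> (snd p)) \<in> L2 UNIV" if "i < 2" for i by (rule L2_tensor[OF \<Phi>[OF that] w.L2])
    show "(\<lambda>p. \<Phi> i (fst p) * \<psi> (snd p)) \<in> L2 (rect h)" if "i < 2" for i
    proof -
      have "set_borel_measurable lborel (rect h) (\<lambda>p. \<Phi> i (fst p) * \<psi> (snd p))"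
        by (rule set_borel_measurable_subset[of _ UNIV]) (use \<eta>[OF that] open_rect in \<open>auto simp: L2_def\<close>)
      moreover have "set_integrable lborel (rect h) (\<lambda>p. (cmod (\<Phi> i (fst p) * \<psi> (snd p)))\<^sup>2)"
        by (rule set_integrable_subset[of _ UNIV]) (use \<eta>[OF that] open_rect in \<open>auto simp: L2_def\<close>)
      ultimately show ?thesis by (simp add: L2_def)
    qed
    fix \<phi> assume \<phi>: "\<phi> \<in> test_functions (rect h)"
    \<comment> \<open>The correction acts on the component \<open>gint \<psi> \<phi>\<close>. By
      Fubini it is a pairing of \<open>\<phi>\<close> with tensor products, hence of rank two on the
      rectangle, which is why the third eigenvalue is bounded.\<close>
    have ip: "(LINT x|lborel. gint \<psi> \<phi> x * cnj (\<Phi> i x)) = L2_inner (rect h) \<phi> (\<lambda>p. \<Phi> i (fst p) * \<psi> (snd p))" if i: "i < 2" for i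
    proof -
      let ?F = "\<lambda>p. \<phi> p * cnj (\<Phi> i (fst p) * \<psi> (snd p))"
      have "integrable lborel ?F"
        using L2_inner_integrable[OF csupp_L2[OF csupp_test[OF \<phi>]] \<eta>[OF i]] by (simp add: set_integrable_def)
      then have "(LINT p|lborel. ?F p) = (LINT x|lborel. LINT y|lborel. ?F (x, y))" by (rule fubini(1)[symmetric])
      also have "\<dots> = (LINT x|lborel. gint \<psi> \<phi> x * cnj (\<Phi> i x))"
      proof -
        have "(LINT y|lborel. ?F (x, y)) = (LINT y|lborel. \<phi> (x, y) * cnj (\<psi> y) * cnj (\<Phi> i x))" for x
          by (simp add: mult_ac)
        then show ?thesis by (simp add: gint_def)
      qed
      finally have "(LINT x|lborel. gint \<psi> \<phi> x * cnj (\<Phi> i x)) = (LINT p|lborel. ?F p)" ..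
      also have "\<dots> = L2_inner (rect h) \<phi> (\<lambda>p. \<Phi> i (fst p) * \<psi> (snd p))"
        unfolding L2_inner_def set_lebesgue_integral_def
        by (intro Bochner_Integration.integral_cong refl) (use \<phi> in \<open>auto simp: indicator_def test_functions_iff\<close>)
      finally show ?thesis .
    qed
    have S: "(\<Sum>i<2. e i * (cmod (LINT x|lborel. gint \<psi> \<phi> x * cnj (\<Phi> i x)))\<^sup>2) =
        (\<Sum>i<2. e i * (cmod (L2_inner (rect h) \<phi> (\<lambda>p. \<Phi> i (fst p) * \<psi> (snd p))))\<^sup>2)"
      by (rule sum.cong) (simp_all add: ip)
    show "(min (?r 1 / h ^ 4 + ?t 2) (?r 3 / h ^ 4 + ?t 1) - 2 * pi ^ 4 / h\<^sup>2) * nsq \<phi>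
        - (\<Sum>i<2. e i * (cmod (L2_inner (rect h) \<phi> (\<lambda>p. \<Phi> i (fst p) * \<psi> (snd p))))\<^sup>2)
        \<le> nsq (\<lambda>p. pX (pX \<phi>) p + pY (pY \<phi>) p)"
      using w.biharmonic_form_lower_bound[OF h \<phi> A1 A3 B2] unfolding S by simp
  qed
  ultimately show ?thesis by (simp add: min_diff_distrib_left)
qed

end
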